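(* Assume the Ultrapower Axiom. Then the Mitchell order wellorders the class of Dodd solid ultrafilters.
   Context: For a countably complete ultrafilter \(U\), \(\mathrm{Ult}(V,U)\) is the transitive collapse of the ultrapower, \(j_U\) its embedding and \([\mathrm{id}]_U\) the class of the identity. The Mitchell order: \(U_0<_M U_1\) iff \(U_0\in\mathrm{Ult}(V,U_1)\). A uniform ultrafilter is a countably complete ultrafilter \(U\) on \([\kappa]^n\) (the \(n\)-element subsets of an ordinal \(\kappa\)) with \(\kappa\) least such that \([\kappa]^n\in U\); \(\mathrm{sp}(U)=\kappa\). Finite sets of ordinals are ordered by \(a<b\) iff the largest element of their symmetric difference lies in \(b\). For a uniform \(U\) and finite set of ordinals \(a\), the extender of \(U\) below \(a\) is the function \(U|a\) with domain \(P(\mathrm{sp}(U))\) given by \(U|a(X)=j_U(X)\cap\{b\in[\mathrm{Ord}]^{<\omega}:b<a\}\). A nonprincipal uniform ultrafilter \(U\) is Dodd solid if \(U|[\mathrm{id}]_U\in\mathrm{Ult}(V,U)\). A comparison of \(\langle U_0,U_1\rangle\) by internal ultrafilters is a pair \(\langle W_0,W_1\rangle\) with \(W_i\in\mathrm{Ult}(V,U_i)\) a countably complete ultrafilter there, \(\mathrm{Ult}(\mathrm{Ult}(V,U_0),W_0)=\mathrm{Ult}(\mathrm{Ult}(V,U_1),W_1)\) and \(j_{W_0}\circ j_{U_0}=j_{W_1}\circ j_{U_1}\). The Ultrapower Axiom: every pair of countably complete ultrafilters admits such a comparison.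
   Formalization: The extender U|a is taken with domain P([sp(U)]^{<ω}) instead of P(sp(U)): for sets X of ordinals, j_U(X)∩[Ord]^{<ω} contains only natural numbers, and the claim would then fail for two copies of one normal measure, on [κ]^1 and [κ]^2. *)

theory Defs
  imports Main
begin

section \<open>Models of ZFC\<close>

text \<open>
  The universe of sets is an arbitrary type \<open>'v\<close>; the membership relation is given by
  \<^term>\<open>elts\<close>, which sends a set to the class of its elements. Classes are HOL sets of type
  \<open>'v set\<close>; the universe \<open>V\<close> is \<open>UNIV :: 'v set\<close>. The theory is first-order ZFC: the two axiom
  schemes, and the classes of sets about which the theory speaks, range over formulas of the
  language of set theory with parameters, not over all HOL predicates. In particular the
  membership relation is not required to be wellfounded outside the model, and notions such as
  finiteness and countability are those of the model.
\<close>

text \<open>Variables are de Bruijn indices.\<close>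

datatype fm = Member nat nat | Equal nat nat | Neg fm | Conj fm fm | Forall fm

class membership =
  fixes elts :: "'a \<Rightarrow> 'a set"
begin

primrec sat :: "fm \<Rightarrow> (nat \<Rightarrow> 'a) \<Rightarrow> bool" where
  "sat (Member i j) e \<longleftrightarrow> e i \<in> elts (e j)"
| "sat (Equal i j) e \<longleftrightarrow> e i = e j"
| "sat (Neg p) e \<longleftrightarrow> \<not> sat p e"
| "sat (Conj p q) e \<longleftrightarrow> sat p e \<and> sat q e"
| "sat (Forall p) e \<longleftrightarrow> (\<forall>x. sat p (case_nat x e))"

definition definable_class :: "'a set \<Rightarrow> bool" where
  "definable_class A \<longleftrightarrow> (\<exists>p e. A = {x. sat p (case_nat x e)})"

end

class zfc = membership +
  assumes extensionality: "elts x = elts y \<Longrightarrow> x = y"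
    and foundation: "elts x \<noteq> {} \<Longrightarrow> \<exists>y\<in>elts x. elts y \<inter> elts x = {}"
    and pairing: "\<exists>z. elts z = {x, y}"
    and union: "\<exists>z. elts z = (\<Union>y\<in>elts x. elts y)"
    and power_set: "\<exists>z. elts z = {y. elts y \<subseteq> elts x}"
    and infinity: "\<exists>z. (\<exists>x\<in>elts z. elts x = {}) \<and>
                       (\<forall>x\<in>elts z. \<exists>y\<in>elts z. elts y = insert x (elts x))"
    and separation: "\<exists>z. elts z = {y \<in> elts x. sat p (case_nat y e)}"
    and replacement:
      "(\<And>y z z'. y \<in> elts x \<Longrightarrow> sat p (case_nat y (case_nat z e)) \<Longrightarrow>
          sat p (case_nat y (case_nat z' e)) \<Longrightarrow> z = z') \<Longrightarrow>
       \<exists>w. elts w = {z. \<exists>y\<in>elts x. sat p (case_nat y (case_nat z e))}"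
    and choice:
      "(\<And>y. y \<in> elts x \<Longrightarrow> elts y \<noteq> {}) \<Longrightarrow>
       (\<And>y z. y \<in> elts x \<Longrightarrow> z \<in> elts x \<Longrightarrow> y \<noteq> z \<Longrightarrow> elts y \<inter> elts z = {}) \<Longrightarrow>
       \<exists>c. \<forall>y\<in>elts x. \<exists>!z. z \<in> elts c \<and> z \<in> elts y"


section \<open>Basic set theory\<close>

text \<open>The set with extension \<open>A\<close>; only meaningful if the class \<open>A\<close> is a set of the model.\<close>

definition vset :: "'v::zfc set \<Rightarrow> 'v" where
  "vset A = (THE x. elts x = A)"

definition vpair :: "'v::zfc \<Rightarrow> 'v \<Rightarrow> 'v" where
  "vpair x y = vset {vset {x}, vset {x, y}}"

definition vfun :: "'v::zfc \<Rightarrow> 'v \<Rightarrow> bool" where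
  "vfun f X \<longleftrightarrow> (\<forall>z\<in>elts f. \<exists>x\<in>elts X. \<exists>y. z = vpair x y) \<and>
                (\<forall>x\<in>elts X. \<exists>!y. vpair x y \<in> elts f)"

definition app :: "'v::zfc \<Rightarrow> 'v \<Rightarrow> 'v" where
  "app f x = (THE y. vpair x y \<in> elts f)"

definition vlam :: "'v::zfc \<Rightarrow> ('v \<Rightarrow> 'v) \<Rightarrow> 'v" where
  "vlam X F = vset ((\<lambda>x. vpair x (F x)) ` elts X)"

definition vPow :: "'v::zfc \<Rightarrow> 'v" where
  "vPow X = vset {A. elts A \<subseteq> elts X}"

definition transitive_set :: "'v::zfc \<Rightarrow> bool" where
  "transitive_set x \<longleftrightarrow> (\<forall>y\<in>elts x. elts y \<subseteq> elts x)"

definition Ord :: "'v::zfc \<Rightarrow> bool" where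
  "Ord \<alpha> \<longleftrightarrow> transitive_set \<alpha> \<and> (\<forall>\<beta>\<in>elts \<alpha>. transitive_set \<beta>)"

text \<open>The natural numbers of the model: ordinals \<open>n\<close> such that every \<open>m \<le> n\<close> is zero or a
  successor.\<close>

definition natural :: "'v::zfc \<Rightarrow> bool" where
  "natural n \<longleftrightarrow> Ord n \<and>
     (\<forall>m\<in>insert n (elts n). elts m = {} \<or> (\<exists>k. elts m = insert k (elts k)))"

definition omega :: "'v::zfc" where
  "omega = vset {n. natural n}"

definition has_size :: "'v::zfc \<Rightarrow> 'v \<Rightarrow> bool" where
  "has_size b n \<longleftrightarrow> (\<exists>f. vfun f n \<and> bij_betw (app f) (elts n) (elts b))"

definition vfinite :: "'v::zfc \<Rightarrow> bool" where
  "vfinite b \<longleftrightarrow> (\<exists>n. natural n \<and> has_size b n)"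

text \<open>\<open>[X]\<^sup>n\<close> and \<open>[X]\<^sup><\<^sup>\<omega>\<close>\<close>

definition nsubsets :: "'v::zfc \<Rightarrow> 'v \<Rightarrow> 'v" where
  "nsubsets X n = vset {b. elts b \<subseteq> elts X \<and> has_size b n}"

definition finsubsets :: "'v::zfc \<Rightarrow> 'v" where
  "finsubsets X = vset {b. elts b \<subseteq> elts X \<and> vfinite b}"

definition fin_ords :: "'v::zfc set" where
  "fin_ords = {b. (\<forall>\<xi>\<in>elts b. Ord \<xi>) \<and> vfinite b}"

definition fin_less :: "'v::zfc \<Rightarrow> 'v \<Rightarrow> bool" where
  "fin_less a b \<longleftrightarrow> (\<exists>\<delta>\<in>elts b - elts a.
     \<forall>\<xi>\<in>(elts a - elts b) \<union> (elts b - elts a). \<xi> = \<delta> \<or> \<xi> \<in> elts \<delta>)"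


section \<open>Ultrafilters and ultrapowers\<close>

text \<open>
  The next notions are relative to a transitive class \<open>M\<close>, which is either \<open>V\<close> or an ultrapower
  of \<open>V\<close>: they express what \<open>M\<close> believes. The notions of the previous section used here (pairs,
  functions, application, \<open>\<omega>\<close>) are absolute and therefore need no relativization.
\<close>

definition cc_ultrafilter_on :: "'v::zfc set \<Rightarrow> 'v \<Rightarrow> 'v \<Rightarrow> bool" where
  "cc_ultrafilter_on M X U \<longleftrightarrow>
     U \<in> M \<and>
     (\<forall>A\<in>elts U. elts A \<subseteq> elts X) \<and>
     X \<in> elts U \<and>
     vset {} \<notin> elts U \<and>
     (\<forall>A\<in>elts U. \<forall>B\<in>M. elts A \<subseteq> elts B \<and> elts B \<subseteq> elts X \<longrightarrow> B \<in> elts U) \<and>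
     (\<forall>A\<in>elts U. \<forall>B\<in>elts U. vset (elts A \<inter> elts B) \<in> elts U) \<and>
     (\<forall>A\<in>M. elts A \<subseteq> elts X \<longrightarrow> A \<in> elts U \<or> vset (elts X - elts A) \<in> elts U) \<and>
     (\<forall>s\<in>M. vfun s omega \<and> (\<forall>n\<in>elts omega. app s n \<in> elts U) \<longrightarrow>
        vset (\<Inter>n\<in>elts omega. elts (app s n)) \<in> elts U)"

definition cc_ultrafilter :: "'v::zfc set \<Rightarrow> 'v \<Rightarrow> bool" where
  "cc_ultrafilter M U \<longleftrightarrow> (\<exists>X. cc_ultrafilter_on M X U)"

text \<open>The underlying set of an ultrafilter is the union of its members.\<close>

definition carrier :: "'v::zfc \<Rightarrow> 'v" where
  "carrier U = vset (\<Union>A\<in>elts U. elts A)"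

definition ult_funs :: "'v::zfc set \<Rightarrow> 'v \<Rightarrow> 'v set" where
  "ult_funs M U = {f \<in> M. vfun f (carrier U)}"

definition ult_eq :: "'v::zfc \<Rightarrow> 'v \<Rightarrow> 'v \<Rightarrow> bool" where
  "ult_eq U f g \<longleftrightarrow> vset {x \<in> elts (carrier U). app f x = app g x} \<in> elts U"

definition ult_mem :: "'v::zfc \<Rightarrow> 'v \<Rightarrow> 'v \<Rightarrow> bool" where
  "ult_mem U f g \<longleftrightarrow> vset {x \<in> elts (carrier U). app f x \<in> elts (app g x)} \<in> elts U"

text \<open>
  The transitive collapse of the ultrapower is a class function on the proper class
  \<^term>\<open>ult_funs M U\<close>, whose equivalence classes modulo \<^term>\<open>ult_eq U\<close> are proper classes too. As
  in any definition by recursion it is the union of its set approximations: \<open>p\<close> is the collapse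
  restricted to a set \<open>t\<close> of functions that contains, up to equality modulo \<open>U\<close>, every
  ultrapower-element of each of its members.
\<close>

definition collapse_approx :: "'v::zfc set \<Rightarrow> 'v \<Rightarrow> 'v \<Rightarrow> 'v \<Rightarrow> bool" where
  "collapse_approx M U t p \<longleftrightarrow>
     t \<in> M \<and> p \<in> M \<and> elts t \<subseteq> ult_funs M U \<and> vfun p t \<and>
     (\<forall>g\<in>elts t. \<forall>f\<in>ult_funs M U. ult_mem U f g \<longrightarrow> (\<exists>f'\<in>elts t. ult_eq U f' f)) \<and>
     (\<forall>g\<in>elts t. elts (app p g) = {app p f |f. f \<in> elts t \<and> ult_mem U f g})"

text \<open>\<open>[f]\<^sub>U\<close>, \<open>Ult(M,U)\<close>, \<open>j\<^sub>U : M \<rightarrow> Ult(M,U)\<close> and \<open>[id]\<^sub>U\<close>\<close>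

definition ult_class :: "'v::zfc set \<Rightarrow> 'v \<Rightarrow> 'v \<Rightarrow> 'v" where
  "ult_class M U f = (THE x. \<exists>t p. collapse_approx M U t p \<and> f \<in> elts t \<and> x = app p f)"

definition Ult :: "'v::zfc set \<Rightarrow> 'v \<Rightarrow> 'v set" where
  "Ult M U = ult_class M U ` ult_funs M U"

definition ult_emb :: "'v::zfc set \<Rightarrow> 'v \<Rightarrow> 'v \<Rightarrow> 'v" where
  "ult_emb M U x = ult_class M U (vlam (carrier U) (\<lambda>_. x))"

definition ult_id :: "'v::zfc set \<Rightarrow> 'v \<Rightarrow> 'v" where
  "ult_id M U = ult_class M U (vlam (carrier U) (\<lambda>x. x))"

definition mitchell_less :: "'v::zfc \<Rightarrow> 'v \<Rightarrow> bool" where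
  "mitchell_less U0 U1 \<longleftrightarrow> U0 \<in> Ult UNIV U1"


section \<open>Dodd solid ultrafilters\<close>

definition uniform_on :: "'v::zfc \<Rightarrow> 'v \<Rightarrow> 'v \<Rightarrow> bool" where
  "uniform_on \<kappa> n U \<longleftrightarrow> Ord \<kappa> \<and> natural n \<and> cc_ultrafilter_on UNIV (nsubsets \<kappa> n) U \<and>
     (\<forall>\<alpha>\<in>elts \<kappa>. nsubsets \<alpha> n \<notin> elts U)"

definition uniform_ultrafilter :: "'v::zfc \<Rightarrow> bool" where
  "uniform_ultrafilter U \<longleftrightarrow> (\<exists>\<kappa> n. uniform_on \<kappa> n U)"

definition sp :: "'v::zfc \<Rightarrow> 'v" where
  "sp U = (THE \<kappa>. \<exists>n. uniform_on \<kappa> n U)"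

definition nonprincipal :: "'v::zfc \<Rightarrow> bool" where
  "nonprincipal U \<longleftrightarrow> (\<forall>x\<in>elts (carrier U). vset {x} \<notin> elts U)"

text \<open>
  The extender \<open>U|a\<close>. Its arguments are the sets \<open>X \<subseteq> [sp(U)]\<^sup><\<^sup>\<omega>\<close> of finite sets of ordinals, so
  that \<open>j\<^sub>U(X)\<close> is again a set of finite sets of ordinals and intersecting it with
  \<open>{b \<in> [Ord]\<^sup><\<^sup>\<omega>. b < a}\<close> makes sense. With arguments \<open>X \<subseteq> sp(U)\<close>, that is, sets of
  ordinals, the intersection would contain nothing but natural numbers.
\<close>

definition extender_below :: "'v::zfc \<Rightarrow> 'v \<Rightarrow> 'v" where
  "extender_below U a = vlam (vPow (finsubsets (sp U)))
     (\<lambda>X. vset (elts (ult_emb UNIV U X) \<inter> {b \<in> fin_ords. fin_less b a}))"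

definition dodd_solid :: "'v::zfc \<Rightarrow> bool" where
  "dodd_solid U \<longleftrightarrow> uniform_ultrafilter U \<and> nonprincipal U \<and>
     extender_below U (ult_id UNIV U) \<in> Ult UNIV U"


section \<open>The Ultrapower Axiom\<close>

definition comparison :: "'v::zfc \<Rightarrow> 'v \<Rightarrow> 'v \<Rightarrow> 'v \<Rightarrow> bool" where
  "comparison U0 U1 W0 W1 \<longleftrightarrow>
     cc_ultrafilter (Ult UNIV U0) W0 \<and> cc_ultrafilter (Ult UNIV U1) W1 \<and>
     Ult (Ult UNIV U0) W0 = Ult (Ult UNIV U1) W1 \<and>
     (\<forall>x. ult_emb (Ult UNIV U0) W0 (ult_emb UNIV U0 x) =
          ult_emb (Ult UNIV U1) W1 (ult_emb UNIV U1 x))"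

definition ultrapower_axiom :: "'v::zfc itself \<Rightarrow> bool" where
  "ultrapower_axiom TYPE('v) \<longleftrightarrow>
     (\<forall>U0 U1 :: 'v. cc_ultrafilter UNIV U0 \<and> cc_ultrafilter UNIV U1 \<longrightarrow>
        (\<exists>W0 W1. comparison U0 U1 W0 W1))"


section \<open>Wellorders of classes\<close>

text \<open>\<open>R\<close> is the strict order. Subclasses are definable ones (with parameters); this includes all
  subsets of \<open>A\<close>.\<close>

definition wellorders_class :: "('v::zfc \<Rightarrow> 'v \<Rightarrow> bool) \<Rightarrow> 'v set \<Rightarrow> bool" where
  "wellorders_class R A \<longleftrightarrow> irreflp_on A R \<and> transp_on A R \<and> totalp_on A R \<and>
     (\<forall>B. definable_class B \<and> B \<subseteq> A \<and> B \<noteq> {} \<longrightarrow> (\<exists>m\<in>B. \<forall>x\<in>B. x \<noteq> m \<longrightarrow> R m x))"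

end

theory Submission
  imports Defs
begin

text \<open>
  Write \<open>M\<^sub>U = Ult(V,U)\<close>. A comparison of \<open>U\<^sub>0\<close> and \<open>U\<^sub>1\<close> sends both seeds \<open>[id]\<close> to finite sets of
  ordinals \<open>a\<^sub>0\<close> and \<open>a\<^sub>1\<close> of the common target. If \<open>a\<^sub>0 = a\<^sub>1\<close>, then \<open>U\<^sub>0 = U\<^sub>1\<close>. If \<open>a\<^sub>0 < a\<^sub>1\<close>, then \<open>U\<^sub>0\<close> is
  below \<open>U\<^sub>1\<close> in the Ketonen order, and \<open>U\<^sub>0\<close> is computed in \<open>M\<close> of \<open>U\<^sub>1\<close> from the extender
  \<open>U\<^sub>1|[id]\<close>; so \<open>U\<^sub>0\<close> precedes \<open>U\<^sub>1\<close> in the Mitchell order if \<open>U\<^sub>1\<close> is Dodd solid. The Ketonen order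
  is wellfounded, by countable completeness, so it remains to see that it extends the Mitchell
  order on Dodd solid ultrafilters. A nonprincipal Dodd solid \<open>U \<in> M\<^sub>U\<close> would be below itself in
  the Ketonen order. The other case is \<open>U\<^sub>0\<close> in \<open>M\<close> of \<open>U\<^sub>1\<close> with \<open>U\<^sub>1\<close> below \<open>U\<^sub>0\<close>, and so also \<open>U\<^sub>1\<close>
  in \<open>M\<close> of \<open>U\<^sub>0\<close>. By Kunen's inconsistency \<open>j\<close> of \<open>U\<^sub>1\<close> moves \<open>sp(U\<^sub>0)\<close>; hence \<open>U\<^sub>0 = [f]\<close> for a
  function \<open>f\<close> whose values live on smaller spaces and belong to \<open>M\<close> of \<open>U\<^sub>0\<close>. That class is closed
  under sequences of the relevant length, so it contains \<open>f\<close> and \<open>U\<^sub>0\<close>, which was excluded.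
\<close>

section \<open>Definability with parameters\<close>

text \<open>The model satisfies separation and replacement for formulas only and may be illfounded
  from outside, so every induction, recursion and choice over its sets carries a proof of
  definability. Los is proved once, over the universe; what is needed of ultrapowers of ultrapowers
  is packed into parameter-free predicates and transferred. Dodd solidity is used in three ways, all
  by reading the extender as a set of pairs: its arguments put every set of finite subsets of
  \<open>sp U\<close> into the ultrapower, its values replace \<open>J A\<close> under any measure
  concentrating below \<open>[id]\<close>, and its values at singletons give \<open>J\<close> itself
  at the points that \<open>J\<close> sends below \<open>[id]\<close>. The last yields closure under
  sequences, but only modulo null sets, so the final contradiction works with functions up to
  equality almost everywhere. Kunen's inconsistency is applied to the space of \<open>U0\<close>
  instead of an ordinal, since \<open>U0\<close> in the ultrapower puts all subsets of that space
  there. Transitivity is not proved directly: by linearity its failure would close a Ketonen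
  cycle.\<close>

primrec ren :: "(nat \<Rightarrow> nat) \<Rightarrow> fm \<Rightarrow> fm" where
  "ren f (Member i j) = Member (f i) (f j)"
| "ren f (Equal i j) = Equal (f i) (f j)"
| "ren f (Neg p) = Neg (ren f p)"
| "ren f (Conj p q) = Conj (ren f p) (ren f q)"
| "ren f (Forall p) = Forall (ren (case_nat 0 (\<lambda>k. Suc (f k))) p)"

lemma sat_ren: "sat (ren f p) e = sat p (\<lambda>i. e (f i))" for e :: "nat \<Rightarrow> 'v::zfc"
proof (induction p arbitrary: f e)
  case (Forall p)
  have "(\<lambda>i. case_nat x e (case_nat 0 (\<lambda>k. Suc (f k)) i)) = case_nat x (\<lambda>i. e (f i))" for x
    by (rule ext) (simp split: nat.split)
  then show ?case using Forall by simp
qed simp_all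

text \<open>\<open>vd P\<close> and \<open>dt T\<close> say that a predicate, respectively a term, of the variables \<open>e 0, e 1, \<dots>\<close>
  is definable with parameters. Since the HOL variables of \<open>P\<close> and \<open>T\<close> count as parameters, the rules
  \<open>vdi\<close> establish the instances of separation and replacement by mere syntax. In \<open>mrg\<close> the even
  positions hold the variables and the odd positions the parameters.\<close>

definition mrg :: "(nat \<Rightarrow> 'v) \<Rightarrow> (nat \<Rightarrow> 'v) \<Rightarrow> nat \<Rightarrow> 'v" where
  "mrg e c i = (if even i then e (i div 2) else c (i div 2))"

definition vd :: "((nat \<Rightarrow> 'v::zfc) \<Rightarrow> bool) \<Rightarrow> bool" where
  "vd P \<longleftrightarrow> (\<exists>p c. \<forall>e. P e \<longleftrightarrow> sat p (mrg e c))"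

definition dt :: "((nat \<Rightarrow> 'v::zfc) \<Rightarrow> 'v) \<Rightarrow> bool" where
  "dt T \<longleftrightarrow> vd (\<lambda>e. e 0 = T (\<lambda>i. e (Suc i)))"

named_theorems vdi

lemma vd_ren: assumes "vd P" shows "vd (\<lambda>e. P (\<lambda>i. e (g i)))"
proof -
  obtain p c where p: "\<And>e. P e \<longleftrightarrow> sat p (mrg e c)" using assms by (auto simp: vd_def)
  have "(\<lambda>i. mrg e c (if even i then 2 * g (i div 2) else i)) = mrg (\<lambda>i. e (g i)) c" for e
    by (rule ext) (simp add: mrg_def)
  then have "P (\<lambda>i. e (g i)) \<longleftrightarrow> sat (ren (\<lambda>i. if even i then 2 * g (i div 2) else i) p) (mrg e c)" for e
    by (simp add: sat_ren p)
  then show ?thesis unfolding vd_def by blast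
qed

lemma vd_not [vdi]: assumes "vd P" shows "vd (\<lambda>e. \<not> P e)"
proof -
  obtain p c where p: "\<And>e. P e \<longleftrightarrow> sat p (mrg e c)" using assms by (auto simp: vd_def)
  have "(\<not> P e) \<longleftrightarrow> sat (Neg p) (mrg e c)" for e by (simp add: p)
  then show ?thesis unfolding vd_def by blast
qed

lemma vd_conj [vdi]: assumes "vd P" "vd Q" shows "vd (\<lambda>e. P e \<and> Q e)"
proof -
  obtain p c where p: "\<And>e. P e \<longleftrightarrow> sat p (mrg e c)" using assms by (auto simp: vd_def)
  obtain q d where q: "\<And>e. Q e \<longleftrightarrow> sat q (mrg e d)" using assms by (auto simp: vd_def)
  \<comment> \<open>The parameter lists \<open>c\<close> and \<open>d\<close> have to share the odd
    positions. With \<open>mrg c d\<close> as the common list, \<open>c k\<close> sits at position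
    4k+1 and \<open>d k\<close> at 4k+3; the renamings send 2k+1 there.\<close>
  let ?f = "\<lambda>i. if even i then i else 2 * i - 1" and ?g = "\<lambda>i. if even i then i else 2 * i + 1"
  have 1: "(\<lambda>i. mrg e (mrg c d) (?f i)) = mrg e c" for e
    by (rule ext) (auto simp: mrg_def elim!: oddE; drule arg_cong[where f = even]; simp)
  have 2: "(\<lambda>i. mrg e (mrg c d) (?g i)) = mrg e d" for e
    by (rule ext) (auto simp: mrg_def elim!: oddE; drule arg_cong[where f = even]; simp)
  have "(P e \<and> Q e) \<longleftrightarrow> sat (Conj (ren ?f p) (ren ?g q)) (mrg e (mrg c d))" for e
    by (simp only: sat.simps sat_ren 1 2 p q)
  then show ?thesis unfolding vd_def by blast
qed

lemma vd_all [vdi]: assumes "vd (\<lambda>e. P (e 0) (\<lambda>i. e (Suc i)))" shows "vd (\<lambda>e. \<forall>x. P x e)"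
proof -
  obtain p c where p: "\<And>e. P (e 0) (\<lambda>i. e (Suc i)) \<longleftrightarrow> sat p (mrg e c)"
    using assms by (auto simp: vd_def)
  \<comment> \<open>Pushing \<open>x\<close> in front of \<open>mrg e c\<close> shifts every
    position by one, whereas pushing it in front of \<open>e\<close> alone shifts the even positions
    by two and leaves the odd ones; \<open>?f\<close> reconciles the two layouts.\<close>
  let ?f = "\<lambda>i. if i = 0 then 0 else if even i then i - 1 else i + 1"
  have 1: "(\<lambda>i. case_nat x (mrg e c) (?f i)) = mrg (case_nat x e) c" for x e
    by (rule ext) (auto simp: mrg_def elim!: oddE evenE split: nat.split; drule arg_cong[where f = even]; simp)
  have "P x e \<longleftrightarrow> sat (ren ?f p) (case_nat x (mrg e c))" for x e
    using p[of "case_nat x e"] by (simp only: sat_ren 1 nat.case)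
  then have "(\<forall>x. P x e) \<longleftrightarrow> sat (Forall (ren ?f p)) (mrg e c)" for e
    by simp
  then show ?thesis unfolding vd_def by blast
qed

lemma vd_eq_var: "vd (\<lambda>e. e i = e j)"
proof -
  have "(e i = e j) \<longleftrightarrow> sat (Equal (2*i) (2*j)) (mrg e (\<lambda>_. undefined))" for e :: "nat \<Rightarrow> 'a"
    by (simp add: mrg_def)
  then show ?thesis unfolding vd_def by blast
qed

lemma vd_mem_var: "vd (\<lambda>e. e i \<in> elts (e j))"
proof -
  have "(e i \<in> elts (e j)) \<longleftrightarrow> sat (Member (2*i) (2*j)) (mrg e (\<lambda>_. undefined))" for e :: "nat \<Rightarrow> 'a"
    by (simp add: mrg_def)
  then show ?thesis unfolding vd_def by blast
qed

lemma vd_const [vdi]: "vd (\<lambda>e. b)"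
proof (cases b)
  case True then show ?thesis using vd_eq_var[of 0 0] by simp
next
  case False then show ?thesis using vd_not[OF vd_eq_var[of 0 0]] by simp
qed

lemma vd_ex [vdi]: assumes "vd (\<lambda>e. P (e 0) (\<lambda>i. e (Suc i)))" shows "vd (\<lambda>e. \<exists>x. P x e)"
  using vd_not[OF vd_all[of "\<lambda>x e. \<not> P x e", OF vd_not[OF assms]]] by simp

lemma vd_disj [vdi]: "vd P \<Longrightarrow> vd Q \<Longrightarrow> vd (\<lambda>e. P e \<or> Q e)"
  using vd_not[OF vd_conj[OF vd_not vd_not]] by simp

lemma vd_imp [vdi]: "vd P \<Longrightarrow> vd Q \<Longrightarrow> vd (\<lambda>e. P e \<longrightarrow> Q e)"
  using vd_not[OF vd_conj[OF _ vd_not]] by simp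

lemma vd_iff [vdi]: assumes "vd P" "vd Q" shows "vd (\<lambda>e. P e = Q e)"
  using vd_conj[OF vd_imp[OF assms] vd_imp[OF assms(2,1)]]
  by (simp add: iff_conv_conj_imp)

lemma dt_var [vdi]: "dt (\<lambda>e. e i)"
  unfolding dt_def using vd_eq_var[of 0 "Suc i"] by simp

lemma dt_const [vdi]: "dt (\<lambda>e. a)"
proof -
  have "(e 0 = a) \<longleftrightarrow> sat (Equal 0 1) (mrg e (\<lambda>_. a))" for e :: "nat \<Rightarrow> 'a"
    by (simp add: mrg_def)
  then show ?thesis unfolding vd_def dt_def by blast
qed

lemma vd_sub: assumes "vd (\<lambda>e. P (e 0) (\<lambda>i. e (Suc i)))" "dt T" shows "vd (\<lambda>e. P (T e) e)"
proof -
  have "vd (\<lambda>e. \<exists>x. x = T e \<and> P x e)"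
    by (rule vd_ex, rule vd_conj) (use assms in \<open>simp_all add: dt_def\<close>)
  then show ?thesis by simp
qed

lemma dt_ren: assumes "dt T" shows "dt (\<lambda>e. T (\<lambda>i. e (g i)))"
  using vd_ren[OF assms[unfolded dt_def], of "case_nat 0 (\<lambda>i. Suc (g i))"]
  by (simp add: dt_def)

lemma vd_sub2:
  assumes "vd (\<lambda>e. P (e 0) (e 1) (\<lambda>i. e (Suc (Suc i))))" "dt S" "dt T"
  shows "vd (\<lambda>e. P (S e) (T e) e)"
proof (rule vd_sub[of "\<lambda>x e. P (S e) x e", OF _ assms(3)])
  have "vd (\<lambda>e. P (e (Suc 0)) (e 0) (\<lambda>i. e (Suc (Suc i))))"
    using vd_ren[OF assms(1), of "\<lambda>i. case i of 0 \<Rightarrow> 1 | Suc 0 \<Rightarrow> 0 | Suc (Suc k) \<Rightarrow> Suc (Suc k)"] by simp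
  then have "vd (\<lambda>e. P (e 0) (e 1) (\<lambda>i. e (Suc (Suc i))))"
    using assms(1) by blast
  show "vd (\<lambda>e. P (S (\<lambda>i. e (Suc i))) (e 0) (\<lambda>i. e (Suc i)))"
    by (rule vd_sub[of "\<lambda>x e. P x (e 0) (\<lambda>i. e (Suc i))", OF _ dt_ren[OF assms(2)]])
       (use assms(1) in simp)
qed

lemma vd_mem [vdi]: "dt S \<Longrightarrow> dt T \<Longrightarrow> vd (\<lambda>e. S e \<in> elts (T e))"
  by (rule vd_sub2[of "\<lambda>x y e. x \<in> elts y"]) (use vd_mem_var[of 0 1] in simp_all)

lemma vd_eq [vdi]: "dt S \<Longrightarrow> dt T \<Longrightarrow> vd (\<lambda>e. S e = T e)"
  by (rule vd_sub2[of "\<lambda>x y e. x = y"]) (use vd_eq_var[of 0 1] in simp_all)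

lemma vd_ball [vdi]:
  assumes "dt T" "vd (\<lambda>e. P (e 0) (\<lambda>i. e (Suc i)))" shows "vd (\<lambda>e. \<forall>x\<in>elts (T e). P x e)"
  unfolding Ball_def by (rule vdi dt_ren[OF assms(1)] assms(2))+

lemma vd_bex [vdi]:
  assumes "dt T" "vd (\<lambda>e. P (e 0) (\<lambda>i. e (Suc i)))" shows "vd (\<lambda>e. \<exists>x\<in>elts (T e). P x e)"
  unfolding Bex_def by (rule vdi dt_ren[OF assms(1)] assms(2))+

lemma vd_in_Collect [vdi]: "vd (\<lambda>e. P (S e) e) \<Longrightarrow> vd (\<lambda>e. S e \<in> {x. P x e})" by simp
lemma vd_in_insert [vdi]: "vd (\<lambda>e. S e = T e) \<Longrightarrow> vd (\<lambda>e. S e \<in> B e) \<Longrightarrow> vd (\<lambda>e. S e \<in> insert (T e) (B e))"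
  using vd_disj by force
lemma vd_in_empty [vdi]: "vd (\<lambda>e. S e \<in> {})" by (simp add: vd_const)
lemma vd_in_UN [vdi]: "vd (\<lambda>e. \<exists>x\<in>elts (X e). S e \<in> F x e) \<Longrightarrow> vd (\<lambda>e. S e \<in> (\<Union>x\<in>elts (X e). F x e))" by simp
lemma vd_in_image [vdi]: "vd (\<lambda>e. \<exists>x\<in>elts (X e). S e = F x e) \<Longrightarrow> vd (\<lambda>e. S e \<in> (\<lambda>x. F x e) ` elts (X e))"
  by (simp add: image_iff)
lemma vd_subset [vdi]: "vd (\<lambda>e. \<forall>x\<in>elts (X e). x \<in> A e) \<Longrightarrow> vd (\<lambda>e. elts (X e) \<subseteq> A e)"
  by (simp add: subset_eq)
lemma vd_set_eq [vdi]: "vd (\<lambda>e. \<forall>x. x \<in> elts (X e) \<longleftrightarrow> x \<in> A e) \<Longrightarrow> vd (\<lambda>e. elts (X e) = A e)"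
  by (simp add: set_eq_iff)
lemma vd_ex1 [vdi]: assumes "vd (\<lambda>e. P (e 0) (\<lambda>i. e (Suc i)))" shows "vd (\<lambda>e. \<exists>!x. P x e)"
  unfolding Ex1_def
proof (intro vd_ex vd_conj assms vd_all vd_imp)
  show "vd (\<lambda>e. P (e 0) (\<lambda>i. e (Suc (Suc i))))"
    using vd_ren[OF assms, of "case_nat 0 (\<lambda>i. Suc (Suc i))"] by simp
qed (intro vdi)+

lemma dt_if [vdi]: assumes "vd P" "dt S" "dt T" shows "dt (\<lambda>e. if P e then S e else T e)"
proof -
  have "vd (\<lambda>e. (P (\<lambda>i. e (Suc i)) \<longrightarrow> e 0 = S (\<lambda>i. e (Suc i))) \<and> (\<not> P (\<lambda>i. e (Suc i)) \<longrightarrow> e 0 = T (\<lambda>i. e (Suc i))))"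
    by (rule vdi vd_ren[OF assms(1), of Suc] dt_ren[OF assms(2)] dt_ren[OF assms(3)])+
  then show ?thesis unfolding dt_def by (rule back_subst[of vd]) auto
qed

lemma dt_sub:
  assumes "dt (\<lambda>e. F (e 0) (\<lambda>i. e (Suc i)))" "dt T" shows "dt (\<lambda>e. F (T e) e)"
  unfolding dt_def
proof (rule vd_sub[of "\<lambda>x e. e 0 = F x (\<lambda>i. e (Suc i))" "\<lambda>e. T (\<lambda>i. e (Suc i))"])
  show "vd (\<lambda>e. e (Suc 0) = F (e 0) (\<lambda>i. e (Suc (Suc i))))"
    using vd_ren[OF assms(1)[unfolded dt_def], of "\<lambda>i. case i of 0 \<Rightarrow> 1 | Suc 0 \<Rightarrow> 0 | Suc (Suc k) \<Rightarrow> Suc (Suc k)"] by simp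
  show "dt (\<lambda>e. T (\<lambda>i. e (Suc i)))" by (rule dt_ren[OF assms(2)])
qed

lemma dt_fun: "dt (\<lambda>e. F (e 0)) \<Longrightarrow> dt T \<Longrightarrow> dt (\<lambda>e. F (T e))"
  by (rule dt_sub[of "\<lambda>x e. F x"])

lemma vd_pred: "vd (\<lambda>e. P (e 0)) \<Longrightarrow> dt T \<Longrightarrow> vd (\<lambda>e. P (T e))"
  by (rule vd_sub[of "\<lambda>x e. P x"])

lemma vd_pred2: "vd (\<lambda>e. P (e 0) (e 1)) \<Longrightarrow> dt S \<Longrightarrow> dt T \<Longrightarrow> vd (\<lambda>e. P (S e) (T e))"
  by (rule vd_sub2[of "\<lambda>x y e. P x y"])

lemma dt_fun2: assumes "dt (\<lambda>e. F (e 0) (e 1))" "dt S" "dt T" shows "dt (\<lambda>e. F (S e) (T e))"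
  unfolding dt_def
proof (rule vd_sub2[of "\<lambda>x y e. e 0 = F x y"])
  show "vd (\<lambda>e. e (Suc (Suc 0)) = F (e 0) (e 1))"
    using vd_ren[OF assms(1)[unfolded dt_def], of "\<lambda>i. case i of 0 \<Rightarrow> 2 | Suc k \<Rightarrow> k"]
    by (simp add: numeral_2_eq_2)
qed (rule dt_ren[OF assms(2)] dt_ren[OF assms(3)])+

text \<open>Induction on the fixed formula \<open>p\<close>. The valuation may consist of infinitely
  many terms with unrelated parameters, as the theorem of Los requires for arbitrary sequences of
  functions.\<close>

lemma vd_sat:
  fixes T :: "nat \<Rightarrow> (nat \<Rightarrow> 'v::zfc) \<Rightarrow> 'v"
  assumes "\<And>i. dt (T i)" shows "vd (\<lambda>e. sat p (\<lambda>i. T i e))"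
  using assms
proof (induction p arbitrary: T)
  case (Forall p)
  have "dt (case_nat (\<lambda>e. e 0) (\<lambda>i e. T i (\<lambda>k. e (Suc k))) i)" for i
    by (cases i) (simp_all add: dt_var dt_ren[OF Forall.prems])
  from Forall.IH[OF this] 
  have "vd (\<lambda>e. sat p (\<lambda>i. case_nat (\<lambda>e. e 0) (\<lambda>i e. T i (\<lambda>k. e (Suc k))) i e))" .
  moreover have "(\<lambda>i. case_nat (\<lambda>e. e 0) (\<lambda>i e. T i (\<lambda>k. e (Suc k))) i e) =
     case_nat (e 0) (\<lambda>i. T i (\<lambda>k. e (Suc k)))" for e :: "nat \<Rightarrow> 'v"
    by (rule ext) (simp split: nat.split)
  ultimately show ?case unfolding sat.simps by (intro vdi) simp
next
  case (Neg p) show ?case unfolding sat.simps by (intro vdi Neg.IH Neg.prems)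
next
  case (Conj p q) show ?case unfolding sat.simps by (intro vdi Conj.IH Conj.prems)
qed (simp_all add: vd_mem vd_eq)

section \<open>Basic set theory\<close>

definition small :: "'v::zfc set \<Rightarrow> bool" where
  "small A \<longleftrightarrow> (\<exists>z. elts z = A)"

lemma elts_vset [simp]: "small A \<Longrightarrow> elts (vset A) = A"
  unfolding small_def vset_def by (metis (mono_tags, lifting) extensionality theI)

lemma vset_elts [simp]: "vset (elts x) = x"
  unfolding vset_def by (rule the_equality, rule refl) (rule extensionality)

lemma elts_eq_iff: "elts x = elts y \<longleftrightarrow> x = y" for x :: "'v::zfc"
  by (rule iffI, erule extensionality) simp

lemma eltsI: "(\<And>z. z \<in> elts x \<longleftrightarrow> z \<in> elts y) \<Longrightarrow> x = y" for x :: "'v::zfc"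
  by (rule extensionality, rule set_eqI)

lemma small_sep: assumes "vd (\<lambda>e. P (e 0))" shows "small {y \<in> elts x. P y}"
proof -
  obtain p c where p: "\<And>e. P (e 0) \<longleftrightarrow> sat p (mrg e c)" using assms by (auto simp: vd_def)
  let ?d = "\<lambda>i. mrg (case_nat undefined (\<lambda>_. undefined)) c (Suc i)"
  have *: "mrg (case_nat y (\<lambda>_. undefined)) c = case_nat y ?d" for y
    by (rule ext) (auto simp: mrg_def split: nat.split elim!: evenE oddE)
  have "P y \<longleftrightarrow> sat p (case_nat y ?d)" for y
    using p[of "case_nat y (\<lambda>_. undefined)"] unfolding *[of y] by (simp only: nat.case)
  then show ?thesis using separation[of x p ?d] unfolding small_def by simp
qed

lemma small_subset: "vd (\<lambda>e. e 0 \<in> A) \<Longrightarrow> A \<subseteq> elts x \<Longrightarrow> small A"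
  using small_sep[of "\<lambda>y. y \<in> A" x] by (metis Collect_conj_eq Collect_mem_eq inf.absorb_iff2)

lemma small_image: assumes "dt (\<lambda>e. F (e 0))" shows "small (F ` elts x)"
proof -
  have "vd (\<lambda>e. e 1 = F (e 0))"
    by (intro vdi dt_fun[OF assms])
  then obtain p c where p: "\<And>e. e 1 = F (e 0) \<longleftrightarrow> sat p (mrg e c)" by (auto simp: vd_def)
  let ?u = "\<lambda>_::nat. undefined :: 'a"
  let ?d = "mrg (case_nat undefined (case_nat undefined ?u)) c"
  \<comment> \<open>Replacement reads argument and value at positions 0 and 1, while
    \<open>mrg\<close> keeps them at 0 and 2. All other positions are looked up in
    \<open>?d\<close>, two places further on.\<close>
  let ?f = "\<lambda>i. if i = 0 then 0 else if i = 2 then 1 else i + 2"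
  have "(\<lambda>i. case_nat y (case_nat z ?d) (?f i)) = mrg (case_nat y (case_nat z ?u)) c" for y z
  proof (rule ext)
    fix i :: nat
    consider "i = 0" | "i = 2" | "i \<noteq> 0" "i \<noteq> 2" by blast
    then show "case_nat y (case_nat z ?d) (?f i) = mrg (case_nat y (case_nat z ?u)) c i"
    proof cases
      case 3
      then have "i = 1 \<or> (\<exists>k. i div 2 = Suc (Suc k)) \<or> odd i" proof (cases "odd i")
        case False
        then obtain k where "i = 2 * k" by auto
        then show ?thesis using 3 by (cases k; cases "k - 1") auto
      qed simp
      with 3 show ?thesis by (auto simp: mrg_def)
    qed (simp_all add: mrg_def)
  qed
  then have q: "z = F y \<longleftrightarrow> sat (ren ?f p) (case_nat y (case_nat z ?d))" for y z
    using p[of "case_nat y (case_nat z ?u)"] by (simp add: sat_ren)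
  have "\<exists>w. elts w = {z. \<exists>y\<in>elts x. sat (ren ?f p) (case_nat y (case_nat z ?d))}"
    by (rule replacement, unfold q[symmetric]) simp
  moreover have "{z. \<exists>y\<in>elts x. sat (ren ?f p) (case_nat y (case_nat z ?d))} = F ` elts x"
    by (auto simp flip: q)
  ultimately show ?thesis unfolding small_def by simp
qed

lemma small_pair [simp]: "small {x, y}" unfolding small_def using pairing .
lemma small_sing [simp]: "small {x}" using small_pair[of x x] by simp
lemma small_empty [simp]: "small {}"
  using small_sep[of "\<lambda>_. False", OF vd_const] by simp
lemma small_Union [simp]: "small (\<Union>y\<in>elts x. elts y)" unfolding small_def using union .
lemma small_Pow [simp]: "small {y. elts y \<subseteq> elts x}" unfolding small_def using power_set .

lemma elts_vPow [simp]: "elts (vPow x) = {y. elts y \<subseteq> elts x}" by (simp add: vPow_def)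

lemma small_UN: assumes "dt (\<lambda>e. F (e 0))" shows "small (\<Union>y\<in>elts x. elts (F y))"
  using small_Union[of "vset (F ` elts x)"] small_image[OF assms] by simp

lemma small_Un [simp]: "small (elts x \<union> elts y)"
  using small_Union[of "vset {x, y}"] by simp

lemma small_insert [simp]: "small (insert x (elts y))"
  using small_Un[of "vset {x}" y] by simp

text \<open>\<open>vset\<close> is a \<open>THE\<close>, hence takes one fixed junk value
  \<open>c\<close> on all classes that are not sets. Both cases are first-order, so definability can
  be had before the class is shown to be a set.\<close>

lemma dt_vset [vdi]: assumes "vd (\<lambda>e. e 0 \<in> A (\<lambda>i. e (Suc i)))" shows "dt (\<lambda>e. vset (A e))"
proof -
  let ?A = "\<lambda>e. A (\<lambda>i. e (Suc i))"
  define c where "c = (THE x::'a. False)"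
  have "vset B = c" if "\<not> small B" for B :: "'a set"
    using that unfolding vset_def c_def small_def by simp
  then have *: "z = vset B \<longleftrightarrow> (\<forall>x. x \<in> elts z \<longleftrightarrow> x \<in> B) \<or> (\<not> (\<exists>z. \<forall>x. x \<in> elts z \<longleftrightarrow> x \<in> B)) \<and> z = c" for B and z :: 'a
    by (cases "small B") (auto simp: small_def elts_eq_iff simp flip: set_eq_iff)
  have "vd (\<lambda>e. e 0 \<in> A (\<lambda>i. e (Suc (Suc i))))" "vd (\<lambda>e. e 0 \<in> A (\<lambda>i. e (Suc (Suc (Suc i)))))"
    using vd_ren[OF assms, of "case_nat 0 (\<lambda>i. Suc (Suc i))"] vd_ren[OF assms, of "case_nat 0 (\<lambda>i. Suc (Suc (Suc i)))"]
    by simp_all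
  then show ?thesis unfolding dt_def * by (intro vdi)
qed

lemma elts_vpair: "elts (vpair x y) = {vset {x}, vset {x, y}}" by (simp add: vpair_def)

lemma vset_pair_inj: "vset {x} = vset {x'} \<longleftrightarrow> x = x'" "vset {x} = vset {y, z} \<longleftrightarrow> y = x \<and> z = x"
  "vset {y,z} = vset {x} \<longleftrightarrow> y = x \<and> z = x"
  "vset {x,y} = vset {z,w} \<longleftrightarrow> {x,y} = {z,w}" for x x' y z w :: "'v::zfc"
  by (metis elts_vset small_sing singleton_inject, 
      metis elts_vset small_sing small_pair doubleton_eq_iff insert_absorb2,
      metis elts_vset small_sing small_pair doubleton_eq_iff insert_absorb2,
      metis elts_vset small_pair)

lemma vpair_inj [simp]: "vpair x y = vpair x' y' \<longleftrightarrow> x = x' \<and> y = y'"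
proof
  assume "vpair x y = vpair x' y'"
  then have "{vset {x}, vset {x, y}} = {vset {x'}, vset {x', y'}}" by (metis elts_vpair)
  then show "x = x' \<and> y = y'"
    by (auto simp: doubleton_eq_iff vset_pair_inj)
qed simp

lemma dt_vpair [vdi]: "dt S \<Longrightarrow> dt T \<Longrightarrow> dt (\<lambda>e. vpair (S e) (T e))"
  by (rule dt_fun2[where F = vpair]) (unfold vpair_def, intro vdi)

text \<open>A description operator that, unlike \<open>THE\<close>, is definable also where the description fails.\<close>

definition vthe :: "('v::zfc \<Rightarrow> bool) \<Rightarrow> 'v" where
  "vthe P = vset {u. \<exists>y. P y \<and> u \<in> elts y}"

lemma vthe_eq: assumes "P y" "\<And>z. P z \<Longrightarrow> z = y" shows "vthe P = y"
proof -
  have "{u. \<exists>z. P z \<and> u \<in> elts z} = elts y" using assms by blast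
  then show ?thesis by (simp add: vthe_def)
qed

lemma dt_vthe [vdi]: assumes "vd (\<lambda>e. P (e 0) (\<lambda>i. e (Suc i)))" shows "dt (\<lambda>e. vthe (\<lambda>y. P y e))"
  unfolding vthe_def
proof (intro dt_vset vd_in_Collect vd_ex vd_conj)
  show "vd (\<lambda>e. P (e 0) (\<lambda>i. e (Suc (Suc i))))"
    using vd_ren[OF assms, of "case_nat 0 (\<lambda>i. Suc (Suc i))"] by simp
qed (intro vdi)

text \<open>\<open>app\<close> is a \<open>THE\<close>, whose value need not be definable where the
  described object is not unique. \<open>ap\<close> agrees with it on the domain of a function and
  is definable everywhere.\<close>

definition ap :: "'v::zfc \<Rightarrow> 'v \<Rightarrow> 'v" where
  "ap f x = vthe (\<lambda>y. vpair x y \<in> elts f)"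

lemma ap_unique: "vpair x y \<in> elts f \<Longrightarrow> (\<And>z. vpair x z \<in> elts f \<Longrightarrow> z = y) \<Longrightarrow> ap f x = y"
  unfolding ap_def by (rule vthe_eq)

lemma app_eq_ap: assumes "\<exists>!y. vpair x y \<in> elts f" shows "app f x = ap f x"
proof -
  obtain y where y: "vpair x y \<in> elts f" "\<And>z. vpair x z \<in> elts f \<Longrightarrow> z = y" using assms by auto
  have "app f x = y" unfolding app_def by (intro the_equality y)
  then show ?thesis using ap_unique[OF y] by simp
qed

lemma dt_ap [vdi]: "dt S \<Longrightarrow> dt T \<Longrightarrow> dt (\<lambda>e. ap (S e) (T e))"
  by (rule dt_fun2[where F = ap]) (unfold ap_def, intro vdi)

lemma vd_vfun [vdi]: assumes "dt S" "dt T" shows "vd (\<lambda>e. vfun (S e) (T e))"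
  by (rule vd_sub2[of "\<lambda>x y e. vfun x y", OF _ assms]) (unfold vfun_def, intro vdi)

lemma dt_vlam [vdi]: assumes "dt X" "dt (\<lambda>e. F (e 0) (\<lambda>i. e (Suc i)))"
  shows "dt (\<lambda>e. vlam (X e) (\<lambda>x. F x e))"
  unfolding vlam_def
proof (intro dt_vset vd_in_image vd_bex vd_eq dt_vpair)
  show "dt (\<lambda>e. F (e 0) (\<lambda>i. e (Suc (Suc i))))"
    using dt_ren[OF assms(2), of "case_nat 0 (\<lambda>i. Suc (Suc i))"] by simp
qed (rule dt_ren[OF assms(1)] dt_var)+

lemma dt_vPow [vdi]: "dt T \<Longrightarrow> dt (\<lambda>e. vPow (T e))"
  by (rule dt_fun[where F = vPow]) (unfold vPow_def, intro vdi)

lemma vfun_unique: "vfun f X \<Longrightarrow> x \<in> elts X \<Longrightarrow> \<exists>!y. vpair x y \<in> elts f" by (simp add: vfun_def)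

lemma vfun_dom: assumes "vfun f X" "vpair x y \<in> elts f" shows "x \<in> elts X"
proof -
  obtain x' y' where "x' \<in> elts X" "vpair x y = vpair x' y'" using assms unfolding vfun_def by blast
  then show ?thesis by simp
qed

lemma ap_eqI: assumes "vfun f X" "vpair x y \<in> elts f" shows "ap f x = y"
  using vfun_unique[OF assms(1) vfun_dom[OF assms]] assms(2) by (blast intro: ap_unique)

lemma vfun_pair: assumes "vfun f X" "x \<in> elts X" shows "vpair x (ap f x) \<in> elts f"
proof -
  obtain y where "vpair x y \<in> elts f" using vfun_unique[OF assms] by blast
  then show ?thesis using ap_eqI[OF assms(1)] by simp
qed

lemma vfun_pair_iff: "vfun f X \<Longrightarrow> vpair x y \<in> elts f \<longleftrightarrow> x \<in> elts X \<and> y = ap f x"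
  using vfun_dom[of f X x y] ap_eqI[of f X x y] vfun_pair[of f X x] by auto

lemma app_ap: "vfun f X \<Longrightarrow> x \<in> elts X \<Longrightarrow> app f x = ap f x"
  by (rule app_eq_ap) (simp add: vfun_def)

lemma vfun_elts: "vfun f X \<Longrightarrow> elts f = (\<lambda>x. vpair x (ap f x)) ` elts X"
proof (intro set_eqI iffI)
  fix z assume f: "vfun f X" and "z \<in> elts f"
  then obtain x y where "z = vpair x y" "x \<in> elts X" unfolding vfun_def by blast
  then show "z \<in> (\<lambda>x. vpair x (ap f x)) ` elts X" using f \<open>z \<in> elts f\<close> by (auto simp: vfun_pair_iff image_iff)
qed (auto simp: vfun_pair)

lemma vfun_ext: assumes "vfun f X" "vfun g X" "\<And>x. x \<in> elts X \<Longrightarrow> ap f x = ap g x" shows "f = g"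
proof (rule extensionality)
  show "elts f = elts g" using assms by (simp add: vfun_elts cong: image_cong)
qed

lemma vlam_elts: assumes "dt (\<lambda>e. F (e 0))" shows "elts (vlam X F) = (\<lambda>x. vpair x (F x)) ` elts X"
  unfolding vlam_def by (intro elts_vset small_image vdi assms)

lemma vlam_vfun: assumes "dt (\<lambda>e. F (e 0))" shows "vfun (vlam X F) X"
  unfolding vfun_def vlam_elts[OF assms] by auto

lemma ap_vlam [simp]: "dt (\<lambda>e. F (e 0)) \<Longrightarrow> x \<in> elts X \<Longrightarrow> ap (vlam X F) x = F x"
  by (rule ap_eqI[OF vlam_vfun]) (auto simp: vlam_elts)

subsection \<open>Choice functions and recursion\<close>

lemma vlam_cong: "(\<And>x. x \<in> elts X \<Longrightarrow> F x = G x) \<Longrightarrow> vlam X F = vlam X G"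
  by (simp add: vlam_def cong: image_cong)

lemma set_choice:
  assumes F: "dt (\<lambda>e. F (e 0))" and ne: "\<And>x. x \<in> elts a \<Longrightarrow> elts (F x) \<noteq> {}"
  shows "\<exists>f. vfun f a \<and> (\<forall>x\<in>elts a. ap f x \<in> elts (F x))"
proof -
  \<comment> \<open>The axiom of choice speaks of disjoint families only; tagging the elements of
    \<open>F x\<close> with \<open>x\<close> makes the family disjoint.\<close>
  define H where "H x = vset ((\<lambda>y. vpair x y) ` elts (F x))" for x
  have H: "elts (H x) = (\<lambda>y. vpair x y) ` elts (F x)" for x
    unfolding H_def by (intro elts_vset small_image vdi)
  have dH: "dt (\<lambda>e. H (e 0))" unfolding H_def
    by (intro vdi) (rule dt_ren[OF F, of "\<lambda>_. Suc 0"])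
  define A where "A = vset (H ` elts a)"
  have A: "elts A = H ` elts a" unfolding A_def by (intro elts_vset small_image dH)
  have "\<exists>c. \<forall>y\<in>elts A. \<exists>!z. z \<in> elts c \<and> z \<in> elts y"
  proof (rule choice)
    fix y assume "y \<in> elts A" then show "elts y \<noteq> {}" using ne by (auto simp: A H)
  next
    fix y z assume "y \<in> elts A" "z \<in> elts A" "y \<noteq> z"
    then show "elts y \<inter> elts z = {}" by (auto simp: A H)
  qed
  then obtain c where c: "\<And>x. x \<in> elts a \<Longrightarrow> \<exists>!z. z \<in> elts c \<and> z \<in> elts (H x)"
    unfolding A by blast
  \<comment> \<open>The selector \<open>c\<close> may have further elements; only its tagged pairs
    form the function.\<close>
  define f where "f = vset {z \<in> elts c. \<exists>x\<in>elts a. \<exists>y\<in>elts (F x). z = vpair x y}"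
  have f: "elts f = {z \<in> elts c. \<exists>x\<in>elts a. \<exists>y\<in>elts (F x). z = vpair x y}"
    unfolding f_def
    by (intro elts_vset small_sep vdi) (rule dt_ren[OF F, of "\<lambda>_. 0"])
  have "vfun f a" unfolding vfun_def
  proof (intro conjI ballI)
    fix z assume "z \<in> elts f" then show "\<exists>x\<in>elts a. \<exists>y. z = vpair x y" by (auto simp: f)
  next
    fix x assume x: "x \<in> elts a"
    from c[OF x] obtain z where z0: "z \<in> elts c \<and> z \<in> elts (H x)"
      and z3: "\<forall>z'. z' \<in> elts c \<and> z' \<in> elts (H x) \<longrightarrow> z' = z" by (rule ex1E)
    have z: "z \<in> elts c" "z \<in> elts (H x)" using z0 by auto
    then obtain y where y: "z = vpair x y" "y \<in> elts (F x)" by (auto simp: H)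
    show "\<exists>!y. vpair x y \<in> elts f"
    proof (rule ex1I[of _ y])
      show "vpair x y \<in> elts f" using x y z(1) by (auto simp: f)
      fix y' assume "vpair x y' \<in> elts f"
      then have "vpair x y' = z" by (intro z3[rule_format]) (auto simp: f H)
      then show "y' = y" using y by simp
    qed
  qed
  moreover have "ap f x \<in> elts (F x)" if "x \<in> elts a" for x
    using vfun_pair[OF \<open>vfun f a\<close> that] by (auto simp: f)
  ultimately show ?thesis by blast
qed

text \<open>Minimal elements are asked only of sets of the model: wellfoundedness as the model sees
  it. \<open>wf_rel_min\<close> passes to definable subclasses by separation.\<close>

definition wf_rel :: "'v::zfc \<Rightarrow> ('v \<Rightarrow> 'v \<Rightarrow> bool) \<Rightarrow> bool" where
  "wf_rel t R \<longleftrightarrow> (\<forall>u. elts u \<subseteq> elts t \<and> elts u \<noteq> {} \<longrightarrow> (\<exists>m\<in>elts u. \<forall>y\<in>elts u. \<not> R y m))"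

lemma wf_rel_min:
  assumes "wf_rel t R" "vd (\<lambda>e. P (e 0))" "g \<in> elts t" "P g"
  obtains m where "m \<in> elts t" "P m" "\<And>y. y \<in> elts t \<Longrightarrow> P y \<Longrightarrow> \<not> R y m"
proof -
  have "elts (vset {y \<in> elts t. P y}) = {y \<in> elts t. P y}" by (intro elts_vset small_sep assms)
  then show ?thesis using assms(1)[unfolded wf_rel_def, rule_format, of "vset {y \<in> elts t. P y}"] assms(3,4) that
    by auto
qed

lemma wf_rel_induct:
  assumes "wf_rel t R" "vd (\<lambda>e. P (e 0))" "g \<in> elts t"
    "\<And>g. g \<in> elts t \<Longrightarrow> (\<And>h. h \<in> elts t \<Longrightarrow> R h g \<Longrightarrow> P h) \<Longrightarrow> P g"
  shows "P g"
proof (rule ccontr)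
  assume "\<not> P g"
  then obtain m where "m \<in> elts t" "\<not> P m" "\<And>y. y \<in> elts t \<Longrightarrow> \<not> P y \<Longrightarrow> \<not> R y m"
    using wf_rel_min[OF assms(1) vd_not[OF assms(2)] assms(3)] by blast
  then show False using assms(4)[of m] by blast
qed

text \<open>The union of all approximations on sets closed under predecessors. Two approximations
  agree on their common domain by \<open>R\<close>-induction, and an \<open>R\<close>-minimal point
  outside the union would allow one more value.\<close>

lemma wf_rec:
  assumes wf: "wf_rel t R" and R: "vd (\<lambda>e. R (e 0) (e 1))" and G: "dt (\<lambda>e. G (e 0) (e 1))"
  shows "\<exists>p. vfun p t \<and> (\<forall>g\<in>elts t. ap p g = G g (vlam (vset {h \<in> elts t. R h g}) (ap p)))"
proof -
  define pr where "pr g = vset {h \<in> elts t. R h g}" for g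
  have R1: "vd (\<lambda>e. R (S e) (T e))" if "dt S" "dt T" for S T by (rule vd_pred2[OF R that])
  have G1: "dt (\<lambda>e. G (S e) (T e))" if "dt S" "dt T" for S T by (rule dt_fun2[OF G that])
  have pr: "elts (pr g) = {h \<in> elts t. R h g}" for g
    unfolding pr_def by (intro elts_vset small_sep R1 vdi)
  have dpr: "dt (\<lambda>e. pr (e 0))" unfolding pr_def by (intro vdi R1)
  have dpr1: "dt (\<lambda>e. pr (S e))" if "dt S" for S by (rule dt_fun[OF dpr that])
  define approx where "approx d q \<longleftrightarrow> elts d \<subseteq> elts t \<and> (\<forall>g\<in>elts d. elts (pr g) \<subseteq> elts d) \<and> vfun q d \<and>
    (\<forall>g\<in>elts d. ap q g = G g (vlam (pr g) (ap q)))" for d q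
  have approxE: "elts d \<subseteq> elts t" "\<And>g. g \<in> elts d \<Longrightarrow> elts (pr g) \<subseteq> elts d" "vfun q d"
    "\<And>g. g \<in> elts d \<Longrightarrow> ap q g = G g (vlam (pr g) (ap q))" if "approx d q" for d q
    using that by (auto simp: approx_def)
  have dapprox: "vd (\<lambda>e. approx (S e) (T e))" if "dt S" "dt T" for S T
    by (rule vd_pred2[OF _ that]) (unfold approx_def, intro vdi G1 dpr1)
  have uniq: "ap q g = ap q' g" if a: "approx d q" "approx d' q'" "g \<in> elts d" "g \<in> elts d'" for d q d' q' g
  proof -
    have "g \<in> elts d \<longrightarrow> g \<in> elts d' \<longrightarrow> ap q g = ap q' g"
    proof (rule wf_rel_induct[OF wf, of "\<lambda>g. g \<in> elts d \<longrightarrow> g \<in> elts d' \<longrightarrow> ap q g = ap q' g"])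
      show "g \<in> elts t" using a(3) approxE(1)[OF a(1)] by blast
    next
      fix g assume IH: "\<And>h. h \<in> elts t \<Longrightarrow> R h g \<Longrightarrow> h \<in> elts d \<longrightarrow> h \<in> elts d' \<longrightarrow> ap q h = ap q' h"
      show "g \<in> elts d \<longrightarrow> g \<in> elts d' \<longrightarrow> ap q g = ap q' g"
      proof (intro impI)
        assume g: "g \<in> elts d" "g \<in> elts d'"
        have "vlam (pr g) (ap q) = vlam (pr g) (ap q')"
        proof (rule vlam_cong)
          fix h assume h: "h \<in> elts (pr g)"
          then have "h \<in> elts t" "R h g" by (auto simp: pr)
          moreover have "h \<in> elts d" "h \<in> elts d'" using h approxE(2)[OF a(1) g(1)] approxE(2)[OF a(2) g(2)] by auto
          ultimately show "ap q h = ap q' h" using IH by blast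
        qed
        then show "ap q g = ap q' g" using approxE(4)[OF a(1) g(1)] approxE(4)[OF a(2) g(2)] by simp
      qed
    qed (intro vdi)
    then show ?thesis using a by blast
  qed
  define D where "D = vset {g \<in> elts t. \<exists>d q. approx d q \<and> g \<in> elts d}"
  have D: "elts D = {g \<in> elts t. \<exists>d q. approx d q \<and> g \<in> elts d}"
    unfolding D_def by (intro elts_vset small_sep vdi dapprox)
  define val where "val g = vthe (\<lambda>y. \<exists>d q. approx d q \<and> g \<in> elts d \<and> y = ap q g)" for g
  have dval: "dt (\<lambda>e. val (e 0))" unfolding val_def by (intro vdi dapprox)
  have val: "val g = ap q g" if "approx d q" "g \<in> elts d" for d q g
    unfolding val_def
  proof (rule vthe_eq)
    fix z assume "\<exists>d q. approx d q \<and> g \<in> elts d \<and> z = ap q g"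
    then obtain d' q' where *: "approx d' q'" "g \<in> elts d'" and z: "z = ap q' g" by blast
    show "z = ap q g" unfolding z by (rule uniq[OF *(1) that(1) *(2) that(2)])
  qed (use that in blast)
  define p where "p = vlam D val"
  have p: "vfun p D" "\<And>g. g \<in> elts D \<Longrightarrow> ap p g = val g" unfolding p_def by (simp_all add: vlam_vfun dval)
  have pra: "elts (pr g) \<subseteq> elts D" "ap p g = G g (vlam (pr g) (ap p))" if gD: "g \<in> elts D" for g
  proof -
    obtain d q where dq: "approx d q" "g \<in> elts d" using gD by (auto simp: D)
    have sub: "elts (pr g) \<subseteq> elts d" by (rule approxE(2)[OF dq])
    then show 1: "elts (pr g) \<subseteq> elts D" using dq(1) approxE(1)[OF dq(1)] by (auto simp: D)
    have "vlam (pr g) (ap p) = vlam (pr g) (ap q)"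
    proof (rule vlam_cong)
      fix x assume x: "x \<in> elts (pr g)"
      then have "ap p x = val x" using 1 p(2) by blast
      also have "\<dots> = ap q x" using x sub by (intro val[OF dq(1)]) blast
      finally show "ap p x = ap q x" .
    qed
    then show "ap p g = G g (vlam (pr g) (ap p))"
      using approxE(4)[OF dq] val[OF dq] p(2)[OF gD] by simp
  qed
  have "elts D = elts t"
  proof (rule ccontr)
    assume "elts D \<noteq> elts t"
    moreover have "elts D \<subseteq> elts t" by (auto simp: D)
    ultimately obtain g0 where g0: "g0 \<in> elts t" "g0 \<notin> elts D" by blast
    have vD: "vd (\<lambda>e. e 0 \<notin> elts D)" by (intro vdi)
    obtain g where g: "g \<in> elts t" "g \<notin> elts D" "\<And>h. h \<in> elts t \<Longrightarrow> h \<notin> elts D \<Longrightarrow> \<not> R h g"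
      using wf_rel_min[OF wf vD g0] by blast
    have sub: "elts (pr g) \<subseteq> elts D" using g(3) by (auto simp: pr)
    define D' where "D' = vset (insert g (elts D))"
    have D': "elts D' = insert g (elts D)" by (simp add: D'_def)
    define F where "F h = (if h = g then G g (vlam (pr g) (ap p)) else val h)" for h
    have dF: "dt (\<lambda>e. F (e 0))" unfolding F_def by (intro vdi dval)
    define q where "q = vlam D' F"
    have q: "vfun q D'" "\<And>h. h \<in> elts D' \<Longrightarrow> ap q h = F h" unfolding q_def by (simp_all add: vlam_vfun dF)
    have eq: "ap q h = ap p h" if "h \<in> elts D" for h
      using that q(2)[of h] g(2) p(2)[OF that] by (auto simp: D' F_def)
    have eqv: "vlam (pr h) (ap q) = vlam (pr h) (ap p)" if "h \<in> elts D'" for h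
    proof (rule vlam_cong)
      fix x assume "x \<in> elts (pr h)"
      then have "x \<in> elts D" using that sub pra(1)[of h] by (auto simp: D')
      then show "ap q x = ap p x" by (rule eq)
    qed
    have "approx D' q" unfolding approx_def
    proof (intro conjI ballI q(1))
      show "elts D' \<subseteq> elts t" using g(1) by (auto simp: D' D)
      fix h assume h: "h \<in> elts D'"
      then show "elts (pr h) \<subseteq> elts D'" using sub pra(1)[of h] by (auto simp: D')
      show "ap q h = G h (vlam (pr h) (ap q))"
      proof (cases "h = g")
        case True then show ?thesis using q(2)[OF h] eqv[OF h] by (simp add: F_def)
      next
        case False
        then have "h \<in> elts D" using h by (simp add: D')
        then show ?thesis using eq pra(2) eqv[OF h] by simp
      qed
    qed
    then show False using g(1,2) by (auto simp: D D')
  qed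
  then have "D = t" by (simp add: elts_eq_iff)
  then show ?thesis using p(1) pra(2) unfolding pr_def by blast
qed

lemma vd_mem01: "vd (\<lambda>e. e 0 \<in> elts (e 1))" by (intro vdi)

lemma wf_rel_mem: "wf_rel t (\<lambda>x y. x \<in> elts y)"
  unfolding wf_rel_def using foundation by blast

subsection \<open>Natural numbers\<close>

definition v0 :: "'v::zfc" where "v0 = vset {}"
definition vsucc :: "'v::zfc \<Rightarrow> 'v" where "vsucc n = vset (insert n (elts n))"

lemma elts_v0 [simp]: "elts v0 = {}" by (simp add: v0_def)
lemma elts_vsucc [simp]: "elts (vsucc n) = insert n (elts n)" by (simp add: vsucc_def)
lemma dt_vsucc [vdi]: "dt S \<Longrightarrow> dt (\<lambda>e. vsucc (S e))"
  by (rule dt_fun[where F = vsucc]) (unfold vsucc_def, intro vdi)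

lemma empty_v0: "elts m = {} \<longleftrightarrow> m = v0" using elts_eq_iff[of m v0] by simp
lemma insert_vsucc: "elts m = insert k (elts k) \<longleftrightarrow> m = vsucc k" using elts_eq_iff[of m "vsucc k"] by simp

lemma mem_irrefl [simp]: "x \<notin> elts x" for x :: "'v::zfc"
  using foundation[of "vset {x}"] by auto

lemma mem_asym: "x \<in> elts y \<Longrightarrow> y \<notin> elts x" for x y :: "'v::zfc"
  using foundation[of "vset {x, y}"] by auto

lemma vsucc_not_v0 [simp]: "vsucc n \<noteq> v0" "v0 \<noteq> vsucc n"
  by (metis elts_v0 elts_vsucc insert_not_empty)+

lemma vsucc_inj [simp]: "vsucc m = vsucc n \<longleftrightarrow> m = n"
  by (metis elts_vsucc insertCI insertE mem_asym)

lemma vd_transitive_set [vdi]: "dt S \<Longrightarrow> vd (\<lambda>e. transitive_set (S e))"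
  by (rule vd_pred[where P = transitive_set]) (unfold transitive_set_def, intro vdi)
lemma vd_Ord [vdi]: "dt S \<Longrightarrow> vd (\<lambda>e. Ord (S e))"
  by (rule vd_pred[where P = Ord]) (unfold Ord_def, intro vdi)
lemma vd_natural [vdi]: "dt S \<Longrightarrow> vd (\<lambda>e. natural (S e))"
  by (rule vd_pred[where P = natural]) (simp only: natural_def ball_simps, intro vdi)

lemma Ord_in: "Ord \<alpha> \<Longrightarrow> \<beta> \<in> elts \<alpha> \<Longrightarrow> Ord \<beta>"
  unfolding Ord_def transitive_set_def by blast
lemma Ord_trans: "Ord \<alpha> \<Longrightarrow> \<beta> \<in> elts \<alpha> \<Longrightarrow> \<gamma> \<in> elts \<beta> \<Longrightarrow> \<gamma> \<in> elts \<alpha>"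
  unfolding Ord_def transitive_set_def by blast
lemma Ord_vsucc: "Ord \<alpha> \<Longrightarrow> Ord (vsucc \<alpha>)"
  unfolding Ord_def transitive_set_def by auto

lemma natural_iff: "natural n \<longleftrightarrow> Ord n \<and> (\<forall>m\<in>insert n (elts n). m = v0 \<or> (\<exists>k. m = vsucc k))"
  unfolding natural_def empty_v0 insert_vsucc ..

lemma natural_v0: "natural v0" by (simp add: natural_iff Ord_def transitive_set_def)
lemma natural_vsucc: "natural n \<Longrightarrow> natural (vsucc n)" by (auto simp: natural_iff Ord_vsucc)
lemma natural_in: "natural n \<Longrightarrow> m \<in> elts n \<Longrightarrow> natural m"
  unfolding natural_iff by (auto intro: Ord_in Ord_trans)

text \<open>The least counterexample is sought in \<open>vsucc n\<close>, because the naturals are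
  not yet known to form a set; \<open>small_natural\<close> is derived from this form.\<close>

lemma natural_induct0:
  assumes P: "vd (\<lambda>e. P (e 0))" and "P v0" "\<And>n. natural n \<Longrightarrow> P n \<Longrightarrow> P (vsucc n)" and n: "natural n"
  shows "P n"
proof (rule ccontr)
  assume "\<not> P n"
  then obtain m where m: "m \<in> elts (vsucc n)" "\<not> P m" "\<And>y. y \<in> elts (vsucc n) \<Longrightarrow> \<not> P y \<Longrightarrow> y \<notin> elts m"
    using wf_rel_min[OF wf_rel_mem vd_not[OF P], of n "vsucc n"] by auto
  have nat: "natural m" using m(1) n natural_in by auto
  have "m \<noteq> v0" using m(2) assms(2) by auto
  then obtain k where k: "m = vsucc k" using nat by (auto simp: natural_iff)
  then have kn: "natural k" using nat natural_in[of m k] by simp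
  have "k \<in> elts (vsucc n)" using m(1) n k unfolding natural_iff by (auto intro: Ord_trans)
  then have "P k" using m(3) k by auto
  then show False using assms(3) kn k m(2) by auto
qed

lemma small_natural: "small {n::'v::zfc. natural n}"
proof -
  obtain z :: 'v where z: "\<exists>x\<in>elts z. elts x = {}" "\<forall>x\<in>elts z. \<exists>y\<in>elts z. elts y = insert x (elts x)"
    using infinity by blast
  have "n \<in> elts z" if "natural n" for n
    by (rule natural_induct0[OF _ _ _ that]) (use z in \<open>auto simp: empty_v0 insert_vsucc intro: vdi\<close>)
  then show ?thesis by (intro small_subset[of _ z]) (auto intro: vdi)
qed

lemma elts_omega [simp]: "elts omega = {n. natural n}"
  by (simp add: omega_def small_natural)

lemma natural_induct [consumes 1, case_names dfn zero succ]:
  assumes "natural n" "vd (\<lambda>e. P (e 0))" "P v0" "\<And>n. natural n \<Longrightarrow> P n \<Longrightarrow> P (vsucc n)"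
  shows "P n"
  using natural_induct0[of P n] assms by blast

lemma natural_cases: "natural n \<Longrightarrow> (n = v0 \<Longrightarrow> Q) \<Longrightarrow> (\<And>k. natural k \<Longrightarrow> n = vsucc k \<Longrightarrow> Q) \<Longrightarrow> Q"
  by (metis elts_vsucc insertI1 natural_iff natural_in)

lemma omega_rec:
  assumes F: "dt (\<lambda>e. F (e 0) (e 1))"
  shows "\<exists>s. vfun s omega \<and> ap s v0 = a \<and> (\<forall>n. natural n \<longrightarrow> ap s (vsucc n) = F n (ap s n))"
proof -
  \<comment> \<open>The union of a successor natural is its predecessor; this is how
    \<open>G\<close> finds the previous value of the recursion.\<close>
  define U where "U n = vset (\<Union>k\<in>elts n. elts k)" for n :: 'a
  have dU: "dt (\<lambda>e. U (S e))" if "dt S" for S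
    by (rule dt_fun[where F = U, OF _ that]) (unfold U_def, intro vdi)
  have U: "U (vsucc n) = n" if "natural n" for n
  proof -
    have "(\<Union>k\<in>elts (vsucc n). elts k) = elts n"
      using that unfolding natural_iff Ord_def transitive_set_def by auto
    then show ?thesis by (simp add: U_def)
  qed
  define G where "G n r = (if n = v0 then a else F (U n) (ap r (U n)))" for n r
  have "dt (\<lambda>e. G (e 0) (e 1))" unfolding G_def by (intro vdi dt_fun2[OF F] dU)
  then obtain s where s: "vfun s omega"
    "\<And>g. natural g \<Longrightarrow> ap s g = G g (vlam (vset {h \<in> elts omega. h \<in> elts g}) (ap s))"
    using wf_rec[OF wf_rel_mem[of omega] vd_mem01, of G] by auto
  have "ap s v0 = a" using s(2)[OF natural_v0] by (simp add: G_def)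
  moreover have "ap s (vsucc n) = F n (ap s n)" if n: "natural n" for n
  proof -
    have "n \<in> elts (vset {h \<in> elts omega. h \<in> elts (vsucc n)})"
      by (subst elts_vset, intro small_sep vdi) (use n in simp)
    then have "ap (vlam (vset {h \<in> elts omega. h \<in> elts (vsucc n)}) (ap s)) n = ap s n"
      by (intro ap_vlam vdi)
    then show ?thesis using s(2)[OF natural_vsucc[OF n]] U[OF n] by (simp add: G_def)
  qed
  ultimately show ?thesis using s(1) by blast
qed

subsection \<open>Transitive closures, ordinals and ranks\<close>

lemma transitive_closure: "\<exists>T. transitive_set T \<and> elts x \<subseteq> elts T"
proof -
  have "dt (\<lambda>e. vset (\<Union>y\<in>elts (e 1). elts y))" by (intro vdi)
  then obtain s where s: "vfun s omega" "ap s v0 = x" "\<And>n. natural n \<Longrightarrow> ap s (vsucc n) = vset (\<Union>y\<in>elts (ap s n). elts y)"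
    using omega_rec[of "\<lambda>n v. vset (\<Union>y\<in>elts v. elts y)" x] by auto
  define T where "T = vset (\<Union>n\<in>elts omega. elts (ap s n))"
  have T: "elts T = (\<Union>n\<in>elts omega. elts (ap s n))"
    unfolding T_def by (intro elts_vset small_UN vdi)
  have "transitive_set T" unfolding transitive_set_def
  proof (intro ballI subsetI)
    fix y z assume "y \<in> elts T" "z \<in> elts y"
    then obtain n where "natural n" "y \<in> elts (ap s n)" by (auto simp: T)
    then have "z \<in> elts (ap s (vsucc n))" using s(3) \<open>z \<in> elts y\<close> by auto
    then show "z \<in> elts T" using natural_vsucc[OF \<open>natural n\<close>] by (auto simp: T)
  qed
  moreover have "elts x \<subseteq> elts T" using s(2) natural_v0 by (auto simp: T)
  ultimately show ?thesis by blast
qed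

lemma transitive_closure1: obtains T where "transitive_set T" "x \<in> elts T"
  using transitive_closure[of "vset {x}"] by auto

text \<open>A transitive set around \<open>x\<close> reduces foundation for a definable class to
  foundation for a set: elements of a minimal \<open>m\<close> stay in that set.\<close>

lemma mem_min:
  assumes "vd (\<lambda>e. P (e 0))" "P x" obtains m where "P m" "\<And>y. y \<in> elts m \<Longrightarrow> \<not> P y"
proof -
  obtain T where T: "transitive_set T" "x \<in> elts T" by (rule transitive_closure1)
  obtain m where "m \<in> elts T" "P m" "\<And>y. y \<in> elts T \<Longrightarrow> P y \<Longrightarrow> y \<notin> elts m"
    using wf_rel_min[OF wf_rel_mem assms(1) T(2) assms(2)] by blast
  then show ?thesis using that T(1) unfolding transitive_set_def by blast
qed

lemma mem_induct [case_names dfn step]: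
  assumes P: "vd (\<lambda>e. P (e 0))" and step: "\<And>x. (\<And>y. y \<in> elts x \<Longrightarrow> P y) \<Longrightarrow> P x" shows "P x"
proof (rule ccontr)
  assume "\<not> P x"
  then obtain m where "\<not> P m" "\<And>y. y \<in> elts m \<Longrightarrow> \<not> \<not> P y"
    using mem_min[OF vd_not[OF P]] by blast
  then show False using step by blast
qed

lemma Ord_linear: "Ord \<alpha> \<Longrightarrow> Ord \<beta> \<Longrightarrow> \<alpha> \<in> elts \<beta> \<or> \<alpha> = \<beta> \<or> \<beta> \<in> elts \<alpha>" for \<alpha> \<beta> :: "'v::zfc"
proof -
  have "Ord \<alpha> \<longrightarrow> (\<forall>\<beta>. Ord \<beta> \<longrightarrow> \<alpha> \<in> elts \<beta> \<or> \<alpha> = \<beta> \<or> \<beta> \<in> elts \<alpha>)"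
  proof (induction \<alpha> rule: mem_induct)
    case dfn show ?case by (intro vdi)
  next
    case (step \<alpha>)
    show ?case
    proof (intro impI allI)
      fix \<beta> :: 'v assume \<alpha>: "Ord \<alpha>" and "Ord \<beta>"
      have "Ord \<beta> \<longrightarrow> \<alpha> \<in> elts \<beta> \<or> \<alpha> = \<beta> \<or> \<beta> \<in> elts \<alpha>"
      proof (induction \<beta> rule: mem_induct)
        case dfn show ?case by (intro vdi)
      next
        case IH: (step \<beta>)
        show ?case
        proof (intro impI, rule ccontr)
          assume \<beta>: "Ord \<beta>" and n: "\<not> (\<alpha> \<in> elts \<beta> \<or> \<alpha> = \<beta> \<or> \<beta> \<in> elts \<alpha>)"
          have "\<delta> \<in> elts \<alpha>" if "\<delta> \<in> elts \<beta>" for \<delta>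
            using IH[OF that] n that Ord_in[OF \<beta> that] Ord_trans[OF \<beta> that] by blast
          moreover have "\<gamma> \<in> elts \<beta>" if "\<gamma> \<in> elts \<alpha>" for \<gamma>
            using step[OF that] n that Ord_in[OF \<alpha> that] Ord_trans[OF \<alpha> that] \<beta> by blast
          ultimately have "\<alpha> = \<beta>" by (intro eltsI) blast
          then show False using n by blast
        qed
      qed
      then show "\<alpha> \<in> elts \<beta> \<or> \<alpha> = \<beta> \<or> \<beta> \<in> elts \<alpha>" using \<open>Ord \<beta>\<close> by blast
    qed
  qed
  then show "Ord \<alpha> \<Longrightarrow> Ord \<beta> \<Longrightarrow> \<alpha> \<in> elts \<beta> \<or> \<alpha> = \<beta> \<or> \<beta> \<in> elts \<alpha>" by blast
qed

lemma Ord_subset: "Ord \<alpha> \<Longrightarrow> Ord \<beta> \<Longrightarrow> elts \<alpha> \<subseteq> elts \<beta> \<longleftrightarrow> \<alpha> = \<beta> \<or> \<alpha> \<in> elts \<beta>"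
  using Ord_linear[of \<alpha> \<beta>] Ord_trans[of \<beta> \<alpha>] mem_irrefl[of \<beta>] by blast

definition rank_fun :: "'v::zfc \<Rightarrow> 'v \<Rightarrow> bool" where
  "rank_fun T p \<longleftrightarrow> transitive_set T \<and> vfun p T \<and>
     (\<forall>y\<in>elts T. ap p y = vset (\<Union>z\<in>elts y. elts (vsucc (ap p z))))"

definition rk :: "'v::zfc \<Rightarrow> 'v" where
  "rk x = vthe (\<lambda>y. \<exists>T p. rank_fun T p \<and> x \<in> elts T \<and> y = ap p x)"

lemma vd_rank_fun [vdi]: "dt S \<Longrightarrow> dt T \<Longrightarrow> vd (\<lambda>e. rank_fun (S e) (T e))"
  by (rule vd_pred2[where P = rank_fun]) (unfold rank_fun_def, intro vdi)

lemma dt_rk [vdi]: "dt S \<Longrightarrow> dt (\<lambda>e. rk (S e))"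
  by (rule dt_fun[where F = rk]) (unfold rk_def, intro vdi)

lemma rank_fun_ex: "\<exists>T p. rank_fun T p \<and> x \<in> elts T"
proof -
  obtain T where T: "transitive_set T" "x \<in> elts T" by (rule transitive_closure1)
  define G where "G g r = vset (\<Union>z\<in>elts g. elts (vsucc (ap r z)))" for g r :: 'a
  have "dt (\<lambda>e. G (e 0) (e 1))" unfolding G_def by (intro vdi)
  then obtain p where p: "vfun p T" "\<And>g. g \<in> elts T \<Longrightarrow> ap p g = G g (vlam (vset {h \<in> elts T. h \<in> elts g}) (ap p))"
    using wf_rec[OF wf_rel_mem[of T] vd_mem01, of G] by auto
  have "ap p y = vset (\<Union>z\<in>elts y. elts (vsucc (ap p z)))" if y: "y \<in> elts T" for y
  proof -
    have "elts y \<subseteq> elts T" using T(1) y unfolding transitive_set_def by blast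
    then have "{h \<in> elts T. h \<in> elts y} = elts y" by auto
    moreover have "ap (vlam y (ap p)) z = ap p z" if "z \<in> elts y" for z
      by (rule ap_vlam[OF _ that]) (intro vdi)
    ultimately show ?thesis using p(2)[OF y] by (simp add: G_def)
  qed
  then show ?thesis using T p(1) unfolding rank_fun_def by blast
qed

lemma rank_fun_unique:
  assumes "rank_fun T p" "rank_fun T' p'" shows "x \<in> elts T \<longrightarrow> x \<in> elts T' \<longrightarrow> ap p x = ap p' x"
proof (induction x rule: mem_induct)
  case dfn show ?case by (intro vdi)
next
  case (step x)
  show ?case
  proof (intro impI)
    assume x: "x \<in> elts T" "x \<in> elts T'"
    then have "ap p y = ap p' y" if "y \<in> elts x" for y
      using step[OF that] that assms unfolding rank_fun_def transitive_set_def by blast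
    then show "ap p x = ap p' x" using assms x unfolding rank_fun_def by auto
  qed
qed

lemma rk_eq_ap: assumes "rank_fun T p" "x \<in> elts T" shows "rk x = ap p x"
  unfolding rk_def
proof (rule vthe_eq)
  fix z assume "\<exists>T p. rank_fun T p \<and> x \<in> elts T \<and> z = ap p x"
  then obtain T' p' where *: "rank_fun T' p'" "x \<in> elts T'" and z: "z = ap p' x" by blast
  show "z = ap p x" unfolding z using rank_fun_unique[OF *(1) assms(1)] *(2) assms(2) by blast
qed (use assms in blast)

lemma elts_rk: "elts (rk x) = (\<Union>z\<in>elts x. elts (vsucc (rk z)))"
proof -
  obtain T p where T: "rank_fun T p" "x \<in> elts T" using rank_fun_ex by blast
  have z: "rk z = ap p z" if "z \<in> elts x" for z
    using T that unfolding rank_fun_def transitive_set_def by (intro rk_eq_ap[OF T(1)]) blast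
  have "rk x = vset (\<Union>z\<in>elts x. elts (vsucc (ap p z)))"
    using rk_eq_ap[OF T] T unfolding rank_fun_def by simp
  moreover have "small (\<Union>z\<in>elts x. elts (vsucc (ap p z)))" by (intro small_UN vdi)
  ultimately show ?thesis using z by simp
qed

lemma Ord_rk: "Ord (rk x)"
proof (induction x rule: mem_induct)
  case dfn show ?case by (intro vdi)
next
  case (step x)
  then show ?case unfolding Ord_def transitive_set_def elts_rk[of x] by fastforce
qed

lemma rk_le_iff: "elts (rk u) \<subseteq> elts (rk z) \<longleftrightarrow> (\<forall>v\<in>elts u. rk v \<in> elts (rk z))"
  using Ord_rk[of z] by (auto simp: elts_rk[of u] dest: Ord_trans)

text \<open>This is the cumulative hierarchy. A set has rank below that of \<open>y\<close> exactly
  if it is a subset of an earlier stage belonging to some \<open>z\<close> in \<open>y\<close>, so a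
  union of power sets collects them.\<close>

lemma small_rk_less: "small {u. rk u \<in> elts (rk y)}"
proof (induction y rule: mem_induct)
  case dfn show ?case unfolding small_def by (intro vdi)
next
  case (step y)
  have "(rk u \<in> elts (rk y)) \<longleftrightarrow> (\<exists>z\<in>elts y. elts u \<subseteq> {v. rk v \<in> elts (rk z)})" for u
    unfolding elts_rk[of y] using Ord_subset[OF Ord_rk Ord_rk, of u] rk_le_iff[of u] by (simp add: subset_eq)
  moreover have "{v. rk v \<in> elts (rk z)} = elts (vset {v. rk v \<in> elts (rk z)})" if "z \<in> elts y" for z
    using step[OF that] by simp
  ultimately have "{u. rk u \<in> elts (rk y)} = (\<Union>z\<in>elts y. elts (vPow (vset {v. rk v \<in> elts (rk z)})))"
    by auto
  then show ?case by (simp only:) (intro small_UN vdi)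
qed

lemma small_rk_le: "small {u. elts (rk u) \<subseteq> elts (rk y)}"
proof -
  have "{u. elts (rk u) \<subseteq> elts (rk y)} = elts (vPow (vset {v. rk v \<in> elts (rk y)}))"
    using small_rk_less[of y] by (auto simp: rk_le_iff)
  then show ?thesis by simp
qed

text \<open>Collection and choice together: witnesses of least rank form a set.\<close>

lemma choose_fun:
  assumes P: "vd (\<lambda>e. P (e 0) (e 1))" and ex: "\<And>x. x \<in> elts a \<Longrightarrow> \<exists>y. P x y"
  obtains f where "vfun f a" "\<And>x. x \<in> elts a \<Longrightarrow> P x (ap f x)"
proof -
  define C where "C x = vset {y. P x y \<and> (\<forall>z. P x z \<longrightarrow> elts (rk y) \<subseteq> elts (rk z))}" for x
  have P1: "vd (\<lambda>e. P (S e) (T e))" if "dt S" "dt T" for S T by (rule vd_pred2[OF P that])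
  have dC: "dt (\<lambda>e. C (e 0))" unfolding C_def by (intro vdi P1)
  have C: "elts (C x) = {y. P x y \<and> (\<forall>z. P x z \<longrightarrow> elts (rk y) \<subseteq> elts (rk z))}" for x
  proof (cases "\<exists>y. P x y")
    case True
    then obtain y where "P x y" by blast
    then show ?thesis unfolding C_def
      by (intro elts_vset small_subset[of _ "vset {u. elts (rk u) \<subseteq> elts (rk y)}"])
         (auto simp: small_rk_le intro!: P1 vdi)
  qed (simp add: C_def)
  have "elts (C x) \<noteq> {}" if x: "x \<in> elts a" for x
  proof -
    obtain y where "P x y" using ex[OF x] by blast
    then have 1: "\<exists>z. P x z \<and> rk z = rk y" by blast
    have "vd (\<lambda>e. \<exists>z. P x z \<and> rk z = e 0)" by (intro vdi P1)
    from mem_min[OF this 1] obtain r where r: "\<exists>y. P x y \<and> rk y = r" "\<And>s. s \<in> elts r \<Longrightarrow> \<not> (\<exists>y. P x y \<and> rk y = s)"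
      by blast
    then obtain y where y: "P x y" "rk y = r" by blast
    have "elts (rk y) \<subseteq> elts (rk z)" if "P x z" for z
    proof -
      have "rk z \<notin> elts (rk y)" using r(2)[of "rk z"] y(2) that by blast
      then show ?thesis
        using Ord_linear[OF Ord_rk[of y] Ord_rk[of z]] Ord_subset[OF Ord_rk[of y] Ord_rk[of z]] by blast
    qed
    then show ?thesis using y C by blast
  qed
  from set_choice[OF dC this] obtain f where "vfun f a" "\<forall>x\<in>elts a. ap f x \<in> elts (C x)" by blast
  then show ?thesis using that C by auto
qed

section \<open>Parameter-free definability and elementarity\<close>

primrec satM :: "'v::zfc set \<Rightarrow> fm \<Rightarrow> (nat \<Rightarrow> 'v) \<Rightarrow> bool" where
  "satM M (Member i j) e \<longleftrightarrow> e i \<in> elts (e j)"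
| "satM M (Equal i j) e \<longleftrightarrow> e i = e j"
| "satM M (Neg p) e \<longleftrightarrow> \<not> satM M p e"
| "satM M (Conj p q) e \<longleftrightarrow> satM M p e \<and> satM M q e"
| "satM M (Forall p) e \<longleftrightarrow> (\<forall>x\<in>M. satM M p (case_nat x e))"

lemma satM_UNIV [simp]: "satM UNIV p e = sat p e"
  by (induction p arbitrary: e) simp_all

lemma satM_ren: "satM M (ren f p) e = satM M p (\<lambda>i. e (f i))"
proof (induction p arbitrary: f e)
  case (Forall p)
  have "(\<lambda>i. case_nat x e (case_nat 0 (\<lambda>k. Suc (f k)) i)) = case_nat x (\<lambda>i. e (f i))" for x
    by (rule ext) (simp split: nat.split)
  then show ?case using Forall by simp
qed simp_all

text \<open>Besides the universe itself, the ultrapowers are transitive classes that satisfy every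
  parameter-free formula valid in the universe. \<open>pd\<close> and \<open>pt\<close> are definability without parameters,
  uniformly in these classes: what is proved of such a predicate in the universe transfers to them.\<close>

definition inner_model :: "'v::zfc set \<Rightarrow> bool" where
  "inner_model M \<longleftrightarrow> (\<forall>x\<in>M. elts x \<subseteq> M) \<and>
     (\<forall>p. (\<forall>e::nat \<Rightarrow> 'v. sat p e) \<longrightarrow> (\<forall>e. (\<forall>i. e i \<in> M) \<longrightarrow> satM M p e))"

lemma inner_model_UNIV: "inner_model UNIV" by (simp add: inner_model_def)

lemma inner_model_trans: "inner_model M \<Longrightarrow> x \<in> M \<Longrightarrow> y \<in> elts x \<Longrightarrow> y \<in> M"
  unfolding inner_model_def by blast

definition pd :: "('v::zfc set \<Rightarrow> (nat \<Rightarrow> 'v) \<Rightarrow> bool) \<Rightarrow> bool" where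
  "pd P \<longleftrightarrow> (\<exists>p. \<forall>M e. inner_model M \<longrightarrow> (\<forall>i. e i \<in> M) \<longrightarrow> P M e = satM M p e)"

definition pt :: "('v::zfc set \<Rightarrow> (nat \<Rightarrow> 'v) \<Rightarrow> 'v) \<Rightarrow> bool" where
  "pt T \<longleftrightarrow> pd (\<lambda>M e. e 0 = T M (\<lambda>i. e (Suc i)))"

named_theorems pdi

lemma pdI: "(\<And>M e. inner_model M \<Longrightarrow> (\<And>i. e i \<in> M) \<Longrightarrow> P M e = satM M p e) \<Longrightarrow> pd P"
  unfolding pd_def by blast

lemma pd_cong: assumes "pd Q" "\<And>M e. inner_model M \<Longrightarrow> (\<And>i. e i \<in> M) \<Longrightarrow> P M e = Q M e" shows "pd P"
proof -
  obtain p where "\<And>M e. inner_model M \<Longrightarrow> (\<And>i. e i \<in> M) \<Longrightarrow> Q M e = satM M p e" using assms(1) unfolding pd_def by blast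
  then show ?thesis by (intro pdI[of P p]) (simp add: assms(2))
qed

lemma pd_ren: assumes "pd P" shows "pd (\<lambda>M e. P M (\<lambda>i. e (g i)))"
proof -
  obtain p where "\<And>M e. inner_model M \<Longrightarrow> (\<And>i. e i \<in> M) \<Longrightarrow> P M e = satM M p e" using assms(1) unfolding pd_def by blast
  then show ?thesis by (intro pdI[of _ "ren g p"]) (simp add: satM_ren)
qed

lemma pd_not [pdi]: assumes "pd P" shows "pd (\<lambda>M e. \<not> P M e)"
proof -
  obtain p where "\<And>M e. inner_model M \<Longrightarrow> (\<And>i. e i \<in> M) \<Longrightarrow> P M e = satM M p e" using assms(1) unfolding pd_def by blast
  then show ?thesis by (intro pdI[of _ "Neg p"]) simp
qed

lemma pd_conj [pdi]: assumes "pd P" "pd Q" shows "pd (\<lambda>M e. P M e \<and> Q M e)"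
proof -
  obtain p where "\<And>M e. inner_model M \<Longrightarrow> (\<And>i. e i \<in> M) \<Longrightarrow> P M e = satM M p e" using assms(1) unfolding pd_def by blast
  moreover obtain q where "\<And>M e. inner_model M \<Longrightarrow> (\<And>i. e i \<in> M) \<Longrightarrow> Q M e = satM M q e" using assms(2) unfolding pd_def by blast
  ultimately show ?thesis by (intro pdI[of _ "Conj p q"]) simp
qed

lemma pd_all [pdi]: assumes "pd (\<lambda>M e. P M (e 0) (\<lambda>i. e (Suc i)))" shows "pd (\<lambda>M e. \<forall>x\<in>M. P M x e)"
proof -
  obtain p where p: "\<And>M e. inner_model M \<Longrightarrow> (\<And>i. e i \<in> M) \<Longrightarrow> P M (e 0) (\<lambda>i. e (Suc i)) = satM M p e"
    using assms(1) unfolding pd_def by blast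
  have "P M x e = satM M p (case_nat x e)" if "inner_model M" "\<And>i. e i \<in> M" "x \<in> M" for M e x
    using p[of M "case_nat x e"] that by (simp split: nat.split)
  then show ?thesis by (intro pdI[of _ "Forall p"]) simp
qed

lemma pd_disj [pdi]: "pd P \<Longrightarrow> pd Q \<Longrightarrow> pd (\<lambda>M e. P M e \<or> Q M e)"
  using pd_not[OF pd_conj[OF pd_not pd_not]] by simp

lemma pd_imp [pdi]: "pd P \<Longrightarrow> pd Q \<Longrightarrow> pd (\<lambda>M e. P M e \<longrightarrow> Q M e)"
  using pd_not[OF pd_conj[OF _ pd_not]] by simp

lemma pd_iff [pdi]: assumes "pd P" "pd Q" shows "pd (\<lambda>M e. P M e = Q M e)"
  using pd_conj[OF pd_imp[OF assms] pd_imp[OF assms(2,1)]]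
  by (simp add: iff_conv_conj_imp)

lemma pd_ex [pdi]: assumes "pd (\<lambda>M e. P M (e 0) (\<lambda>i. e (Suc i)))" shows "pd (\<lambda>M e. \<exists>x\<in>M. P M x e)"
  using pd_not[OF pd_all[of "\<lambda>M x e. \<not> P M x e", OF pd_not[OF assms]]] by simp

lemma pd_eq_var: "pd (\<lambda>M e. e i = e j)" by (rule pdI[of _ "Equal i j"]) simp
lemma pd_mem_var: "pd (\<lambda>M e. e i \<in> elts (e j))" by (rule pdI[of _ "Member i j"]) simp

lemma pt_var [pdi]: "pt (\<lambda>M e. e i)"
  unfolding pt_def using pd_eq_var[of 0 "Suc i"] by simp

lemma transferE:
  assumes "pd P" "inner_model M" "\<And>e. P UNIV e" "\<And>i. e i \<in> M" shows "P M e"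
proof -
  obtain p where p: "\<And>M e. inner_model M \<Longrightarrow> (\<And>i. e i \<in> M) \<Longrightarrow> P M e = satM M p e" using assms(1) unfolding pd_def by blast
  have "sat p e" for e :: "nat \<Rightarrow> 'a" using p[OF inner_model_UNIV, of e] assms(3)[of e] by simp
  then have "satM M p e" using assms(2,4) unfolding inner_model_def by blast
  then show ?thesis using p[OF assms(2,4)] by simp
qed

text \<open>That the value exists is itself a parameter-free statement, trivially true in the
  universe; its transfer says that \<open>M\<close> is closed under the operation.\<close>

lemma pt_in: assumes "pt T" "inner_model M" "\<And>i. e i \<in> M" shows "T M e \<in> M"
proof -
  have "pd (\<lambda>M e. \<exists>x\<in>M. x = T M e)" by (rule pd_ex) (use assms(1) in \<open>simp add: pt_def\<close>)
  from transferE[OF this assms(2) _ assms(3)] show ?thesis by auto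
qed

lemma pt_ren: assumes "pt T" shows "pt (\<lambda>M e. T M (\<lambda>i. e (g i)))"
  using pd_ren[OF assms[unfolded pt_def], of "case_nat 0 (\<lambda>i. Suc (g i))"]
  by (simp add: pt_def)

lemma pd_sub: assumes "pd (\<lambda>M e. P M (e 0) (\<lambda>i. e (Suc i)))" "pt T" shows "pd (\<lambda>M e. P M (T M e) e)"
proof (rule pd_cong)
  show "pd (\<lambda>M e. \<exists>x\<in>M. x = T M e \<and> P M x e)"
    by (rule pd_ex, rule pd_conj) (use assms in \<open>simp_all add: pt_def\<close>)
  show "P M (T M e) e = (\<exists>x\<in>M. x = T M e \<and> P M x e)" if "inner_model M" "\<And>i. e i \<in> M" for M e
    using pt_in[OF assms(2) that] by auto
qed

lemma pd_pred: "pd (\<lambda>M e. P M (e 0)) \<Longrightarrow> pt T \<Longrightarrow> pd (\<lambda>M e. P M (T M e))"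
  by (rule pd_sub[of "\<lambda>M x e. P M x"])

lemma pd_pred2: assumes "pd (\<lambda>M e. P M (e 0) (e 1))" "pt S" "pt T" shows "pd (\<lambda>M e. P M (S M e) (T M e))"
proof (rule pd_sub[of "\<lambda>M x e. P M (S M e) x", OF _ assms(3)])
  show "pd (\<lambda>M e. P M (S M (\<lambda>i. e (Suc i))) (e 0))"
    by (rule pd_sub[of "\<lambda>M x e. P M x (e 0)", OF _ pt_ren[OF assms(2)]])
       (use pd_ren[OF assms(1), of "\<lambda>i. if i = 0 then 0 else 1"] in simp)
qed

lemma pd_pred3: assumes "pd (\<lambda>M e. P M (e 0) (e 1) (e 2))" "pt S" "pt T" "pt W"
  shows "pd (\<lambda>M e. P M (S M e) (T M e) (W M e))"
proof (rule pd_sub[of "\<lambda>M x e. P M (S M e) (T M e) x", OF _ assms(4)],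
    rule pd_sub[of "\<lambda>M x e. P M (S M (\<lambda>i. e (Suc i))) x (e 0)", OF _ pt_ren[OF assms(3)]],
    rule pd_sub[of "\<lambda>M x e. P M x (e 0) (e (Suc 0))", OF _ pt_ren[OF assms(2), of "\<lambda>i. Suc (Suc i)"]])
  show "pd (\<lambda>M e. P M (e 0) (e (Suc 0)) (e (Suc (Suc 0))))" using assms(1) by (simp add: numeral_2_eq_2)
qed

lemma pd_pred4: assumes "pd (\<lambda>M e. P M (e 0) (e 1) (e 2) (e 3))" "pt S" "pt T" "pt W" "pt Y"
  shows "pd (\<lambda>M e. P M (S M e) (T M e) (W M e) (Y M e))"
proof (rule pd_sub[of "\<lambda>M x e. P M (S M e) (T M e) (W M e) x", OF _ assms(5)],
    rule pd_sub[of "\<lambda>M x e. P M (S M (\<lambda>i. e (Suc i))) (T M (\<lambda>i. e (Suc i))) x (e 0)", OF _ pt_ren[OF assms(4)]],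
    rule pd_sub[of "\<lambda>M x e. P M (S M (\<lambda>i. e (Suc (Suc i)))) x (e 0) (e (Suc 0))", OF _ pt_ren[OF assms(3), of "\<lambda>i. Suc (Suc i)"]],
    rule pd_sub[of "\<lambda>M x e. P M x (e 0) (e (Suc 0)) (e (Suc (Suc 0)))", OF _ pt_ren[OF assms(2), of "\<lambda>i. Suc (Suc (Suc i))"]])
  show "pd (\<lambda>M e. P M (e 0) (e (Suc 0)) (e (Suc (Suc 0))) (e (Suc (Suc (Suc 0)))))"
    using assms(1) by (simp add: numeral_2_eq_2 numeral_3_eq_3)
qed

lemma pd_mem [pdi]: "pt S \<Longrightarrow> pt T \<Longrightarrow> pd (\<lambda>M e. S M e \<in> elts (T M e))"
  by (rule pd_pred2[of "\<lambda>M x y. x \<in> elts y"]) (rule pd_mem_var)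

lemma pd_eq [pdi]: "pt S \<Longrightarrow> pt T \<Longrightarrow> pd (\<lambda>M e. S M e = T M e)"
  by (rule pd_pred2[of "\<lambda>M x y. x = y"]) (rule pd_eq_var)

lemma pd_inM [pdi]: "pt T \<Longrightarrow> pd (\<lambda>M e. T M e \<in> M)"
  by (rule pd_cong[OF pd_eq_var[of 0 0]]) (simp add: pt_in)

lemma pd_ball [pdi]:
  assumes "pt T" "pd (\<lambda>M e. P M (e 0) (\<lambda>i. e (Suc i)))" shows "pd (\<lambda>M e. \<forall>x\<in>elts (T M e). P M x e)"
proof (rule pd_cong)
  show "pd (\<lambda>M e. \<forall>x\<in>M. x \<in> elts (T M e) \<longrightarrow> P M x e)"
    by (intro pd_all pd_imp assms(2) pd_mem pt_var pt_ren[OF assms(1)])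
  show "(\<forall>x\<in>elts (T M e). P M x e) = (\<forall>x\<in>M. x \<in> elts (T M e) \<longrightarrow> P M x e)" if "inner_model M" "\<And>i. e i \<in> M" for M e
    using inner_model_trans[OF that(1) pt_in[OF assms(1) that(1), of e, OF that(2)]] by blast
qed

lemma pd_bex [pdi]:
  assumes "pt T" "pd (\<lambda>M e. P M (e 0) (\<lambda>i. e (Suc i)))" shows "pd (\<lambda>M e. \<exists>x\<in>elts (T M e). P M x e)"
  using pd_not[OF pd_ball[OF assms(1), of "\<lambda>M x e. \<not> P M x e", OF pd_not[OF assms(2)]]] by simp

lemma pd_subset [pdi]: "pt S \<Longrightarrow> pt T \<Longrightarrow> pd (\<lambda>M e. elts (S M e) \<subseteq> elts (T M e))"
  by (rule pd_pred2[of "\<lambda>M x y. elts x \<subseteq> elts y"]) (unfold subset_eq, intro pdi)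

lemma pt_fun: assumes "pt (\<lambda>M e. F M (e 0))" "pt S" shows "pt (\<lambda>M e. F M (S M e))"
  unfolding pt_def
  by (rule pd_pred2[of "\<lambda>M x y. x = F M y", OF _ pt_var pt_ren[OF assms(2)]])
     (use assms(1) in \<open>simp add: pt_def\<close>)

lemma pt_fun2: assumes "pt (\<lambda>M e. F M (e 0) (e 1))" "pt S" "pt T" shows "pt (\<lambda>M e. F M (S M e) (T M e))"
  unfolding pt_def
  by (rule pd_pred3[of "\<lambda>M x y z. x = F M y z", OF _ pt_var pt_ren[OF assms(2)] pt_ren[OF assms(3)]])
     (use assms(1) in \<open>simp add: pt_def numeral_2_eq_2\<close>)

lemma pt_sep [pdi]: assumes "pt T" "pd (\<lambda>M e. P M (e 0) (\<lambda>i. e (Suc i)))"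
  shows "pt (\<lambda>M e. vset {x \<in> elts (T M e). P M x e})"
  unfolding pt_def
proof (rule pd_cong)
  have P2: "pd (\<lambda>M e. P M (e 0) (\<lambda>i. e (Suc (Suc i))))"
    using pd_ren[OF assms(2), of "case_nat 0 (\<lambda>i. Suc (Suc i))"] by simp
  show "pd (\<lambda>M e. (\<forall>x\<in>elts (e 0). x \<in> elts (T M (\<lambda>i. e (Suc i))) \<and> P M x (\<lambda>i. e (Suc i))) \<and>
      (\<forall>x\<in>elts (T M (\<lambda>i. e (Suc i))). P M x (\<lambda>i. e (Suc i)) \<longrightarrow> x \<in> elts (e 0)))"
    by (intro pdi P2 pt_ren[OF assms(1)])
  fix M :: "'a set" and e :: "nat \<Rightarrow> 'a" assume M: "inner_model M" "\<And>i. e i \<in> M"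
  let ?e = "\<lambda>i. e (Suc i)"
  \<comment> \<open>Separation is not among the assumptions on \<open>M\<close>. This instance of it
    is valid in the universe and transfers; its witness in \<open>M\<close> shows that the two-sided
    description above captures the true \<open>vset\<close>.\<close>
  have "pd (\<lambda>M e. \<exists>z\<in>M. (\<forall>x\<in>elts z. x \<in> elts (T M e) \<and> P M x e) \<and> (\<forall>x\<in>elts (T M e). P M x e \<longrightarrow> x \<in> elts z))"
    by (intro pdi P2 pt_ren[OF assms(1)])
  moreover have "\<exists>z\<in>UNIV. (\<forall>x\<in>elts z. x \<in> elts (T UNIV e) \<and> P UNIV x e) \<and> (\<forall>x\<in>elts (T UNIV e). P UNIV x e \<longrightarrow> x \<in> elts z)"
    for e
  proof -
    obtain p where p: "\<And>M e. inner_model M \<Longrightarrow> (\<And>i. e i \<in> M) \<Longrightarrow> P M (e 0) (\<lambda>i. e (Suc i)) = satM M p e"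
      using assms(2) unfolding pd_def by blast
    have "P UNIV x e = sat p (case_nat x e)" for x using p[OF inner_model_UNIV, of "case_nat x e"] by simp
    then show ?thesis using separation[of "T UNIV e" p e] by auto
  qed
  ultimately obtain z where "(\<forall>x\<in>elts z. x \<in> elts (T M ?e) \<and> P M x ?e) \<and> (\<forall>x\<in>elts (T M ?e). P M x ?e \<longrightarrow> x \<in> elts z)"
    using transferE[of _ M ?e] M by blast
  then have z: "elts z = {x \<in> elts (T M ?e). P M x ?e}" by blast
  then show "(e 0 = vset {x \<in> elts (T M ?e). P M x ?e}) =
      ((\<forall>x\<in>elts (e 0). x \<in> elts (T M ?e) \<and> P M x ?e) \<and> (\<forall>x\<in>elts (T M ?e). P M x ?e \<longrightarrow> x \<in> elts (e 0)))"
    unfolding z[symmetric] vset_elts elts_eq_iff[of "e 0" z, symmetric] set_eq_iff using z by blast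
qed

lemma transfer1: "pd (\<lambda>M e. P M (e 0)) \<Longrightarrow> inner_model M \<Longrightarrow> (\<And>x. P UNIV x) \<Longrightarrow> x \<in> M \<Longrightarrow> P M x"
  using transferE[of "\<lambda>M e. P M (e 0)" M "\<lambda>_. x"] by simp

lemma transfer2: "pd (\<lambda>M e. P M (e 0) (e 1)) \<Longrightarrow> inner_model M \<Longrightarrow> (\<And>x y. P UNIV x y) \<Longrightarrow> x \<in> M \<Longrightarrow> y \<in> M \<Longrightarrow> P M x y"
  using transferE[of "\<lambda>M e. P M (e 0) (e 1)" M "case_nat x (\<lambda>_. y)"] by (simp split: nat.split)

lemma transfer3: "pd (\<lambda>M e. P M (e 0) (e 1) (e 2)) \<Longrightarrow> inner_model M \<Longrightarrow> (\<And>x y z. P UNIV x y z) \<Longrightarrow>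
    x \<in> M \<Longrightarrow> y \<in> M \<Longrightarrow> z \<in> M \<Longrightarrow> P M x y z"
  using transferE[of "\<lambda>M e. P M (e 0) (e 1) (e 2)" M "case_nat x (case_nat y (\<lambda>_. z))"]
  by (simp add: numeral_2_eq_2 split: nat.split)

lemma transfer4: "pd (\<lambda>M e. P M (e 0) (e 1) (e 2) (e 3)) \<Longrightarrow> inner_model M \<Longrightarrow> (\<And>x y z w. P UNIV x y z w) \<Longrightarrow>
    x \<in> M \<Longrightarrow> y \<in> M \<Longrightarrow> z \<in> M \<Longrightarrow> w \<in> M \<Longrightarrow> P M x y z w"
  using transferE[of "\<lambda>M e. P M (e 0) (e 1) (e 2) (e 3)" M "case_nat x (case_nat y (case_nat z (\<lambda>_. w)))"]
  by (simp add: eval_nat_numeral split: nat.split)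

lemma vd_pd:
  assumes "pd P" "\<And>i. dt (T i)" shows "vd (\<lambda>e. P UNIV (\<lambda>i. T i e))"
proof -
  obtain p where "\<And>M e. inner_model M \<Longrightarrow> (\<And>i. e i \<in> M) \<Longrightarrow> P M e = satM M p e" using assms(1) unfolding pd_def by blast
  from this[OF inner_model_UNIV] have "P UNIV e = sat p e" for e by simp
  then show ?thesis using vd_sat[OF assms(2), of p] by simp
qed

lemma vd_pd1: "pd (\<lambda>M e. P M (e 0)) \<Longrightarrow> dt S \<Longrightarrow> vd (\<lambda>e. P UNIV (S e))"
  using vd_pd[of "\<lambda>M e. P M (e 0)" "\<lambda>_. S"] by simp

lemma vd_pd2: assumes "pd (\<lambda>M e. P M (e 0) (e 1))" "dt S" "dt T" shows "vd (\<lambda>e. P UNIV (S e) (T e))"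
  using vd_pd[OF assms(1), of "case_nat S (\<lambda>_. T)"] assms(2,3) by (simp split: nat.split)

lemma vd_pd3: assumes "pd (\<lambda>M e. P M (e 0) (e 1) (e 2))" "dt S" "dt T" "dt W" shows "vd (\<lambda>e. P UNIV (S e) (T e) (W e))"
  using vd_pd[OF assms(1), of "case_nat S (case_nat T (\<lambda>_. W))"] assms(2-) by (simp add: eval_nat_numeral split: nat.split)

lemma vd_pd4: assumes "pd (\<lambda>M e. P M (e 0) (e 1) (e 2) (e 3))" "dt S" "dt T" "dt W" "dt Y"
  shows "vd (\<lambda>e. P UNIV (S e) (T e) (W e) (Y e))"
  using vd_pd[OF assms(1), of "case_nat S (case_nat T (case_nat W (\<lambda>_. Y)))"] assms(2-) by (simp add: eval_nat_numeral split: nat.split)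

subsection \<open>Absolute notions\<close>

lemma pt_pairset [pdi]: "pt S \<Longrightarrow> pt T \<Longrightarrow> pt (\<lambda>M e. vset {S M e, T M e})"
proof (rule pt_fun2[where F = "\<lambda>M x y. vset {x, y}"])
  have eq: "(z = vset {x, y}) = (x \<in> elts z \<and> y \<in> elts z \<and> (\<forall>w\<in>elts z. w = x \<or> w = y))" for x y z :: 'a
    by (subst elts_eq_iff[symmetric]) (auto simp: set_eq_iff)
  show "pt (\<lambda>M e. vset {e 0, e 1 :: 'a})" unfolding pt_def eq by (intro pdi)
qed

lemma pt_sing [pdi]: "pt S \<Longrightarrow> pt (\<lambda>M e. vset {S M e})"
  using pt_pairset[of S S] by simp

lemma pt_vpair [pdi]: "pt S \<Longrightarrow> pt T \<Longrightarrow> pt (\<lambda>M e. vpair (S M e) (T M e))"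
  unfolding vpair_def by (intro pdi)

lemma inner_model_vpairD: assumes "inner_model M" "f \<in> M" "vpair x y \<in> elts f" shows "x \<in> M" "y \<in> M"
proof -
  have "vset {x, y} \<in> M" using assms by (metis elts_vpair inner_model_trans insertCI)
  then show "x \<in> M" "y \<in> M" using inner_model_trans[OF assms(1), of "vset {x,y}"] by auto
qed

lemma pd_vfun0: "pd (\<lambda>M e. vfun (e 0) (e 1))"
proof (rule pd_cong)
  show "pd (\<lambda>M e. (\<forall>z\<in>elts (e 0). \<exists>x\<in>elts (e 1). \<exists>y\<in>M. z = vpair x y) \<and>
     (\<forall>x\<in>elts (e 1). \<exists>y\<in>M. vpair x y \<in> elts (e 0) \<and> (\<forall>y'\<in>M. vpair x y' \<in> elts (e 0) \<longrightarrow> y' = y)))"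
    by (intro pdi)
  fix M :: "'a set" and e :: "nat \<Rightarrow> 'a" assume M: "inner_model M" "\<And>i. e i \<in> M"
  have y: "y \<in> M" if "vpair x y \<in> elts (e 0)" for x y using inner_model_vpairD[OF M(1) M(2) that] by simp
  have A: "(\<exists>y. z = vpair x y) = (\<exists>y\<in>M. z = vpair x y)" if "z \<in> elts (e 0)" for z x
    using y that by auto
  have B: "(\<exists>!y. vpair x y \<in> elts (e 0)) = (\<exists>y\<in>M. vpair x y \<in> elts (e 0) \<and> (\<forall>y'\<in>M. vpair x y' \<in> elts (e 0) \<longrightarrow> y' = y))" for x
  proof
    assume "\<exists>!y. vpair x y \<in> elts (e 0)"
    then obtain z where z: "vpair x z \<in> elts (e 0)" "\<forall>y. vpair x y \<in> elts (e 0) \<longrightarrow> y = z" by (rule ex1E)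
    show "\<exists>y\<in>M. vpair x y \<in> elts (e 0) \<and> (\<forall>y'\<in>M. vpair x y' \<in> elts (e 0) \<longrightarrow> y' = y)"
      by (rule bexI[OF _ y[OF z(1)]], rule conjI[OF z(1)]) (simp add: z(2)[rule_format])
  next
    assume "\<exists>y\<in>M. vpair x y \<in> elts (e 0) \<and> (\<forall>y'\<in>M. vpair x y' \<in> elts (e 0) \<longrightarrow> y' = y)"
    then obtain z where z: "vpair x z \<in> elts (e 0)" "\<forall>y'\<in>M. vpair x y' \<in> elts (e 0) \<longrightarrow> y' = z" by blast
    show "\<exists>!y. vpair x y \<in> elts (e 0)"
      by (rule ex1I[of _ z], rule z(1)) (simp add: z(2)[rule_format, OF y])
  qed
  show "vfun (e 0) (e 1) = ((\<forall>z\<in>elts (e 0). \<exists>x\<in>elts (e 1). \<exists>y\<in>M. z = vpair x y) \<and>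
     (\<forall>x\<in>elts (e 1). \<exists>y\<in>M. vpair x y \<in> elts (e 0) \<and> (\<forall>y'\<in>M. vpair x y' \<in> elts (e 0) \<longrightarrow> y' = y)))"
    unfolding vfun_def B using A by (intro arg_cong2[where f = "(\<and>)"] ball_cong bex_cong refl)
qed

lemma pd_vfun [pdi]: "pt S \<Longrightarrow> pt T \<Longrightarrow> pd (\<lambda>M e. vfun (S M e) (T M e))"
  by (rule pd_pred2[of "\<lambda>M. vfun", OF pd_vfun0])

text \<open>Three unions bound the elements: the first contains the unordered pair of argument and
  value, the second the value, the third its elements. So \<open>ap f x\<close> has a first-order
  description even when \<open>f\<close> is no function, and inner models compute it
  correctly.\<close>

lemma elts_ap: "elts (ap f x) = {u. \<exists>y. vpair x y \<in> elts f \<and> u \<in> elts y}"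
proof -
  define UU :: "'a \<Rightarrow> 'a" where "UU x = vset (\<Union>y\<in>elts x. elts y)" for x
  have UU: "y \<in> elts x \<Longrightarrow> u \<in> elts y \<Longrightarrow> u \<in> elts (UU x)" for x y u by (auto simp: UU_def)
  have "{u. \<exists>y. vpair x y \<in> elts f \<and> u \<in> elts y} \<subseteq> elts (UU (UU (UU f)))"
  proof
    fix u assume "u \<in> {u. \<exists>y. vpair x y \<in> elts f \<and> u \<in> elts y}"
    then obtain y where y: "vpair x y \<in> elts f" "u \<in> elts y" by blast
    have "vset {x, y} \<in> elts (UU f)" by (rule UU[OF y(1)]) (simp add: elts_vpair)
    then have "y \<in> elts (UU (UU f))" by (rule UU) simp
    then show "u \<in> elts (UU (UU (UU f)))" using y(2) by (rule UU)
  qed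
  moreover have "vd (\<lambda>e. e 0 \<in> {u. \<exists>y. vpair x y \<in> elts f \<and> u \<in> elts y})" by (intro vdi)
  ultimately show ?thesis unfolding ap_def vthe_def
    by (intro elts_vset small_subset[of _ "UU (UU (UU f))"])
qed

lemma pt_ap0: "pt (\<lambda>M e. ap (e 0) (e 1))" unfolding pt_def
proof (rule pd_cong)
  show "pd (\<lambda>M e. (\<forall>u\<in>elts (e 0). \<exists>y\<in>M. vpair (e (Suc 1)) y \<in> elts (e (Suc 0)) \<and> u \<in> elts y) \<and>
    (\<forall>y\<in>M. vpair (e (Suc 1)) y \<in> elts (e (Suc 0)) \<longrightarrow> elts y \<subseteq> elts (e 0)))" by (intro pdi)
  fix M :: "'a set" and e :: "nat \<Rightarrow> 'a" assume M: "inner_model M" "\<And>i. e i \<in> M"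
  have "y \<in> M" if "vpair x y \<in> elts (e (Suc 0))" for x y using inner_model_vpairD[OF M(1) M(2) that] by simp
  then show "(e 0 = ap (e (Suc 0)) (e (Suc 1))) = ((\<forall>u\<in>elts (e 0). \<exists>y\<in>M. vpair (e (Suc 1)) y \<in> elts (e (Suc 0)) \<and> u \<in> elts y) \<and>
    (\<forall>y\<in>M. vpair (e (Suc 1)) y \<in> elts (e (Suc 0)) \<longrightarrow> elts y \<subseteq> elts (e 0)))"
    unfolding elts_eq_iff[of "e 0", symmetric] elts_ap by blast
qed

lemma pt_ap [pdi]: "pt S \<Longrightarrow> pt T \<Longrightarrow> pt (\<lambda>M e. ap (S M e) (T M e))"
  by (rule pt_fun2[where F = "\<lambda>M. ap", OF pt_ap0])

lemma pt_vsucc [pdi]: "pt S \<Longrightarrow> pt (\<lambda>M e. vsucc (S M e))"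
proof (rule pt_fun[where F = "\<lambda>M. vsucc"])
  have eq: "(z = vsucc x) = (x \<in> elts z \<and> elts x \<subseteq> elts z \<and> (\<forall>w\<in>elts z. w = x \<or> w \<in> elts x))" for x z :: 'a
    unfolding elts_eq_iff[of z, symmetric] elts_vsucc by blast
  show "pt (\<lambda>M e. vsucc (e 0 :: 'a))" unfolding pt_def eq by (intro pdi)
qed

lemma pt_v0 [pdi]: "pt (\<lambda>M e. v0)"
proof -
  have eq: "(z = v0) = (\<forall>w\<in>elts z. w \<noteq> w)" for z :: 'a by (auto simp flip: empty_v0)
  show ?thesis unfolding pt_def eq by (intro pdi)
qed

lemma pd_transitive_set [pdi]: "pt S \<Longrightarrow> pd (\<lambda>M e. transitive_set (S M e))"
  by (rule pd_pred[of "\<lambda>M. transitive_set"]) (unfold transitive_set_def, intro pdi)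

lemma pd_Ord [pdi]: "pt S \<Longrightarrow> pd (\<lambda>M e. Ord (S M e))"
  by (rule pd_pred[of "\<lambda>M. Ord"]) (unfold Ord_def, intro pdi)

lemma pt_omega [pdi]: "pt (\<lambda>M e. omega)"
proof -
  \<comment> \<open>A description with bounded quantifiers. Closure under successor gives one
    inclusion by induction; for the other, a least non-natural element of \<open>z\<close> would be
    zero or the successor of a natural.\<close>
  have eq: "(z = omega) = (v0 \<in> elts z \<and> (\<forall>n\<in>elts z. vsucc n \<in> elts z) \<and>
      (\<forall>n\<in>elts z. n = v0 \<or> (\<exists>k\<in>elts z. n = vsucc k)))" (is "_ = ?R") for z :: 'a
  proof
    assume "z = omega" then show ?R
      by (auto simp: natural_v0 natural_vsucc elim: natural_cases)
  next
    assume R: ?R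
    have "n \<in> elts z" if "natural n" for n
      using that
    proof (induction n rule: natural_induct)
      case dfn show ?case by (intro vdi)
    qed (use R in auto)
    moreover have "natural n" if "n \<in> elts z" for n
    proof (rule ccontr)
      assume nn: "\<not> natural n"
      have v: "vd (\<lambda>e. \<not> natural (e 0 :: 'a))" by (intro vdi)
      obtain m where m: "m \<in> elts z" "\<not> natural m" "\<And>y. y \<in> elts z \<Longrightarrow> \<not> natural y \<Longrightarrow> y \<notin> elts m"
        by (rule wf_rel_min[OF wf_rel_mem v \<open>n \<in> elts z\<close> nn]) blast
      have "m \<noteq> v0" using natural_v0 m(2) by blast
      then obtain k where "k \<in> elts z" "m = vsucc k" using R m(1) by blast
      then show False using m natural_vsucc[of k] by auto
    qed
    ultimately have "elts z = elts omega" by auto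
    then show "z = omega" by (rule extensionality)
  qed
  show ?thesis unfolding pt_def eq by (intro pdi)
qed

text \<open>The symmetric difference is unfolded into quantifiers bounded by \<open>a\<close> and
  \<open>b\<close>, which makes the order absolute for inner models.\<close>

definition fless :: "'v::zfc \<Rightarrow> 'v \<Rightarrow> bool" where
  "fless a b \<longleftrightarrow> (\<exists>\<delta>\<in>elts b. \<delta> \<notin> elts a \<and> (\<forall>\<xi>\<in>elts a. \<xi> \<notin> elts b \<longrightarrow> \<xi> = \<delta> \<or> \<xi> \<in> elts \<delta>) \<and>
      (\<forall>\<xi>\<in>elts b. \<xi> \<notin> elts a \<longrightarrow> \<xi> = \<delta> \<or> \<xi> \<in> elts \<delta>))"

lemma fin_less_eq: "fin_less = fless"
  by (intro ext) (auto simp: fin_less_def fless_def)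

lemma pd_fless [pdi]: "pt S \<Longrightarrow> pt T \<Longrightarrow> pd (\<lambda>M e. fless (S M e) (T M e))"
  by (rule pd_pred2[of "\<lambda>M. fless"]) (unfold fless_def, intro pdi)

definition bij_fun :: "'v::zfc \<Rightarrow> 'v \<Rightarrow> 'v \<Rightarrow> bool" where
  "bij_fun f n b \<longleftrightarrow> vfun f n \<and> (\<forall>x\<in>elts n. ap f x \<in> elts b) \<and> (\<forall>x\<in>elts n. \<forall>y\<in>elts n. ap f x = ap f y \<longrightarrow> x = y) \<and>
     (\<forall>z\<in>elts b. \<exists>x\<in>elts n. z = ap f x)"

lemma bij_fun_iff: "bij_fun f n b \<longleftrightarrow> vfun f n \<and> bij_betw (ap f) (elts n) (elts b)"
  unfolding bij_fun_def bij_betw_def inj_on_def set_eq_subset image_subset_iff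
  by (auto simp: subset_eq image_iff)

lemma has_size_iff: "has_size b n \<longleftrightarrow> (\<exists>f. bij_fun f n b)"
proof -
  have "bij_betw (app f) (elts n) (elts b) \<longleftrightarrow> bij_betw (ap f) (elts n) (elts b)" if "vfun f n" for f
    using app_ap[OF that] by (intro bij_betw_cong)
  then show ?thesis unfolding has_size_def bij_fun_iff by (metis (no_types))
qed

lemma pd_bij_fun [pdi]: "pt S \<Longrightarrow> pt T \<Longrightarrow> pt W \<Longrightarrow> pd (\<lambda>M e. bij_fun (S M e) (T M e) (W M e))"
  by (rule pd_pred3[of "\<lambda>M. bij_fun"]) (unfold bij_fun_def, intro pdi)

text \<open>Relative to \<open>M\<close>, which has to contain the enumeration. Passing from
  \<open>M\<close> to the universe is immediate; the way back into an ultrapower needs closure and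
  is \<open>finord_MU\<close>.\<close>

definition finord :: "'v::zfc set \<Rightarrow> 'v \<Rightarrow> bool" where
  "finord M b \<longleftrightarrow> (\<forall>\<xi>\<in>elts b. Ord \<xi>) \<and> (\<exists>n\<in>elts omega. \<exists>f\<in>M. bij_fun f n b)"

lemma fin_ords_iff: "b \<in> fin_ords \<longleftrightarrow> finord UNIV b"
  by (auto simp: fin_ords_def vfinite_def has_size_iff finord_def)

lemma pd_finord [pdi]: "pt S \<Longrightarrow> pd (\<lambda>M e. finord M (S M e))"
  by (rule pd_pred[of finord]) (unfold finord_def, intro pdi)

lemma finord_mono: "finord M b \<Longrightarrow> finord UNIV b" unfolding finord_def by blast

section \<open>Ultrapowers\<close>

subsection \<open>Countably complete ultrafilters\<close>

text \<open>The quantifier "for almost all x". It makes sense for any HOL predicate; definability of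
  \<open>P\<close> is asked for only where a set of points has to be formed, as in
  \<open>ae_not\<close>, \<open>ae_iff_set\<close> and \<open>ae_nat\<close>.\<close>

definition ae :: "'v::zfc \<Rightarrow> ('v \<Rightarrow> bool) \<Rightarrow> bool" where
  "ae U P \<longleftrightarrow> (\<exists>A\<in>elts U. \<forall>x\<in>elts A. P x)"

lemma pd_ae [pdi]: assumes "pt T" "pd (\<lambda>M e. P M (e 0) (\<lambda>i. e (Suc i)))" shows "pd (\<lambda>M e. ae (T M e) (\<lambda>x. P M x e))"
proof -
  have "pd (\<lambda>M e. P M (e 0) (\<lambda>i. e (Suc (Suc i))))"
    using pd_ren[OF assms(2), of "case_nat 0 (\<lambda>i. Suc (Suc i))"] by simp
  then show ?thesis unfolding ae_def by (intro pdi assms(1))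
qed

lemma vd_ae [vdi]: assumes "dt T" "vd (\<lambda>e. P (e 0) (\<lambda>i. e (Suc i)))" shows "vd (\<lambda>e. ae (T e) (\<lambda>x. P x e))"
proof -
  have "vd (\<lambda>e. P (e 0) (\<lambda>i. e (Suc (Suc i))))"
    using vd_ren[OF assms(2), of "case_nat 0 (\<lambda>i. Suc (Suc i))"] by simp
  then show ?thesis unfolding ae_def by (intro vdi assms(1))
qed

lemma cc_ultrafilter_on_iff: "cc_ultrafilter_on M X U \<longleftrightarrow>
     U \<in> M \<and> (\<forall>A\<in>elts U. elts A \<subseteq> elts X) \<and> X \<in> elts U \<and> v0 \<notin> elts U \<and>
     (\<forall>A\<in>elts U. \<forall>B\<in>M. elts A \<subseteq> elts B \<and> elts B \<subseteq> elts X \<longrightarrow> B \<in> elts U) \<and>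
     (\<forall>A\<in>elts U. \<forall>B\<in>elts U. vset {x \<in> elts A. x \<in> elts B} \<in> elts U) \<and>
     (\<forall>A\<in>M. elts A \<subseteq> elts X \<longrightarrow> A \<in> elts U \<or> vset {x \<in> elts X. x \<notin> elts A} \<in> elts U) \<and>
     (\<forall>s\<in>M. vfun s omega \<and> (\<forall>n\<in>elts omega. ap s n \<in> elts U) \<longrightarrow>
        vset {x \<in> elts (ap s v0). \<forall>n\<in>elts omega. x \<in> elts (ap s n)} \<in> elts U)"
proof -
  have 1: "elts A \<inter> elts B = {x \<in> elts A. x \<in> elts B}" for A B :: 'a by auto
  have 2: "elts X - elts A = {x \<in> elts X. x \<notin> elts A}" for A :: 'a by auto
  have 3: "(\<Inter>n\<in>elts omega. elts (app s n)) = {x \<in> elts (ap s v0). \<forall>n\<in>elts omega. x \<in> elts (ap s n)}"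
      "(\<forall>n\<in>elts omega. app s n \<in> elts U) = (\<forall>n\<in>elts omega. ap s n \<in> elts U)" if "vfun s omega" for s :: 'a
    using app_ap[OF that] natural_v0 by auto
  have 4: "(vfun s omega \<and> (\<forall>n\<in>elts omega. app s n \<in> elts U) \<longrightarrow> vset (\<Inter>n\<in>elts omega. elts (app s n)) \<in> elts U) =
      (vfun s omega \<and> (\<forall>n\<in>elts omega. ap s n \<in> elts U) \<longrightarrow>
        vset {x \<in> elts (ap s v0). \<forall>n\<in>elts omega. x \<in> elts (ap s n)} \<in> elts U)" for s
  proof (cases "vfun s omega")
    case True show ?thesis unfolding 3[OF True] by (rule refl)
  qed simp
  show ?thesis unfolding cc_ultrafilter_on_def 1 2 4 v0_def[symmetric] by (rule refl)
qed

lemma pd_cc_ultrafilter_on [pdi]: "pt S \<Longrightarrow> pt T \<Longrightarrow> pd (\<lambda>M e. cc_ultrafilter_on M (S M e) (T M e))"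
  by (rule pd_pred2[of cc_ultrafilter_on]) (unfold cc_ultrafilter_on_iff, intro pdi)

lemma vd_cc_ultrafilter_on [vdi]: "dt S \<Longrightarrow> dt T \<Longrightarrow> vd (\<lambda>e. cc_ultrafilter_on UNIV (S e) (T e))"
  by (rule vd_pd2) (intro pdi)

lemma cc_restrict: "cc_ultrafilter_on UNIV X U \<Longrightarrow> U \<in> M \<Longrightarrow> cc_ultrafilter_on M X U"
  unfolding cc_ultrafilter_on_def by blast

definition umem :: "'v::zfc \<Rightarrow> 'v \<Rightarrow> 'v \<Rightarrow> bool" where
  "umem U f g \<longleftrightarrow> ae U (\<lambda>x. ap f x \<in> elts (ap g x))"
definition ueq :: "'v::zfc \<Rightarrow> 'v \<Rightarrow> 'v \<Rightarrow> bool" where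
  "ueq U f g \<longleftrightarrow> ae U (\<lambda>x. ap f x = ap g x)"

text \<open>\<open>collapse_approx\<close> in a form to which \<open>pd\<close> applies: quantifiers
  bounded by sets or by \<open>M\<close>, \<open>ap\<close> for \<open>app\<close>, and
  \<open>ae\<close> in place of sets of agreement. The link is
  \<open>collapse_approx_iff\<close>.\<close>

definition collapse_on :: "'v::zfc set \<Rightarrow> 'v \<Rightarrow> 'v \<Rightarrow> 'v \<Rightarrow> 'v \<Rightarrow> bool" where
  "collapse_on M X U t p \<longleftrightarrow> (\<forall>f\<in>elts t. vfun f X) \<and> vfun p t \<and>
     (\<forall>g\<in>elts t. \<forall>f\<in>M. vfun f X \<longrightarrow> umem U f g \<longrightarrow> (\<exists>f'\<in>elts t. ueq U f' f)) \<and>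
     (\<forall>g\<in>elts t. (\<forall>y\<in>elts (ap p g). \<exists>f\<in>elts t. umem U f g \<and> y = ap p f) \<and>
        (\<forall>f\<in>elts t. umem U f g \<longrightarrow> ap p f \<in> elts (ap p g)))"

definition collapses_to :: "'v::zfc set \<Rightarrow> 'v \<Rightarrow> 'v \<Rightarrow> 'v \<Rightarrow> 'v \<Rightarrow> bool" where
  "collapses_to M X U f y \<longleftrightarrow> (\<exists>t\<in>M. \<exists>p\<in>M. collapse_on M X U t p \<and> f \<in> elts t \<and> y = ap p f)"

lemma pd_umem [pdi]: "pt S \<Longrightarrow> pt T \<Longrightarrow> pt W \<Longrightarrow> pd (\<lambda>M e. umem (S M e) (T M e) (W M e))"
  by (rule pd_pred3[of "\<lambda>M. umem"]) (unfold umem_def, intro pdi)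
lemma pd_ueq [pdi]: "pt S \<Longrightarrow> pt T \<Longrightarrow> pt W \<Longrightarrow> pd (\<lambda>M e. ueq (S M e) (T M e) (W M e))"
  by (rule pd_pred3[of "\<lambda>M. ueq"]) (unfold ueq_def, intro pdi)
lemma pd_collapse_on [pdi]: "pt S \<Longrightarrow> pt T \<Longrightarrow> pt W \<Longrightarrow> pt Y \<Longrightarrow> pd (\<lambda>M e. collapse_on M (S M e) (T M e) (W M e) (Y M e))"
  by (rule pd_pred4[of collapse_on]) (unfold collapse_on_def, intro pdi)
lemma pd_collapses_to [pdi]: "pt S \<Longrightarrow> pt T \<Longrightarrow> pt W \<Longrightarrow> pt Y \<Longrightarrow> pd (\<lambda>M e. collapses_to M (S M e) (T M e) (W M e) (Y M e))"
  by (rule pd_pred4[of collapses_to]) (unfold collapses_to_def, intro pdi)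
lemma vd_umem [vdi]: "dt S \<Longrightarrow> dt T \<Longrightarrow> dt W \<Longrightarrow> vd (\<lambda>e. umem (S e) (T e) (W e))"
  unfolding umem_def by (rule vd_pd3[of "\<lambda>M U f g. ae U (\<lambda>x. ap f x \<in> elts (ap g x))"]) (intro pdi)
lemma vd_ueq [vdi]: "dt S \<Longrightarrow> dt T \<Longrightarrow> dt W \<Longrightarrow> vd (\<lambda>e. ueq (S e) (T e) (W e))"
  unfolding ueq_def by (rule vd_pd3[of "\<lambda>M U f g. ae U (\<lambda>x. ap f x = ap g x)"]) (intro pdi)
lemma vd_collapses_to [vdi]: "dt S \<Longrightarrow> dt T \<Longrightarrow> dt W \<Longrightarrow> dt Y \<Longrightarrow> vd (\<lambda>e. collapses_to UNIV (S e) (T e) (W e) (Y e))"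
  by (rule vd_pd4[of collapses_to]) (intro pdi)

lemma small_vfuns: "small {g. vfun g X \<and> (\<forall>x\<in>elts X. ap g x \<in> elts T)}"
proof -
  define F where "F x = vset ((\<lambda>y. vpair x y) ` elts T)" for x
  define Q where "Q = vset (\<Union>x\<in>elts X. elts (F x))"
  have F: "elts (F x) = (\<lambda>y. vpair x y) ` elts T" for x
    unfolding F_def by (intro elts_vset small_image vdi)
  have Q: "elts Q = (\<Union>x\<in>elts X. elts (F x))"
    unfolding Q_def F_def by (intro elts_vset small_UN vdi)
  have "elts g \<subseteq> elts Q" if "vfun g X" "\<forall>x\<in>elts X. ap g x \<in> elts T" for g
    unfolding vfun_elts[OF that(1)] Q F using that(2) by auto
  then show ?thesis by (intro small_subset[of _ "vPow Q"]) (intro vdi, auto)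
qed

definition vfuns :: "'v::zfc \<Rightarrow> 'v \<Rightarrow> 'v" where
  "vfuns X T = vset {g. vfun g X \<and> (\<forall>x\<in>elts X. ap g x \<in> elts T)}"

lemma elts_vfuns [simp]: "elts (vfuns X T) = {g. vfun g X \<and> (\<forall>x\<in>elts X. ap g x \<in> elts T)}"
  by (simp add: vfuns_def small_vfuns)

section \<open>Countably complete ultrafilters of the universe and the collapse of their
  ultrapowers\<close>

locale uf =
  fixes U X :: "'v::zfc"
  assumes uf: "cc_ultrafilter_on UNIV X U"
begin

lemma sub: "A \<in> elts U \<Longrightarrow> elts A \<subseteq> elts X" using uf unfolding cc_ultrafilter_on_iff by blast
lemma X_in: "X \<in> elts U" using uf unfolding cc_ultrafilter_on_iff by blast
lemma up: "A \<in> elts U \<Longrightarrow> elts A \<subseteq> elts B \<Longrightarrow> elts B \<subseteq> elts X \<Longrightarrow> B \<in> elts U"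
  using uf unfolding cc_ultrafilter_on_iff by blast

lemma ae_mono: assumes "ae U P" "\<And>x. x \<in> elts X \<Longrightarrow> P x \<Longrightarrow> Q x" shows "ae U Q"
proof -
  obtain A where "A \<in> elts U" "\<forall>x\<in>elts A. P x" using assms(1) unfolding ae_def by blast
  then show ?thesis using assms(2) sub[of A] unfolding ae_def by blast
qed

lemma ae_cong: "(\<And>x. x \<in> elts X \<Longrightarrow> P x = Q x) \<Longrightarrow> ae U P = ae U Q"
  using ae_mono[of P Q] ae_mono[of Q P] by blast

lemma ae_conj: assumes "ae U P" "ae U Q" shows "ae U (\<lambda>x. P x \<and> Q x)"
proof -
  obtain A B where AB: "A \<in> elts U" "\<forall>x\<in>elts A. P x" "B \<in> elts U" "\<forall>x\<in>elts B. Q x"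
    using assms unfolding ae_def by blast
  have "vset {x \<in> elts A. x \<in> elts B} \<in> elts U" using uf AB(1,3) unfolding cc_ultrafilter_on_iff by blast
  moreover have "elts (vset {x \<in> elts A. x \<in> elts B}) = {x \<in> elts A. x \<in> elts B}"
    by (intro elts_vset small_sep vdi)
  ultimately show ?thesis unfolding ae_def using AB(2,4) by (intro bexI[of _ "vset {x \<in> elts A. x \<in> elts B}"]) simp_all
qed

lemma ae_mp: assumes "ae U P" "ae U Q" "\<And>x. x \<in> elts X \<Longrightarrow> P x \<Longrightarrow> Q x \<Longrightarrow> R x" shows "ae U R"
  by (rule ae_mono[OF ae_conj[OF assms(1,2)]]) (use assms(3) in blast)

lemma ae_carrier: "ae U (\<lambda>x. x \<in> elts X)" unfolding ae_def using X_in by blast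

lemma ae_triv: "(\<And>x. x \<in> elts X \<Longrightarrow> P x) \<Longrightarrow> ae U P" using ae_mono[OF ae_carrier] by blast

lemma ae_ex: assumes "ae U P" shows "\<exists>x\<in>elts X. P x"
proof -
  obtain A where A: "A \<in> elts U" "\<forall>x\<in>elts A. P x" using assms unfolding ae_def by blast
  have "A \<noteq> v0" using uf A(1) unfolding cc_ultrafilter_on_iff by blast
  then obtain x where "x \<in> elts A" using empty_v0[of A] by blast
  then show ?thesis using A sub[of A] by blast
qed

lemma ae_const: "ae U (\<lambda>x. b) = b" using ae_ex[of "\<lambda>x. b"] ae_triv[of "\<lambda>x. b"] by blast

lemma ae_set: "elts A \<subseteq> elts X \<Longrightarrow> A \<in> elts U \<longleftrightarrow> ae U (\<lambda>x. x \<in> elts A)"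
  unfolding ae_def using up[of _ A] by blast

lemma ae_iff_set: assumes "vd (\<lambda>e. P (e 0))" shows "ae U P \<longleftrightarrow> vset {x \<in> elts X. P x} \<in> elts U"
proof -
  have "elts (vset {x \<in> elts X. P x}) = {x \<in> elts X. P x}" by (intro elts_vset small_sep assms)
  then show ?thesis by (subst ae_set) (auto intro!: ae_cong)
qed

lemma ae_not: assumes "vd (\<lambda>e. P (e 0))" shows "ae U (\<lambda>x. \<not> P x) \<longleftrightarrow> \<not> ae U P"
proof
  assume n: "ae U (\<lambda>x. \<not> P x)"
  show "\<not> ae U P"
  proof
    assume "ae U P"
    from ae_ex[OF ae_conj[OF n this]] show False by blast
  qed
next
  assume n: "\<not> ae U P"
  define A where "A = vset {x \<in> elts X. P x}"
  have A: "elts A = {x \<in> elts X. P x}" unfolding A_def by (intro elts_vset small_sep assms)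
  have "A \<notin> elts U" using n ae_iff_set[OF assms] A_def by simp
  moreover have "elts A \<subseteq> elts X" using A by blast
  ultimately have "vset {x \<in> elts X. x \<notin> elts A} \<in> elts U" using uf unfolding cc_ultrafilter_on_iff by blast
  moreover have "elts (vset {x \<in> elts X. x \<notin> elts A}) = {x \<in> elts X. x \<notin> elts A}"
    by (intro elts_vset small_sep vdi)
  ultimately show "ae U (\<lambda>x. \<not> P x)" unfolding ae_def
    by (intro bexI[of _ "vset {x \<in> elts X. x \<notin> elts A}"]) (auto simp: A)
qed

lemma ae_nat:
  assumes "vd (\<lambda>e. P (e 0) (e 1))" "\<And>n. natural n \<Longrightarrow> ae U (P n)"
  shows "ae U (\<lambda>x. \<forall>n. natural n \<longrightarrow> P n x)"
proof -
  have P1: "vd (\<lambda>e. P (S e) (T e))" if "dt S" "dt T" for S T by (rule vd_pred2[OF assms(1) that])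
  define A where "A n = vset {x \<in> elts X. P n x}" for n
  have A: "elts (A n) = {x \<in> elts X. P n x}" for n unfolding A_def by (intro elts_vset small_sep P1 vdi)
  have dA: "dt (\<lambda>e. A (e 0))" unfolding A_def by (intro vdi P1)
  define s where "s = vlam omega A"
  have s: "vfun s omega" "\<And>n. natural n \<Longrightarrow> ap s n = A n" unfolding s_def by (simp_all add: vlam_vfun dA)
  have "A n \<in> elts U" if "natural n" for n
    using assms(2)[OF that] A by (subst ae_set) (auto elim!: ae_mono)
  then have "\<forall>n\<in>elts omega. ap s n \<in> elts U" using s(2) by simp
  moreover have "\<forall>s\<in>UNIV. vfun s omega \<and> (\<forall>n\<in>elts omega. ap s n \<in> elts U) \<longrightarrow>
        vset {x \<in> elts (ap s v0). \<forall>n\<in>elts omega. x \<in> elts (ap s n)} \<in> elts U"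
    using uf unfolding cc_ultrafilter_on_iff by (elim conjE)
  ultimately have 1: "vset {x \<in> elts (ap s v0). \<forall>n\<in>elts omega. x \<in> elts (ap s n)} \<in> elts U"
    using s(1) by blast
  have "elts (vset {x \<in> elts (ap s v0). \<forall>n\<in>elts omega. x \<in> elts (ap s n)}) =
      {x \<in> elts (ap s v0). \<forall>n\<in>elts omega. x \<in> elts (ap s n)}"
    by (intro elts_vset small_sep vdi)
  then show ?thesis unfolding ae_def
    by (intro bexI[OF _ 1]) (simp add: s(2) A natural_v0)
qed

lemma carrier_eq: "carrier U = X"
proof -
  have "(\<Union>A\<in>elts U. elts A) = elts X" using sub X_in by blast
  then show ?thesis by (simp add: carrier_def)
qed

lemma umem_ueq: "umem U f g \<Longrightarrow> ueq U f f' \<Longrightarrow> umem U f' g"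
  unfolding umem_def ueq_def by (erule (1) ae_mp) simp
lemma umem_ueq2: "umem U f g \<Longrightarrow> ueq U g g' \<Longrightarrow> umem U f g'"
  unfolding umem_def ueq_def by (erule (1) ae_mp) simp
lemma ueq_sym: "ueq U f g \<Longrightarrow> ueq U g f" unfolding ueq_def by (erule ae_mono) simp
lemma ueq_trans: "ueq U f g \<Longrightarrow> ueq U g h \<Longrightarrow> ueq U f h" unfolding ueq_def by (erule (1) ae_mp) simp
text \<open>Without a minimal element, choice and recursion give functions descending modulo
  \<open>U\<close>. Countable completeness provides one \<open>x\<close> at which all the descents
  hold, and the values at \<open>x\<close> violate foundation.\<close>

lemma wf_umem: "wf_rel t (umem U)"
  unfolding wf_rel_def
proof (intro allI impI, rule ccontr)
  fix u assume u: "elts u \<subseteq> elts t \<and> elts u \<noteq> {}" and n: "\<not> (\<exists>m\<in>elts u. \<forall>y\<in>elts u. \<not> umem U y m)"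
  have v: "vd (\<lambda>e. e 1 \<in> elts u \<and> umem U (e 1) (e 0))" by (intro vdi)
  obtain c where c: "vfun c u" "\<And>m. m \<in> elts u \<Longrightarrow> ap c m \<in> elts u \<and> umem U (ap c m) m"
    by (rule choose_fun[of "\<lambda>m y. y \<in> elts u \<and> umem U y m" u, OF v]) (use n in blast)+
  obtain m0 where m0: "m0 \<in> elts u" using u by blast
  have d: "dt (\<lambda>e. ap c (e 1))" by (intro vdi)
  obtain s where s: "ap s v0 = m0" "\<And>n. natural n \<Longrightarrow> ap s (vsucc n) = ap c (ap s n)"
    using omega_rec[of "\<lambda>_ x. ap c x" m0, OF d] by blast
  have su: "ap s n \<in> elts u" if "natural n" for n using that
  proof (induction n rule: natural_induct)
    case dfn show ?case by (intro vdi)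
  qed (use s m0 c in auto)
  have "ae U (\<lambda>x. \<forall>n. natural n \<longrightarrow> ap (ap s (vsucc n)) x \<in> elts (ap (ap s n) x))"
  proof (rule ae_nat)
    show "vd (\<lambda>e. ap (ap s (vsucc (e 0))) (e 1) \<in> elts (ap (ap s (e 0)) (e 1)))" by (intro vdi)
    show "ae U (\<lambda>x. ap (ap s (vsucc n)) x \<in> elts (ap (ap s n) x))" if "natural n" for n
      using c(2)[OF su[OF that]] s(2)[OF that] unfolding umem_def by simp
  qed
  from ae_ex[OF this] obtain x where x: "\<And>n. natural n \<Longrightarrow> ap (ap s (vsucc n)) x \<in> elts (ap (ap s n) x)" by blast
  define D where "D = vset ((\<lambda>n. ap (ap s n) x) ` elts omega)"
  have D: "elts D = (\<lambda>n. ap (ap s n) x) ` elts omega" unfolding D_def by (intro elts_vset small_image vdi)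
  have "elts D \<noteq> {}" unfolding D using natural_v0 by auto
  then obtain y where y: "y \<in> elts D" "elts y \<inter> elts D = {}" using foundation by blast
  then obtain n where "natural n" "y = ap (ap s n) x" by (auto simp: D)
  then have "ap (ap s (vsucc n)) x \<in> elts y \<inter> elts D" using x natural_vsucc by (auto simp: D)
  then show False using y(2) by blast
qed

lemma collapses_to_ex: assumes "vfun f X" shows "\<exists>y. collapses_to UNIV X U f y"
proof -
  define R where "R = vset (ap f ` elts X)"
  have R: "elts R = ap f ` elts X" unfolding R_def by (intro elts_vset small_image vdi)
  \<comment> \<open>All functions from \<open>X\<close> into a transitive set suffice for an
    approximation: whatever is below one of them has values in \<open>T\<close> almost everywhere.
    \<open>v0\<close> is put into \<open>T\<close> as the default for the remaining values.\<close>
  obtain T where T: "transitive_set T" "insert v0 (elts R) \<subseteq> elts T"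
    using transitive_closure[of "vset (insert v0 (elts R))"] by auto
  define t where "t = vfuns X T"
  have t: "elts t = {g. vfun g X \<and> (\<forall>x\<in>elts X. ap g x \<in> elts T)}" by (simp add: t_def)
  have ft: "f \<in> elts t" using assms T(2) by (auto simp: t R)
  define G where "G g r = vset (ap r ` elts (vset {h \<in> elts t. umem U h g}))" for g r
  have dG: "dt (\<lambda>e. G (e 0) (e 1))" unfolding G_def by (intro vdi)
  have vu: "vd (\<lambda>e. umem U (e 0) (e 1))" by (intro vdi)
  obtain p where p: "vfun p t" "\<And>g. g \<in> elts t \<Longrightarrow> ap p g = G g (vlam (vset {h \<in> elts t. umem U h g}) (ap p))"
    using wf_rec[OF wf_umem vu dG, of t] by blast
  have pe: "elts (ap p g) = ap p ` {h \<in> elts t. umem U h g}" if "g \<in> elts t" for g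
  proof -
    have 1: "elts (vset {h \<in> elts t. umem U h g}) = {h \<in> elts t. umem U h g}" by (intro elts_vset small_sep vdi)
    have d: "dt (\<lambda>e. ap p (e 0))" by (intro vdi)
    have "ap (vlam (vset {h \<in> elts t. umem U h g}) (ap p)) ` {h \<in> elts t. umem U h g} = ap p ` {h \<in> elts t. umem U h g}"
      using ap_vlam[of "ap p" _ "vset {h \<in> elts t. umem U h g}", OF d] unfolding 1 by (rule image_cong[OF refl])
    moreover have "small (ap p ` {h \<in> elts t. umem U h g})" using small_image[OF d, of "vset {h \<in> elts t. umem U h g}"] unfolding 1 .
    ultimately show ?thesis unfolding p(2)[OF that] G_def 1 by simp
  qed
  have "collapse_on UNIV X U t p" unfolding collapse_on_def
  proof (intro conjI ballI impI)
    fix g f assume g: "g \<in> elts t" and f: "vfun f X" "umem U f g"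
    define F where "F x = (if ap f x \<in> elts T then ap f x else v0)" for x
    have dF: "dt (\<lambda>e. F (e 0))" unfolding F_def by (intro vdi)
    have lF: "vfun (vlam X F) X" "\<And>x. x \<in> elts X \<Longrightarrow> ap (vlam X F) x = F x" by (simp_all add: dF vlam_vfun)
    have "vlam X F \<in> elts t" unfolding t using T(2) lF by (auto simp: F_def)
    moreover have "ueq U (vlam X F) f" unfolding ueq_def
    proof (rule ae_mono[OF f(2)[unfolded umem_def]])
      fix x assume x: "x \<in> elts X" "ap f x \<in> elts (ap g x)"
      have "ap g x \<in> elts T" using g x(1) by (simp add: t)
      then have "ap f x \<in> elts T" using T(1) x(2) unfolding transitive_set_def by blast
      then show "ap (vlam X F) x = ap f x" using lF(2)[OF x(1)] by (simp add: F_def)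
    qed
    ultimately show "\<exists>f'\<in>elts t. ueq U f' f" by blast
  qed (use p(1) pe in \<open>auto simp: t\<close>)
  then show ?thesis using ft unfolding collapses_to_def by blast
qed

text \<open>Induction along \<open>umem\<close> on \<open>f\<close>, against all \<open>f'\<close>
  at once. Besides the uniqueness of the collapse this contains its injectivity: if the values of
  \<open>f\<close> and \<open>f'\<close> differ almost everywhere, \<open>wit\<close> picks
  pointwise an element of one that is missing in the other.\<close>

lemma collapse_on_eq:
  assumes 1: "collapse_on UNIV X U t p" and 2: "collapse_on UNIV X U t' p'" and ft: "f \<in> elts t"
  shows "\<forall>f'\<in>elts t'. ap p f = ap p' f' \<longleftrightarrow> ueq U f f'"
proof -
  have fn: "\<And>f. f \<in> elts t \<Longrightarrow> vfun f X" "\<And>f. f \<in> elts t' \<Longrightarrow> vfun f X" using 1 2 unfolding collapse_on_def by blast+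
  have cl: "\<exists>f'\<in>elts t. ueq U f' f" if "g \<in> elts t" "vfun f X" "umem U f g" for f g using 1 that unfolding collapse_on_def by blast
  have cl': "\<exists>f'\<in>elts t'. ueq U f' f" if "g \<in> elts t'" "vfun f X" "umem U f g" for f g using 2 that unfolding collapse_on_def by blast
  have dn: "\<exists>f\<in>elts t. umem U f g \<and> y = ap p f" if "g \<in> elts t" "y \<in> elts (ap p g)" for g y using 1 that unfolding collapse_on_def by blast
  have dn': "\<exists>f\<in>elts t'. umem U f g \<and> y = ap p' f" if "g \<in> elts t'" "y \<in> elts (ap p' g)" for g y using 2 that unfolding collapse_on_def by blast
  have up: "ap p f \<in> elts (ap p g)" if "g \<in> elts t" "f \<in> elts t" "umem U f g" for f g using 1 that unfolding collapse_on_def by blast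
  have up': "ap p' f \<in> elts (ap p' g)" if "g \<in> elts t'" "f \<in> elts t'" "umem U f g" for f g using 2 that unfolding collapse_on_def by blast
  show ?thesis
  proof (rule wf_rel_induct[OF wf_umem _ ft, of "\<lambda>f. \<forall>f'\<in>elts t'. ap p f = ap p' f' \<longleftrightarrow> ueq U f f'"])
    show "vd (\<lambda>e. \<forall>f'\<in>elts t'. ap p (e 0) = ap p' f' \<longleftrightarrow> ueq U (e 0) f')" by (intro vdi)
  next
    fix f assume f: "f \<in> elts t" and IH: "\<And>h. h \<in> elts t \<Longrightarrow> umem U h f \<Longrightarrow> \<forall>f'\<in>elts t'. ap p h = ap p' f' \<longleftrightarrow> ueq U h f'"
    show "\<forall>f'\<in>elts t'. ap p f = ap p' f' \<longleftrightarrow> ueq U f f'"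
    proof (intro ballI iffI)
      fix f' assume f': "f' \<in> elts t'" and eq: "ueq U f f'"
      show "ap p f = ap p' f'"
      proof (rule eltsI, rule iffI)
        fix y assume "y \<in> elts (ap p f)"
        then obtain h where h: "h \<in> elts t" "umem U h f" "y = ap p h" using dn[OF f] by blast
        have has_maxima: "umem U h f'" by (rule umem_ueq2[OF h(2) eq])
        then obtain h' where h': "h' \<in> elts t'" "ueq U h' h" using cl'[OF f' fn(1)[OF h(1)]] by blast
        have "ap p h = ap p' h'" using IH[OF h(1,2)] h' ueq_sym by blast
        moreover have "umem U h' f'" by (rule umem_ueq[OF has_maxima ueq_sym[OF h'(2)]])
        ultimately show "y \<in> elts (ap p' f')" using up'[OF f' h'(1)] h(3) by simp
      next
        fix y assume "y \<in> elts (ap p' f')"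
        then obtain h' where h': "h' \<in> elts t'" "umem U h' f'" "y = ap p' h'" using dn'[OF f'] by blast
        have has_maxima: "umem U h' f" by (rule umem_ueq2[OF h'(2) ueq_sym[OF eq]])
        then obtain h where h: "h \<in> elts t" "ueq U h h'" using cl[OF f fn(2)[OF h'(1)]] by blast
        have hf: "umem U h f" by (rule umem_ueq[OF has_maxima ueq_sym[OF h(2)]])
        have "ap p h = ap p' h'" using IH[OF h(1) hf] h(2) h'(1) by blast
        then show "y \<in> elts (ap p f)" using up[OF f h(1) hf] h'(3) by simp
      qed
    next
      fix f' assume f': "f' \<in> elts t'" and eq: "ap p f = ap p' f'"
      show "ueq U f f'"
      proof (rule ccontr)
        assume "\<not> ueq U f f'"
        then have ne: "ae U (\<lambda>x. ap f x \<noteq> ap f' x)" unfolding ueq_def by (subst ae_not) (intro vdi)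
        have wit: "\<exists>h. vfun h X \<and> umem U h g \<and> ae U (\<lambda>x. ap h x \<notin> elts (ap g' x))"
          if a: "ae U (\<lambda>x. \<exists>z. z \<in> elts (ap g x) \<and> z \<notin> elts (ap g' x))" for g g'
        proof -
          have v: "vd (\<lambda>e. (\<exists>z. z \<in> elts (ap g (e 0)) \<and> z \<notin> elts (ap g' (e 0))) \<longrightarrow>
              e 1 \<in> elts (ap g (e 0)) \<and> e 1 \<notin> elts (ap g' (e 0)))" by (intro vdi)
          obtain h where h: "vfun h X" "\<And>x. x \<in> elts X \<Longrightarrow> (\<exists>z. z \<in> elts (ap g x) \<and> z \<notin> elts (ap g' x)) \<longrightarrow>
              ap h x \<in> elts (ap g x) \<and> ap h x \<notin> elts (ap g' x)"
            by (rule choose_fun[of "\<lambda>x y. (\<exists>z. z \<in> elts (ap g x) \<and> z \<notin> elts (ap g' x)) \<longrightarrow>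
              y \<in> elts (ap g x) \<and> y \<notin> elts (ap g' x)" X, OF v]) blast+
          show ?thesis unfolding umem_def
            by (intro exI[of _ h] conjI h(1) ae_mono[OF a]) (use h(2) in blast)+
        qed
        have "ae U (\<lambda>x. \<exists>z. z \<in> elts (ap f x) \<and> z \<notin> elts (ap f' x)) \<or> ae U (\<lambda>x. \<exists>z. z \<in> elts (ap f' x) \<and> z \<notin> elts (ap f x))"
        proof (rule ccontr)
          assume n: "\<not> ?thesis"
          have "ae U (\<lambda>x. \<not> (\<exists>z. z \<in> elts (ap f x) \<and> z \<notin> elts (ap f' x)))" using n by (subst ae_not) (intro vdi, blast)
          moreover have "ae U (\<lambda>x. \<not> (\<exists>z. z \<in> elts (ap f' x) \<and> z \<notin> elts (ap f x)))" using n by (subst ae_not) (intro vdi, blast)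
          ultimately have "ae U (\<lambda>x. ap f x = ap f' x)" by (rule ae_mp) (rule eltsI, blast)
          from ae_ex[OF ae_conj[OF this ne]] show False by blast
        qed
        then show False
        proof
          assume "ae U (\<lambda>x. \<exists>z. z \<in> elts (ap f x) \<and> z \<notin> elts (ap f' x))"
          then obtain h where h: "vfun h X" "umem U h f" "ae U (\<lambda>x. ap h x \<notin> elts (ap f' x))" using wit by blast
          obtain h1 where h1: "h1 \<in> elts t" "ueq U h1 h" using cl[OF f h(1,2)] by blast
          have m: "umem U h1 f" by (rule umem_ueq[OF h(2) ueq_sym[OF h1(2)]])
          obtain h' where h': "h' \<in> elts t'" "umem U h' f'" "ap p h1 = ap p' h'"
            using dn'[OF f' up[OF f h1(1) m, unfolded eq]] by blast
          have "ueq U h1 h'" using IH[OF h1(1) m] h' by blast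
          then have "umem U h f'" using umem_ueq[OF h'(2)] ueq_sym ueq_trans h1(2) by blast
          from ae_ex[OF ae_conj[OF this[unfolded umem_def] h(3)]] show False by blast
        next
          assume "ae U (\<lambda>x. \<exists>z. z \<in> elts (ap f' x) \<and> z \<notin> elts (ap f x))"
          then obtain h where h: "vfun h X" "umem U h f'" "ae U (\<lambda>x. ap h x \<notin> elts (ap f x))" using wit by blast
          obtain h1 where h1: "h1 \<in> elts t'" "ueq U h1 h" using cl'[OF f' h(1,2)] by blast
          have m: "umem U h1 f'" by (rule umem_ueq[OF h(2) ueq_sym[OF h1(2)]])
          obtain k where k: "k \<in> elts t" "umem U k f" "ap p' h1 = ap p k"
            using dn[OF f up'[OF f' h1(1) m, folded eq]] by blast
          have "ueq U k h1" using IH[OF k(1,2)] k(3)[symmetric] h1(1) by blast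
          then have "umem U h f" using umem_ueq[OF k(2)] ueq_trans h1(2) by blast
          from ae_ex[OF ae_conj[OF this[unfolded umem_def] h(3)]] show False by blast
        qed
      qed
    qed
  qed
qed

lemma collapses_to_eq: assumes "collapses_to UNIV X U f y" "collapses_to UNIV X U g z" shows "y = z \<longleftrightarrow> ueq U f g"
proof -
  obtain t p where 1: "collapse_on UNIV X U t p" "f \<in> elts t" "y = ap p f" using assms(1) unfolding collapses_to_def by blast
  obtain t' p' where 2: "collapse_on UNIV X U t' p'" "g \<in> elts t'" "z = ap p' g" using assms(2) unfolding collapses_to_def by blast
  show ?thesis using collapse_on_eq[OF 1(1) 2(1) 1(2)] 1 2 by blast
qed

lemma collapses_to_mem: assumes "collapses_to UNIV X U f y" "collapses_to UNIV X U g z" shows "y \<in> elts z \<longleftrightarrow> umem U f g"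
proof -
  obtain t p where 1: "collapse_on UNIV X U t p" "f \<in> elts t" "y = ap p f" using assms(1) unfolding collapses_to_def by blast
  obtain t' p' where 2: "collapse_on UNIV X U t' p'" "g \<in> elts t'" "z = ap p' g" using assms(2) unfolding collapses_to_def by blast
  note eq = collapse_on_eq[OF 1(1) 2(1) 1(2)]
  show ?thesis
  proof
    assume "y \<in> elts z"
    then obtain h where h: "h \<in> elts t'" "umem U h g" "y = ap p' h" using 2 unfolding collapse_on_def by blast
    then have "ueq U f h" using eq 1(3) by auto
    then show "umem U f g" using umem_ueq[OF h(2)] ueq_sym by blast
  next
    assume m: "umem U f g"
    have "vfun f X" using 1 unfolding collapse_on_def by blast
    then obtain f' where f': "f' \<in> elts t'" "ueq U f' f" using 2 m unfolding collapse_on_def by blast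
    then have "y = ap p' f'" using eq 1(3) ueq_sym by auto
    moreover have "umem U f' g" by (rule umem_ueq[OF m ueq_sym[OF f'(2)]])
    ultimately show "y \<in> elts z" using 2 f'(1) unfolding collapse_on_def by auto
  qed
qed

lemma collapses_to_trans: "collapses_to UNIV X U g z \<Longrightarrow> y \<in> elts z \<Longrightarrow> \<exists>f. vfun f X \<and> collapses_to UNIV X U f y"
  unfolding collapses_to_def collapse_on_def by blast

lemma collapses_to_fn: "collapses_to UNIV X U g z \<Longrightarrow> vfun g X" unfolding collapses_to_def collapse_on_def by blast

end

text \<open>The properties of the collapse, relativized to an inner model by elementarity.\<close>

definition ult_props :: "'v::zfc set \<Rightarrow> 'v \<Rightarrow> 'v \<Rightarrow> bool" where
  "ult_props M X U \<longleftrightarrow> (cc_ultrafilter_on M X U \<longrightarrow>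
     (\<forall>f\<in>M. vfun f X \<longrightarrow> (\<exists>y\<in>M. collapses_to M X U f y)) \<and>
     (\<forall>f\<in>M. \<forall>y\<in>M. collapses_to M X U f y \<longrightarrow> vfun f X) \<and>
     (\<forall>f\<in>M. \<forall>y\<in>M. \<forall>g\<in>M. \<forall>z\<in>M. collapses_to M X U f y \<longrightarrow> collapses_to M X U g z \<longrightarrow>
       (y = z \<longleftrightarrow> ueq U f g) \<and> (y \<in> elts z \<longleftrightarrow> umem U f g)) \<and>
     (\<forall>g\<in>M. \<forall>z\<in>M. collapses_to M X U g z \<longrightarrow> (\<forall>y\<in>elts z. \<exists>f\<in>M. collapses_to M X U f y)))"

lemma ult_props_em: assumes "inner_model M" "X \<in> M" "U \<in> M" shows "ult_props M X U"
proof (rule transfer2[of ult_props, OF _ assms(1) _ assms(2,3)])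
  show "pd (\<lambda>M e. ult_props M (e 0) (e 1))" unfolding ult_props_def by (intro pdi)
  fix X U :: 'a
  show "ult_props UNIV X U" unfolding ult_props_def
  proof
    assume "cc_ultrafilter_on UNIV X U"
    then interpret uf U X by unfold_locales
    have 1: "\<forall>f\<in>UNIV. vfun f X \<longrightarrow> (\<exists>y\<in>UNIV. collapses_to UNIV X U f y)" using collapses_to_ex by simp
    have 2: "\<forall>f\<in>UNIV. \<forall>y\<in>UNIV. collapses_to UNIV X U f y \<longrightarrow> vfun f X" using collapses_to_fn by simp
    have 3: "\<forall>f\<in>UNIV. \<forall>y\<in>UNIV. \<forall>g\<in>UNIV. \<forall>z\<in>UNIV. collapses_to UNIV X U f y \<longrightarrow> collapses_to UNIV X U g z \<longrightarrow>
       (y = z \<longleftrightarrow> ueq U f g) \<and> (y \<in> elts z \<longleftrightarrow> umem U f g)"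
      by (intro ballI impI conjI collapses_to_eq collapses_to_mem)
    have 4: "\<forall>g\<in>UNIV. \<forall>z\<in>UNIV. collapses_to UNIV X U g z \<longrightarrow> (\<forall>y\<in>elts z. \<exists>f\<in>UNIV. collapses_to UNIV X U f y)"
    proof (intro ballI impI)
      fix g z y assume "collapses_to UNIV X U g z" "y \<in> elts z"
      then show "\<exists>f\<in>UNIV. collapses_to UNIV X U f y" using collapses_to_trans by simp blast
    qed
    show "(\<forall>f\<in>UNIV. vfun f X \<longrightarrow> (\<exists>y\<in>UNIV. collapses_to UNIV X U f y)) \<and>
     (\<forall>f\<in>UNIV. \<forall>y\<in>UNIV. collapses_to UNIV X U f y \<longrightarrow> vfun f X) \<and>
     (\<forall>f\<in>UNIV. \<forall>y\<in>UNIV. \<forall>g\<in>UNIV. \<forall>z\<in>UNIV. collapses_to UNIV X U f y \<longrightarrow> collapses_to UNIV X U g z \<longrightarrow>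
       (y = z \<longleftrightarrow> ueq U f g) \<and> (y \<in> elts z \<longleftrightarrow> umem U f g)) \<and>
     (\<forall>g\<in>UNIV. \<forall>z\<in>UNIV. collapses_to UNIV X U g z \<longrightarrow> (\<forall>y\<in>elts z. \<exists>f\<in>UNIV. collapses_to UNIV X U f y))"
      by (intro conjI 1 2 3 4)
  qed
qed

text \<open>\<open>U\<close> is a countably complete ultrafilter only in the sense of
  \<open>M\<close>. With \<open>M\<close> an ultrapower of the universe this covers the second steps
  of a comparison; with \<open>M = UNIV\<close> it specializes to \<open>uf\<close>.\<close>

locale emuf =
  fixes M :: "'v::zfc set" and U X :: 'v
  assumes inner_model: "inner_model M" and ccM: "cc_ultrafilter_on M X U"
begin

lemma U_M: "U \<in> M" and X_U: "X \<in> elts U" and sub_X: "A \<in> elts U \<Longrightarrow> elts A \<subseteq> elts X"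
  and up_M: "A \<in> elts U \<Longrightarrow> B \<in> M \<Longrightarrow> elts A \<subseteq> elts B \<Longrightarrow> elts B \<subseteq> elts X \<Longrightarrow> B \<in> elts U"
  using ccM unfolding cc_ultrafilter_on_def by blast+

lemma X_M: "X \<in> M" by (rule inner_model_trans[OF inner_model U_M X_U])

lemma carrier_M: "carrier U = X"
proof -
  have "(\<Union>A\<in>elts U. elts A) = elts X" using sub_X X_U by blast
  then show ?thesis by (simp add: carrier_def)
qed

lemma ult_funs_iff: "f \<in> ult_funs M U \<longleftrightarrow> f \<in> M \<and> vfun f X"
  by (simp add: ult_funs_def carrier_M)

lemma ae_set_M: "vset A \<in> M \<Longrightarrow> small A \<Longrightarrow> A \<subseteq> elts X \<Longrightarrow> vset A \<in> elts U \<longleftrightarrow> ae U (\<lambda>x. x \<in> A)"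
  unfolding ae_def using up_M[of _ "vset A"] by (intro iffI bexI[of _ "vset A"]) (auto simp: subset_eq)

lemma ae_cong_M: "(\<And>x. x \<in> elts X \<Longrightarrow> P x = Q x) \<Longrightarrow> ae U P = ae U Q"
  unfolding ae_def using sub_X by blast

lemma ult_mem_iff: assumes "f \<in> M" "vfun f X" "g \<in> M" "vfun g X" shows "ult_mem U f g \<longleftrightarrow> umem U f g"
proof -
  let ?S = "{x \<in> elts X. ap f x \<in> elts (ap g x)}"
  have S: "{x \<in> elts X. app f x \<in> elts (app g x)} = ?S" using app_ap[OF assms(2)] app_ap[OF assms(4)] by auto
  have "pt (\<lambda>M e. vset {x \<in> elts (e 0). ap (e 1) x \<in> elts (ap (e 2) x)})" by (intro pdi)
  from pt_in[OF this inner_model, of "case_nat X (case_nat f (\<lambda>_. g))"] have "vset ?S \<in> M"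
    using X_M assms by (simp add: numeral_2_eq_2 split: nat.split)
  moreover have "small ?S" by (intro small_sep vdi)
  ultimately have "vset ?S \<in> elts U \<longleftrightarrow> ae U (\<lambda>x. x \<in> ?S)" by (rule ae_set_M) blast
  also have "\<dots> \<longleftrightarrow> umem U f g" unfolding umem_def by (rule ae_cong_M) blast
  finally show ?thesis unfolding ult_mem_def carrier_M S .
qed

lemma ult_eq_iff: assumes "f \<in> M" "vfun f X" "g \<in> M" "vfun g X" shows "ult_eq U f g \<longleftrightarrow> ueq U f g"
proof -
  let ?S = "{x \<in> elts X. ap f x = ap g x}"
  have S: "{x \<in> elts X. app f x = app g x} = ?S" using app_ap[OF assms(2)] app_ap[OF assms(4)] by auto
  have "pt (\<lambda>M e. vset {x \<in> elts (e 0). ap (e 1) x = ap (e 2) x})" by (intro pdi)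
  from pt_in[OF this inner_model, of "case_nat X (case_nat f (\<lambda>_. g))"] have "vset ?S \<in> M"
    using X_M assms by (simp add: numeral_2_eq_2 split: nat.split)
  moreover have "small ?S" by (intro small_sep vdi)
  ultimately have "vset ?S \<in> elts U \<longleftrightarrow> ae U (\<lambda>x. x \<in> ?S)" by (rule ae_set_M) blast
  also have "\<dots> \<longleftrightarrow> ueq U f g" unfolding ueq_def by (rule ae_cong_M) blast
  finally show ?thesis unfolding ult_eq_def carrier_M S .
qed

lemma collapse_approx_iff: "collapse_approx M U t p \<longleftrightarrow> t \<in> M \<and> p \<in> M \<and> collapse_on M X U t p"
proof -
  have "collapse_approx M U t p \<longleftrightarrow> collapse_on M X U t p" if t: "t \<in> M" "p \<in> M"
  proof (cases "(\<forall>f\<in>elts t. vfun f X) \<and> vfun p t")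
    case True
    then have p: "vfun p t" and fn: "\<And>f. f \<in> elts t \<Longrightarrow> vfun f X" by blast+
    have tM: "\<And>f. f \<in> elts t \<Longrightarrow> f \<in> M" using inner_model_trans[OF inner_model t(1)] .
    have s: "elts t \<subseteq> ult_funs M U" using fn tM by (auto simp: ult_funs_iff)
    have A: "(\<forall>g\<in>elts t. \<forall>f\<in>ult_funs M U. ult_mem U f g \<longrightarrow> (\<exists>f'\<in>elts t. ult_eq U f' f)) \<longleftrightarrow>
       (\<forall>g\<in>elts t. \<forall>f\<in>M. vfun f X \<longrightarrow> umem U f g \<longrightarrow> (\<exists>f'\<in>elts t. ueq U f' f))"
      using ult_mem_iff ult_eq_iff fn tM unfolding Ball_def Bex_def ult_funs_iff by (metis (no_types, lifting))
    have B: "elts (app p g) = {app p f |f. f \<in> elts t \<and> ult_mem U f g} \<longleftrightarrow>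
       (\<forall>y\<in>elts (ap p g). \<exists>f\<in>elts t. umem U f g \<and> y = ap p f) \<and>
        (\<forall>f\<in>elts t. umem U f g \<longrightarrow> ap p f \<in> elts (ap p g))" if g: "g \<in> elts t" for g
    proof -
      have eq1: "{app p f |f. f \<in> elts t \<and> ult_mem U f g} = ap p ` {f \<in> elts t. umem U f g}"
        using app_ap[OF p] ult_mem_iff[OF tM fn tM[OF g] fn[OF g]] by (auto simp: image_iff) metis+
      show ?thesis unfolding app_ap[OF p g] eq1 set_eq_subset image_subset_iff by (auto simp: subset_eq image_iff)
    qed
    show ?thesis unfolding collapse_approx_def collapse_on_def A using B fn p t s by (simp cong: ball_cong)
  next
    case False then show ?thesis unfolding collapse_approx_def collapse_on_def by (auto simp: ult_funs_iff)
  qed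
  then show ?thesis unfolding collapse_approx_def by blast
qed

lemma collapses_to_collapse: "(\<exists>t p. collapse_approx M U t p \<and> f \<in> elts t \<and> x = app p f) \<longleftrightarrow> collapses_to M X U f x"
proof -
  have "app p f = ap p f" if "collapse_on M X U t p" "f \<in> elts t" for t p
    using that app_ap unfolding collapse_on_def by blast
  then show ?thesis unfolding collapses_to_def collapse_approx_iff by (auto; metis)
qed

lemma props: "ult_props M X U" by (rule ult_props_em[OF inner_model X_M U_M])

lemma collapses_to_in: "collapses_to M X U f y \<Longrightarrow> f \<in> M" "collapses_to M X U f y \<Longrightarrow> y \<in> M"
proof -
  show "collapses_to M X U f y \<Longrightarrow> f \<in> M" unfolding collapses_to_def using inner_model_trans[OF inner_model] by blast
  assume "collapses_to M X U f y"
  then obtain t p where t: "t \<in> M" "p \<in> M" "f \<in> elts t" "y = ap p f" unfolding collapses_to_def by blast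
  have "pt (\<lambda>M e. ap (e 0) (e 1))" by (intro pdi)
  from pt_in[OF this inner_model, of "case_nat p (\<lambda>_. f)"] show "y \<in> M"
    using t inner_model_trans[OF inner_model t(1,3)] by (simp split: nat.split)
qed

lemma collapses_to_unique: assumes "collapses_to M X U f y" "collapses_to M X U f z" shows "y = z"
proof -
  have "ueq U f f" unfolding ueq_def ae_def using X_U by blast
  then show ?thesis using props assms collapses_to_in[OF assms(1)] collapses_to_in[OF assms(2)] ccM unfolding ult_props_def by blast
qed

lemma cls_eqI: "collapses_to M X U f y \<Longrightarrow> ult_class M U f = y"
  unfolding ult_class_def collapses_to_collapse by (rule the_equality) (auto dest: collapses_to_unique)

lemma cls_collapses_to: assumes "f \<in> M" "vfun f X" shows "collapses_to M X U f (ult_class M U f)"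
proof -
  obtain y where "collapses_to M X U f y" using props assms ccM unfolding ult_props_def by blast
  then show ?thesis using cls_eqI by simp
qed

lemma cls_iff: "f \<in> M \<Longrightarrow> vfun f X \<Longrightarrow> ult_class M U f = y \<longleftrightarrow> collapses_to M X U f y"
  using cls_collapses_to cls_eqI by metis

lemma cls_in: "f \<in> M \<Longrightarrow> vfun f X \<Longrightarrow> ult_class M U f \<in> M"
  by (rule collapses_to_in(2)[OF cls_collapses_to])

lemma cls_mem: assumes "f \<in> M" "vfun f X" "g \<in> M" "vfun g X"
  shows "ult_class M U f \<in> elts (ult_class M U g) \<longleftrightarrow> ae U (\<lambda>x. ap f x \<in> elts (ap g x))"
  using props ccM cls_collapses_to[OF assms(1,2)] cls_collapses_to[OF assms(3,4)] assms cls_in unfolding ult_props_def umem_def by blast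

lemma cls_eq: assumes "f \<in> M" "vfun f X" "g \<in> M" "vfun g X"
  shows "ult_class M U f = ult_class M U g \<longleftrightarrow> ae U (\<lambda>x. ap f x = ap g x)"
  using props ccM cls_collapses_to[OF assms(1,2)] cls_collapses_to[OF assms(3,4)] assms cls_in unfolding ult_props_def ueq_def by blast

lemma Ult_eq: "Ult M U = ult_class M U ` {f \<in> M. vfun f X}"
proof -
  have "ult_funs M U = {f \<in> M. vfun f X}" using ult_funs_iff by blast
  then show ?thesis by (simp add: Ult_def)
qed

lemma UltE: assumes "y \<in> Ult M U" obtains f where "f \<in> M" "vfun f X" "y = ult_class M U f"
  using assms unfolding Ult_eq by blast

lemma Ult_I: "f \<in> M \<Longrightarrow> vfun f X \<Longrightarrow> ult_class M U f \<in> Ult M U" unfolding Ult_eq by blast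

lemma Ult_trans: assumes "z \<in> Ult M U" "y \<in> elts z" shows "y \<in> Ult M U"
proof -
  obtain g where g: "g \<in> M" "vfun g X" "z = ult_class M U g" using assms(1) by (rule UltE)
  have "\<exists>f\<in>M. collapses_to M X U f y" using props ccM cls_collapses_to[OF g(1,2)] g cls_in assms(2) unfolding ult_props_def by blast
  then obtain f where f: "f \<in> M" "collapses_to M X U f y" by blast
  have "vfun f X" using props ccM f collapses_to_in(2)[OF f(2)] unfolding ult_props_def by blast
  then show ?thesis using Ult_I[OF f(1)] cls_eqI[OF f(2)] by simp
qed

end

sublocale uf \<subseteq> emuf UNIV U X
  by unfold_locales (rule inner_model_UNIV, rule uf)

subsection \<open>The theorem of Los\<close>

context uf
begin

abbreviation MU :: "'v set" where "MU \<equiv> Ult UNIV U"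
abbreviation cls :: "'v \<Rightarrow> 'v" where "cls \<equiv> ult_class UNIV U"
abbreviation J :: "'v \<Rightarrow> 'v" where "J \<equiv> ult_emb UNIV U"
abbreviation idU :: "'v" where "idU \<equiv> ult_id UNIV U"
definition K :: "'v \<Rightarrow> 'v" where "K a = vlam X (\<lambda>_. a)"
definition I :: "'v" where "I = vlam X (\<lambda>x. x)"

lemma K_fun [simp]: "vfun (K a) X" and K_ap [simp]: "x \<in> elts X \<Longrightarrow> ap (K a) x = a"
proof -
  have d: "dt (\<lambda>e. a)" by (intro vdi)
  show "vfun (K a) X" unfolding K_def by (rule vlam_vfun[OF d])
  show "x \<in> elts X \<Longrightarrow> ap (K a) x = a" unfolding K_def by (rule ap_vlam[OF d])
qed

lemma I_fun [simp]: "vfun I X" and I_ap [simp]: "x \<in> elts X \<Longrightarrow> ap I x = x"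
proof -
  have d: "dt (\<lambda>e. e 0)" by (intro vdi)
  show "vfun I X" unfolding I_def by (rule vlam_vfun[OF d])
  show "x \<in> elts X \<Longrightarrow> ap I x = x" unfolding I_def by (rule ap_vlam[OF d])
qed

lemma J_cls: "J a = cls (K a)" by (simp add: ult_emb_def K_def carrier_eq)
lemma id_cls: "idU = cls I" by (simp add: ult_id_def I_def carrier_eq)

lemma los_sat:
  assumes "\<And>i. vfun (F i) X"
  shows "satM MU p (\<lambda>i. cls (F i)) \<longleftrightarrow> ae U (\<lambda>x. sat p (\<lambda>i. ap (F i) x))"
  using assms
proof (induction p arbitrary: F)
  case (Neg p)
  have "vd (\<lambda>e. sat p (\<lambda>i. ap (F i) (e 0)))" by (rule vd_sat) (intro vdi)
  then show ?case using Neg by (simp add: ae_not)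
next
  case (Conj p q)
  have "ae U (\<lambda>x. A x \<and> B x) \<longleftrightarrow> ae U A \<and> ae U B" for A B
    using ae_conj[of A B] ae_mono[of "\<lambda>x. A x \<and> B x" A] ae_mono[of "\<lambda>x. A x \<and> B x" B] by blast
  then show ?case using Conj by simp
next
  case (Forall p)
  have cn: "(\<lambda>i. ap (case_nat f F i) x) = case_nat (ap f x) (\<lambda>i. ap (F i) x)" for f x
    by (rule ext) (simp split: nat.split)
  have cn2: "(\<lambda>i. cls (case_nat f F i)) = case_nat (cls f) (\<lambda>i. cls (F i))" for f
    by (rule ext) (simp split: nat.split)
  have IH: "satM MU p (case_nat (cls f) (\<lambda>i. cls (F i))) \<longleftrightarrow> ae U (\<lambda>x. sat p (case_nat (ap f x) (\<lambda>i. ap (F i) x)))"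
    if "vfun f X" for f
    using Forall.IH[of "case_nat f F"] Forall.prems that by (simp add: cn cn2 split: nat.split)
  have v: "vd (\<lambda>e. sat p (case_nat (S e) (\<lambda>i. ap (F i) (T e))))" if "dt S" "dt T" for S T
  proof -
    have "vd (\<lambda>e. sat p (\<lambda>i. (case_nat S (\<lambda>i e. ap (F i) (T e)) i) e))"
      by (rule vd_sat) (use that in \<open>auto split: nat.split intro: dt_ap dt_const\<close>)
    moreover have "(\<lambda>i. (case_nat S (\<lambda>i e. ap (F i) (T e)) i) e) = case_nat (S e) (\<lambda>i. ap (F i) (T e))" for e
      by (rule ext) (simp split: nat.split)
    ultimately show ?thesis by simp
  qed
  show ?case
  proof
    assume all: "satM MU (Forall p) (\<lambda>i. cls (F i))"
    show "ae U (\<lambda>x. sat (Forall p) (\<lambda>i. ap (F i) x))"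
    proof (rule ccontr)
      assume n: "\<not> ?thesis"
      \<comment> \<open>Where the universal statement fails, \<open>f\<close> picks a
        counterexample. If that happened almost everywhere, the class of \<open>f\<close> would be a
        counterexample in the ultrapower.\<close>
      have v1: "vd (\<lambda>e. (\<exists>z. \<not> sat p (case_nat z (\<lambda>i. ap (F i) (e 0)))) \<longrightarrow> \<not> sat p (case_nat (e 1) (\<lambda>i. ap (F i) (e 0))))"
        by (intro vdi v)
      obtain f where f: "vfun f X" "\<And>x. x \<in> elts X \<Longrightarrow> (\<exists>z. \<not> sat p (case_nat z (\<lambda>i. ap (F i) x))) \<longrightarrow>
          \<not> sat p (case_nat (ap f x) (\<lambda>i. ap (F i) x))"
        by (rule choose_fun[of "\<lambda>x y. (\<exists>z. \<not> sat p (case_nat z (\<lambda>i. ap (F i) x))) \<longrightarrow>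
          \<not> sat p (case_nat y (\<lambda>i. ap (F i) x))" X, OF v1]) blast+
      have "ae U (\<lambda>x. \<not> (\<forall>z. sat p (case_nat z (\<lambda>i. ap (F i) x))))"
        using n by (subst ae_not) (intro vdi v, simp)
      moreover have "ae U (\<lambda>x. sat p (case_nat (ap f x) (\<lambda>i. ap (F i) x)))"
        using IH[OF f(1)] all f(1) Ult_I[of f] by simp
      ultimately have "ae U (\<lambda>x. False)" by (rule ae_mp) (use f(2) in blast)
      then show False using ae_ex by blast
    qed
  next
    assume a: "ae U (\<lambda>x. sat (Forall p) (\<lambda>i. ap (F i) x))"
    have "satM MU p (case_nat y (\<lambda>i. cls (F i)))" if yM: "y \<in> MU" for y
    proof -
      obtain f where f: "vfun f X" "y = cls f" using UltE[OF yM] by blast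
      show ?thesis unfolding f(2) IH[OF f(1)] by (rule ae_mono[OF a]) simp
    qed
    then show "satM MU (Forall p) (\<lambda>i. cls (F i))" by simp
  qed
qed (simp_all add: cls_mem cls_eq)

text \<open>A valid formula holds at every point, so almost everywhere, so in the ultrapower by Los.
  Representatives for the whole valuation are chosen in HOL, outside the model.\<close>

lemma inner_model_MU: "inner_model MU"
  unfolding inner_model_def
proof (intro conjI allI impI ballI subsetI)
  fix p and e :: "nat \<Rightarrow> 'v" assume p: "\<forall>e :: nat \<Rightarrow> 'v. sat p e" and e: "\<forall>i. e i \<in> MU"
  have "\<exists>F. \<forall>i. vfun (F i) X \<and> e i = cls (F i)"
  proof (intro Hilbert_Choice.choice allI)
    fix i show "\<exists>f. vfun f X \<and> e i = cls f" using e UltE by metis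
  qed
  then obtain F where F: "\<And>i. vfun (F i) X" "\<And>i. e i = cls (F i)" by blast
  have "e = (\<lambda>i. cls (F i))" using F(2) by blast
  then show "satM MU p e" using los_sat[OF F(1)] p by (simp add: ae_triv)
qed (rule Ult_trans)

lemma los:
  assumes "pd P" "\<And>i. vfun (F i) X"
  shows "P MU (\<lambda>i. cls (F i)) \<longleftrightarrow> ae U (\<lambda>x. P UNIV (\<lambda>i. ap (F i) x))"
proof -
  obtain p where p: "\<And>M e. inner_model M \<Longrightarrow> (\<And>i. e i \<in> M) \<Longrightarrow> P M e = satM M p e"
    using assms(1) unfolding pd_def by blast
  have "P MU (\<lambda>i. cls (F i)) = satM MU p (\<lambda>i. cls (F i))" by (rule p[OF inner_model_MU]) (simp add: Ult_I assms(2))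
  moreover have "P UNIV e = sat p e" for e using p[OF inner_model_UNIV] by simp
  ultimately show ?thesis using los_sat[OF assms(2)] by simp
qed

lemma los1: assumes "pd (\<lambda>M e. P M (e 0))" "vfun f X" shows "P MU (cls f) \<longleftrightarrow> ae U (\<lambda>x. P UNIV (ap f x))"
  using los[OF assms(1), of "\<lambda>_. f"] assms(2) by simp

lemma los2: assumes "pd (\<lambda>M e. P M (e 0) (e 1))" "vfun f X" "vfun g X"
  shows "P MU (cls f) (cls g) \<longleftrightarrow> ae U (\<lambda>x. P UNIV (ap f x) (ap g x))"
  using los[OF assms(1), of "case_nat f (\<lambda>_. g)"] assms(2-) by (simp split: nat.split)

lemma los3: assumes "pd (\<lambda>M e. P M (e 0) (e 1) (e 2))" "vfun f X" "vfun g X" "vfun h X"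
  shows "P MU (cls f) (cls g) (cls h) \<longleftrightarrow> ae U (\<lambda>x. P UNIV (ap f x) (ap g x) (ap h x))"
  using los[OF assms(1), of "case_nat f (case_nat g (\<lambda>_. h))"] assms(2-) by (simp add: numeral_2_eq_2 split: nat.split)

lemma J_in: "J a \<in> MU" unfolding J_cls by (rule Ult_I) simp_all
lemma id_in: "idU \<in> MU" unfolding id_cls by (rule Ult_I) simp_all

lemma elem1: assumes "pd (\<lambda>M e. P M (e 0))" shows "P MU (J a) \<longleftrightarrow> P UNIV a"
  unfolding J_cls los1[OF assms K_fun] by (subst ae_const[symmetric], rule ae_cong) simp

lemma elem2: assumes "pd (\<lambda>M e. P M (e 0) (e 1))" shows "P MU (J a) (J b) \<longleftrightarrow> P UNIV a b"
  unfolding J_cls los2[OF assms K_fun K_fun] by (subst ae_const[symmetric], rule ae_cong) simp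

lemma elem3: assumes "pd (\<lambda>M e. P M (e 0) (e 1) (e 2))" shows "P MU (J a) (J b) (J c) \<longleftrightarrow> P UNIV a b c"
  unfolding J_cls los3[OF assms K_fun K_fun K_fun] by (subst ae_const[symmetric], rule ae_cong) simp

lemma J_inj: "J a = J b \<longleftrightarrow> a = b"
  by (rule elem2[of "\<lambda>M x y. x = y"]) (intro pdi)
lemma J_mem: "J a \<in> elts (J b) \<longleftrightarrow> a \<in> elts b"
  by (rule elem2[of "\<lambda>M x y. x \<in> elts y"]) (intro pdi)

text \<open>Seed and embedding together determine the ultrafilter; this is how a comparison reads
  off the measures.\<close>

lemma id_J: "idU \<in> elts (J A) \<longleftrightarrow> ae U (\<lambda>x. x \<in> elts A)"
  unfolding J_cls id_cls by (subst cls_mem, simp_all, rule ae_cong, simp)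

lemma J_ap: assumes "vfun f A" "a \<in> elts A" shows "ap (J f) (J a) = J (ap f a)"
proof -
  have "pd (\<lambda>M e. ap (e 0) (e 1) = e 2)" by (intro pdi)
  from elem3[of "\<lambda>M f x y. ap f x = y", OF this] show ?thesis by simp
qed

lemma J_vfun: "vfun f A \<Longrightarrow> vfun (J f) (J A)"
  using elem2[of "\<lambda>M. vfun" f A, OF pd_vfun0] by simp

lemma dt_J: "dt S \<Longrightarrow> dt (\<lambda>e. J (S e))"
proof (rule dt_fun[where F = J])
  have eq: "(y = J a) = collapses_to UNIV X U (vlam X (\<lambda>_. a)) y" for y a
    unfolding J_cls K_def[symmetric] using cls_iff[of "K a" y] by auto
  show "dt (\<lambda>e. J (e 0))" unfolding dt_def eq by (intro vdi)
qed

text \<open>Every element of the ultrapower is a value of some \<open>J f\<close> at the seed;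
  \<open>closure\<close> rests on this.\<close>

lemma cls_rep: assumes "vfun f X" shows "ap (J f) idU = cls f"
proof -
  have p: "pd (\<lambda>M e. ap (e 0) (e 1) = e 2)" by (intro pdi)
  show ?thesis unfolding J_cls id_cls
    by (subst los3[of "\<lambda>M f x y. ap f x = y", OF p K_fun I_fun assms]) (rule ae_triv, simp)
qed

end

section \<open>The order of finite sets of ordinals\<close>

text \<open>The consequence of finiteness on which the order \<open>fless\<close> rests. It mentions
  no enumeration and passes to subsets at once.\<close>

definition has_maxima :: "'v::zfc \<Rightarrow> bool" where
  "has_maxima a \<longleftrightarrow> (\<forall>\<xi>\<in>elts a. Ord \<xi>) \<and>
     (\<forall>c. elts c \<subseteq> elts a \<longrightarrow> elts c \<noteq> {} \<longrightarrow> (\<exists>\<delta>\<in>elts c. \<forall>\<xi>\<in>elts c. \<xi> = \<delta> \<or> \<xi> \<in> elts \<delta>))"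

lemma vd_fless [vdi]: "dt S \<Longrightarrow> dt T \<Longrightarrow> vd (\<lambda>e. fless (S e) (T e))"
  by (rule vd_pred2[where P = fless]) (unfold fless_def, intro vdi)

lemma vd_hm [vdi]: "dt S \<Longrightarrow> vd (\<lambda>e. has_maxima (S e))"
proof (rule vd_pred[where P = has_maxima])
  have "has_maxima a \<longleftrightarrow> (\<forall>\<xi>\<in>elts a. Ord \<xi>) \<and> (\<forall>c. elts c \<subseteq> elts a \<longrightarrow> (\<exists>x. x \<in> elts c) \<longrightarrow>
      (\<exists>\<delta>\<in>elts c. \<forall>\<xi>\<in>elts c. \<xi> = \<delta> \<or> \<xi> \<in> elts \<delta>))" for a :: 'a
    unfolding has_maxima_def ex_in_conv ..
  then show "vd (\<lambda>e. has_maxima (e 0 :: 'a))" by (simp only:) (intro vdi)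
qed

lemma has_maxima_subset: "has_maxima a \<Longrightarrow> elts c \<subseteq> elts a \<Longrightarrow> has_maxima c"
  unfolding has_maxima_def by (meson subset_trans subsetD)

lemma has_maximaD: assumes "has_maxima a" "x \<in> elts a" "vd (\<lambda>e. P (e 0))" "P x"
  obtains \<delta> where "\<delta> \<in> elts a" "P \<delta>" "\<And>\<xi>. \<xi> \<in> elts a \<Longrightarrow> P \<xi> \<Longrightarrow> \<xi> = \<delta> \<or> \<xi> \<in> elts \<delta>"
proof -
  have e: "elts (vset {x \<in> elts a. P x}) = {x \<in> elts a. P x}" by (intro elts_vset small_sep assms(3))
  have "\<exists>\<delta>\<in>elts (vset {x \<in> elts a. P x}). \<forall>\<xi>\<in>elts (vset {x \<in> elts a. P x}). \<xi> = \<delta> \<or> \<xi> \<in> elts \<delta>"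
    using assms(1)[unfolded has_maxima_def, THEN conjunct2, rule_format, of "vset {x \<in> elts a. P x}"] assms(2,4) unfolding e by blast
  then show ?thesis using that unfolding e by blast
qed

lemma has_maxima_Ord: "has_maxima a \<Longrightarrow> \<xi> \<in> elts a \<Longrightarrow> Ord \<xi>" by (simp add: has_maxima_def)

text \<open>Induction on the length \<open>n\<close> of the enumeration, for all nonempty sets of
  ordinals among its first \<open>n\<close> values: the new value either exceeds the old maximum or
  leaves it in place.\<close>

lemma finord_hm: assumes "finord UNIV b" shows "has_maxima b"
proof -
  obtain n f where n: "natural n" and f: "bij_fun f n b" and o: "\<forall>\<xi>\<in>elts b. Ord \<xi>"
    using assms unfolding finord_def by auto
  have "\<forall>c. (\<forall>\<xi>\<in>elts c. Ord \<xi> \<and> (\<exists>k\<in>elts n. \<xi> = ap f k)) \<longrightarrow> (\<exists>x. x \<in> elts c) \<longrightarrow>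
     (\<exists>\<delta>\<in>elts c. \<forall>\<xi>\<in>elts c. \<xi> = \<delta> \<or> \<xi> \<in> elts \<delta>)"
    using n
  proof (induction n rule: natural_induct)
    case dfn show ?case by (intro vdi)
  next
    case zero show ?case by auto
  next
    case (succ n)
    show ?case
    proof (intro allI impI)
      fix c assume c: "\<forall>\<xi>\<in>elts c. Ord \<xi> \<and> (\<exists>k\<in>elts (vsucc n). \<xi> = ap f k)" and "\<exists>x. x \<in> elts c"
      define d where "d = vset {\<xi> \<in> elts c. \<xi> \<noteq> ap f n}"
      have d: "elts d = {\<xi> \<in> elts c. \<xi> \<noteq> ap f n}" unfolding d_def by (intro elts_vset small_sep vdi)
      have dd: "\<forall>\<xi>\<in>elts d. Ord \<xi> \<and> (\<exists>k\<in>elts n. \<xi> = ap f k)" using c by (auto simp: d)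
      show "\<exists>\<delta>\<in>elts c. \<forall>\<xi>\<in>elts c. \<xi> = \<delta> \<or> \<xi> \<in> elts \<delta>"
      proof (cases "\<exists>x. x \<in> elts d")
        case False
        then show ?thesis using \<open>\<exists>x. x \<in> elts c\<close> unfolding d by blast
      next
        case True
        then obtain \<delta> where \<delta>: "\<delta> \<in> elts d" "\<And>\<xi>. \<xi> \<in> elts d \<Longrightarrow> \<xi> = \<delta> \<or> \<xi> \<in> elts \<delta>"
          using succ(2)[rule_format, of d] dd by blast
        have o: "Ord \<delta>" using dd \<delta>(1) by blast
        show ?thesis
        proof (cases "ap f n \<in> elts c \<and> \<delta> \<in> elts (ap f n)")
          case True
          then have "Ord (ap f n)" using c by blast
          then have "\<forall>\<xi>\<in>elts c. \<xi> = ap f n \<or> \<xi> \<in> elts (ap f n)"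
            using \<delta>(2) True Ord_trans[of "ap f n" \<delta>] unfolding d by blast
          then show ?thesis using True by blast
        next
          case False
          have "\<xi> = \<delta> \<or> \<xi> \<in> elts \<delta>" if "\<xi> \<in> elts c" for \<xi>
          proof (cases "\<xi> = ap f n")
            case True
            then show ?thesis using False that c Ord_linear[OF o, of \<xi>] by blast
          qed (use that \<delta>(2) d in blast)
          then show ?thesis using \<delta>(1) d by blast
        qed
      qed
    qed
  qed
  moreover have "\<xi> \<in> elts b \<Longrightarrow> \<exists>k\<in>elts n. \<xi> = ap f k" for \<xi> using f unfolding bij_fun_def by blast
  ultimately show ?thesis using o unfolding has_maxima_def ex_in_conv by (meson subsetD)
qed

text \<open>Each one-sided difference has a largest element, if it is nonempty; the set that
  contains the larger of the two is the larger set.\<close>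

lemma fless_linear: assumes "has_maxima a" "has_maxima b" shows "a = b \<or> fless a b \<or> fless b a"
proof -
  have *: "fless a b \<or> fless b a" if h: "has_maxima a" "has_maxima b" and x: "x \<in> elts a" "x \<notin> elts b" for a b x :: 'a
  proof -
    have v: "vd (\<lambda>e. e 0 \<notin> elts b)" and v': "vd (\<lambda>e. e 0 \<notin> elts a)" by (intro vdi)+
    obtain \<delta> where \<delta>: "\<delta> \<in> elts a" "\<delta> \<notin> elts b" "\<And>\<xi>. \<xi> \<in> elts a \<Longrightarrow> \<xi> \<notin> elts b \<Longrightarrow> \<xi> = \<delta> \<or> \<xi> \<in> elts \<delta>"
      using has_maximaD[OF h(1) x(1) v x(2)] by blast
    show ?thesis
    proof (cases "\<exists>y\<in>elts b. y \<notin> elts a")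
      case False
      then have "fless b a" unfolding fless_def using \<delta> by blast
      then show ?thesis ..
    next
      case True
      then obtain y where y: "y \<in> elts b" "y \<notin> elts a" by blast
      obtain \<epsilon> where \<epsilon>: "\<epsilon> \<in> elts b" "\<epsilon> \<notin> elts a" "\<And>\<xi>. \<xi> \<in> elts b \<Longrightarrow> \<xi> \<notin> elts a \<Longrightarrow> \<xi> = \<epsilon> \<or> \<xi> \<in> elts \<epsilon>"
        using has_maximaD[OF h(2) y(1) v' y(2)] by blast
      have o: "Ord \<delta>" "Ord \<epsilon>" using has_maxima_Ord h \<delta>(1) \<epsilon>(1) by blast+
      consider "\<delta> \<in> elts \<epsilon>" | "\<epsilon> \<in> elts \<delta>" using Ord_linear[OF o] \<delta>(1) \<epsilon>(2) by blast
      then show ?thesis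
      proof cases
        case 1
        then have "fless a b" unfolding fless_def
          using \<epsilon> \<delta>(3) Ord_trans[OF o(2) 1] by blast
        then show ?thesis ..
      next
        case 2
        then have "fless b a" unfolding fless_def
          using \<delta> \<epsilon>(3) Ord_trans[OF o(1) 2] by blast
        then show ?thesis ..
      qed
    qed
  qed
  show ?thesis
  proof (cases "a = b")
    case False
    then obtain x where "x \<in> elts a \<and> x \<notin> elts b \<or> x \<in> elts b \<and> x \<notin> elts a" using eltsI[of a b] by blast
    then show ?thesis using *[OF assms] *[OF assms(2,1)] by blast
  qed simp
qed

text \<open>The larger of the two deciding ordinals decides between \<open>a\<close> and
  \<open>c\<close>, because all three sets agree above it.\<close>

lemma fless_trans: assumes h: "has_maxima a" "has_maxima b" "has_maxima c" and l: "fless a b" "fless b c" shows "fless a c"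
proof -
  obtain \<delta> where \<delta>: "\<delta> \<in> elts b" "\<delta> \<notin> elts a"
    "\<forall>\<xi>. (\<xi> \<in> elts a \<and> \<xi> \<notin> elts b \<or> \<xi> \<in> elts b \<and> \<xi> \<notin> elts a) \<longrightarrow> \<xi> = \<delta> \<or> \<xi> \<in> elts \<delta>"
    using l(1) unfolding fless_def by blast
  obtain \<epsilon> where \<epsilon>: "\<epsilon> \<in> elts c" "\<epsilon> \<notin> elts b"
    "\<forall>\<xi>. (\<xi> \<in> elts b \<and> \<xi> \<notin> elts c \<or> \<xi> \<in> elts c \<and> \<xi> \<notin> elts b) \<longrightarrow> \<xi> = \<epsilon> \<or> \<xi> \<in> elts \<epsilon>"
    using l(2) unfolding fless_def by blast
  have o: "Ord \<delta>" "Ord \<epsilon>" using has_maxima_Ord h \<delta>(1) \<epsilon>(1) by blast+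
  consider "\<delta> \<in> elts \<epsilon>" | "\<epsilon> \<in> elts \<delta>" using Ord_linear[OF o] \<delta>(1) \<epsilon>(2) by blast
  then show ?thesis
  proof cases
    case 1
    have "\<epsilon> \<notin> elts a" using \<delta>(3)[rule_format, of \<epsilon>] \<epsilon>(2) 1 mem_asym[OF 1] mem_irrefl by blast
    moreover have "\<xi> = \<epsilon> \<or> \<xi> \<in> elts \<epsilon>" if "\<xi> \<in> elts a \<and> \<xi> \<notin> elts c \<or> \<xi> \<in> elts c \<and> \<xi> \<notin> elts a" for \<xi>
      using \<delta>(3)[rule_format, of \<xi>] \<epsilon>(3)[rule_format, of \<xi>] that 1 Ord_trans[OF o(2) 1] by blast
    ultimately show ?thesis unfolding fless_def using \<epsilon>(1) by blast
  next
    case 2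
    have "\<delta> \<in> elts c" using \<epsilon>(3)[rule_format, of \<delta>] \<delta>(1) 2 mem_asym[OF 2] mem_irrefl by blast
    moreover have "\<xi> = \<delta> \<or> \<xi> \<in> elts \<delta>" if "\<xi> \<in> elts a \<and> \<xi> \<notin> elts c \<or> \<xi> \<in> elts c \<and> \<xi> \<notin> elts a" for \<xi>
      using \<delta>(3)[rule_format, of \<xi>] \<epsilon>(3)[rule_format, of \<xi>] that 2 Ord_trans[OF o(1) 2] by blast
    ultimately show ?thesis unfolding fless_def using \<delta>(2) by blast
  qed
qed

text \<open>Wellfoundedness is proved by induction on an ordinal bounding the sets: take the least
  possible maximum \<open>\<beta>\<close>, and remove it from the sets of which it is the maximum.\<close>

lemma fless_min_aux:
  "Ord \<alpha> \<longrightarrow> (\<forall>u. (\<forall>a\<in>elts u. has_maxima a \<and> elts a \<subseteq> elts \<alpha>) \<longrightarrow> (\<exists>a. a \<in> elts u) \<longrightarrow> (\<exists>m\<in>elts u. \<forall>y\<in>elts u. \<not> fless y m))"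
proof (induction \<alpha> rule: mem_induct)
  case dfn show ?case by (intro vdi)
next
  case (step \<alpha>)
  show ?case
  proof (intro impI allI)
    fix u assume \<alpha>: "Ord \<alpha>" and u: "\<forall>a\<in>elts u. has_maxima a \<and> elts a \<subseteq> elts \<alpha>" and "\<exists>a. a \<in> elts u"
    then obtain a0 where a0: "a0 \<in> elts u" by blast
    show "\<exists>m\<in>elts u. \<forall>y\<in>elts u. \<not> fless y m"
    proof (cases "v0 \<in> elts u")
      case True
      then show ?thesis unfolding fless_def by (intro bexI[of _ v0]) auto
    next
      case False
      define Mx where "Mx a \<beta> \<longleftrightarrow> \<beta> \<in> elts a \<and> (\<forall>\<xi>\<in>elts a. \<xi> = \<beta> \<or> \<xi> \<in> elts \<beta>)" for a \<beta> :: 'a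
      have vM: "vd (\<lambda>e. Mx (S e) (T e))" if "dt S" "dt T" for S T
        by (rule vd_pred2[OF _ that]) (unfold Mx_def, intro vdi)
      have ex: "\<exists>\<beta>. Mx a \<beta>" if "a \<in> elts u" for a
      proof -
        have "elts a \<noteq> {}" using that False empty_v0[of a] by auto
        then show ?thesis using u that unfolding has_maxima_def Mx_def by blast
      qed
      have "vd (\<lambda>e. \<exists>a\<in>elts u. Mx a (e 0))" by (intro vdi vM)
      then obtain \<beta> where \<beta>: "\<exists>a\<in>elts u. Mx a \<beta>" "\<And>\<gamma>. \<gamma> \<in> elts \<beta> \<Longrightarrow> \<not> (\<exists>a\<in>elts u. Mx a \<gamma>)"
        using mem_min[of "\<lambda>\<beta>. \<exists>a\<in>elts u. Mx a \<beta>"] ex[OF a0] a0 by blast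
      have \<beta>\<alpha>: "\<beta> \<in> elts \<alpha>" using \<beta>(1) u unfolding Mx_def by blast
      then have \<beta>o: "Ord \<beta>" using Ord_in[OF \<alpha>] by blast
      define D where "D a = vset {\<xi> \<in> elts a. \<xi> \<noteq> \<beta>}" for a
      have D: "elts (D a) = {\<xi> \<in> elts a. \<xi> \<noteq> \<beta>}" for a unfolding D_def by (intro elts_vset small_sep vdi)
      define u1 where "u1 = vset {a \<in> elts u. Mx a \<beta>}"
      have u1: "elts u1 = {a \<in> elts u. Mx a \<beta>}" unfolding u1_def by (intro elts_vset small_sep vdi vM)
      define u' where "u' = vset (D ` elts u1)"
      have u': "elts u' = D ` elts u1" unfolding u'_def D_def by (intro elts_vset small_image vdi)
      have 1: "\<forall>a\<in>elts u'. has_maxima a \<and> elts a \<subseteq> elts \<beta>"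
      proof
        fix a assume "a \<in> elts u'"
        then obtain b where b: "b \<in> elts u" "Mx b \<beta>" "a = D b" by (auto simp: u' u1)
        then show "has_maxima a \<and> elts a \<subseteq> elts \<beta>" using u has_maxima_subset[of b a] unfolding Mx_def D by (auto simp: D)
      qed
      have "\<exists>a. a \<in> elts u'" using \<beta>(1) by (auto simp: u' u1)
      then obtain m' where m': "m' \<in> elts u'" "\<And>y. y \<in> elts u' \<Longrightarrow> \<not> fless y m'"
        using step[OF \<beta>\<alpha>] \<beta>o 1 by blast
      then obtain m where m: "m \<in> elts u" "Mx m \<beta>" "m' = D m" by (auto simp: u' u1)
      have "\<not> fless y m" if y: "y \<in> elts u" for y
      proof
        assume l: "fless y m"
        then obtain \<delta> where \<delta>: "\<delta> \<in> elts m" "\<delta> \<notin> elts y" "\<forall>\<xi>\<in>elts y. \<xi> \<notin> elts m \<longrightarrow> \<xi> = \<delta> \<or> \<xi> \<in> elts \<delta>"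
          "\<forall>\<xi>\<in>elts m. \<xi> \<notin> elts y \<longrightarrow> \<xi> = \<delta> \<or> \<xi> \<in> elts \<delta>" unfolding fless_def by blast
        have le: "\<xi> = \<beta> \<or> \<xi> \<in> elts \<beta>" if "\<xi> \<in> elts y" for \<xi>
        proof (cases "\<xi> \<in> elts m")
          case True then show ?thesis using m(2) unfolding Mx_def by blast
        next
          case False
          then have "\<xi> = \<delta> \<or> \<xi> \<in> elts \<delta>" using \<delta>(3) that by blast
          moreover have "\<delta> = \<beta> \<or> \<delta> \<in> elts \<beta>" using m(2) \<delta>(1) unfolding Mx_def by blast
          ultimately show ?thesis using Ord_trans[OF \<beta>o, of \<delta> \<xi>] by blast
        qed
        obtain \<gamma> where \<gamma>: "Mx y \<gamma>" using ex[OF y] by blast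
        then have "\<gamma> = \<beta>" using \<beta>(2) y le unfolding Mx_def by blast
        then have My: "Mx y \<beta>" using \<gamma> by simp
        then have "\<delta> \<noteq> \<beta>" using \<delta>(2) unfolding Mx_def by blast
        then have "fless (D y) (D m)" unfolding fless_def D using \<delta> by blast
        moreover have "D y \<in> elts u'" using y My by (auto simp: u' u1)
        ultimately show False using m'(2) m(3) by blast
      qed
      then show ?thesis using m(1) by blast
    qed
  qed
qed

lemma fless_wf: assumes "\<And>a. a \<in> elts H \<Longrightarrow> has_maxima a" shows "wf_rel H fless"
  unfolding wf_rel_def
proof (intro allI impI)
  fix u assume u: "elts u \<subseteq> elts H \<and> elts u \<noteq> {}"
  define F where "F a = vset (\<Union>\<xi>\<in>elts a. elts (vsucc \<xi>))" for a :: 'a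
  have F: "elts (F a) = (\<Union>\<xi>\<in>elts a. elts (vsucc \<xi>))" for a unfolding F_def by (intro elts_vset small_UN vdi)
  define \<alpha> where "\<alpha> = vset (\<Union>a\<in>elts u. elts (F a))"
  have \<alpha>: "elts \<alpha> = (\<Union>a\<in>elts u. elts (F a))" unfolding \<alpha>_def F_def by (intro elts_vset small_UN vdi)
  have o: "Ord \<xi>" if "\<xi> \<in> elts a" "a \<in> elts u" for \<xi> a using assms u that has_maxima_Ord by blast
  have mem: "\<exists>a\<in>elts u. \<exists>\<zeta>\<in>elts a. Ord \<zeta> \<and> (\<xi> = \<zeta> \<or> \<xi> \<in> elts \<zeta>)" if "\<xi> \<in> elts \<alpha>" for \<xi>
    using that o unfolding \<alpha> F by auto
  have memI: "\<xi> \<in> elts \<alpha>" if "a \<in> elts u" "\<zeta> \<in> elts a" "\<xi> = \<zeta> \<or> \<xi> \<in> elts \<zeta>" for \<xi> \<zeta> a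
    unfolding \<alpha> F using that by auto
  have "Ord \<alpha>" unfolding Ord_def transitive_set_def
  proof (intro conjI ballI subsetI)
    fix \<xi> \<eta> assume \<xi>: "\<xi> \<in> elts \<alpha>" "\<eta> \<in> elts \<xi>"
    then obtain a \<zeta> where a: "a \<in> elts u" "\<zeta> \<in> elts a" "Ord \<zeta>" "\<xi> = \<zeta> \<or> \<xi> \<in> elts \<zeta>" using mem by blast
    then show "\<eta> \<in> elts \<alpha>" using memI[OF a(1,2), of \<eta>] Ord_trans[OF a(3)] \<xi>(2) by blast
    fix \<theta> assume "\<theta> \<in> elts \<eta>"
    then show "\<theta> \<in> elts \<xi>" using a(3,4) \<xi>(2) Ord_trans Ord_in by blast
  qed
  moreover have "\<forall>a\<in>elts u. has_maxima a \<and> elts a \<subseteq> elts \<alpha>" using assms u memI by blast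
  ultimately show "\<exists>m\<in>elts u. \<forall>y\<in>elts u. \<not> fless y m" using fless_min_aux[of \<alpha>] u by blast
qed

subsection \<open>Limits of ultrafilters\<close>

context uf
begin

text \<open>The limit along \<open>U\<close> of the ultrafilters \<open>ap D x\<close>. In terms of
  the ultrapower it is the preimage under \<open>J\<close> of the ultrafilter \<open>[D]\<close>,
  here stated without the ultrapower.\<close>

definition lim :: "'v \<Rightarrow> 'v \<Rightarrow> 'v" where
  "lim B D = vset {A. elts A \<subseteq> elts B \<and> ae U (\<lambda>x. A \<in> elts (ap D x))}"

lemma elts_lim: "elts (lim B D) = {A. elts A \<subseteq> elts B \<and> ae U (\<lambda>x. A \<in> elts (ap D x))}"
  unfolding lim_def by (intro elts_vset small_subset[of _ "vPow B"]) (intro vdi, auto)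

lemma lim_cc:
  assumes D: "ae U (\<lambda>x. cc_ultrafilter_on UNIV B (ap D x))"
  shows "cc_ultrafilter_on UNIV B (lim B D)"
  unfolding cc_ultrafilter_on_iff
proof (intro conjI ballI impI)
  show "lim B D \<in> UNIV" ..
  show "elts A \<subseteq> elts B" if "A \<in> elts (lim B D)" for A using that by (simp add: elts_lim)
  have "ae U (\<lambda>x. B \<in> elts (ap D x))" by (rule ae_mono[OF D]) (simp add: cc_ultrafilter_on_iff)
  then show "B \<in> elts (lim B D)" by (simp add: elts_lim)
  show "v0 \<notin> elts (lim B D)"
  proof
    assume "v0 \<in> elts (lim B D)"
    then have "ae U (\<lambda>x. v0 \<in> elts (ap D x))" by (simp add: elts_lim)
    from ae_ex[OF ae_conj[OF D this]] show False unfolding cc_ultrafilter_on_iff by blast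
  qed
next
  fix A C assume A: "A \<in> elts (lim B D)" and C: "elts A \<subseteq> elts C \<and> elts C \<subseteq> elts B"
  have "ae U (\<lambda>x. A \<in> elts (ap D x))" using A by (simp add: elts_lim)
  then have "ae U (\<lambda>x. C \<in> elts (ap D x))"
    by (rule ae_mp[OF D]) (use C in \<open>unfold cc_ultrafilter_on_iff, blast\<close>)
  then show "C \<in> elts (lim B D)" using C by (simp add: elts_lim)
next
  fix A C assume A: "A \<in> elts (lim B D)" "C \<in> elts (lim B D)"
  have "ae U (\<lambda>x. A \<in> elts (ap D x) \<and> C \<in> elts (ap D x))" using A by (intro ae_conj) (simp_all add: elts_lim)
  then have "ae U (\<lambda>x. vset {x \<in> elts A. x \<in> elts C} \<in> elts (ap D x))"
    by (rule ae_mp[OF D]) (unfold cc_ultrafilter_on_iff, blast)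
  moreover have "elts (vset {x \<in> elts A. x \<in> elts C}) = {x \<in> elts A. x \<in> elts C}" by (intro elts_vset small_sep vdi)
  ultimately show "vset {x \<in> elts A. x \<in> elts C} \<in> elts (lim B D)" using A by (auto simp: elts_lim)
next
  fix A assume A: "elts A \<subseteq> elts B"
  have c: "elts (vset {x \<in> elts B. x \<notin> elts A}) = {x \<in> elts B. x \<notin> elts A}" by (intro elts_vset small_sep vdi)
  show "A \<in> elts (lim B D) \<or> vset {x \<in> elts B. x \<notin> elts A} \<in> elts (lim B D)"
  proof (cases "ae U (\<lambda>x. A \<in> elts (ap D x))")
    case False
    then have "ae U (\<lambda>x. \<not> A \<in> elts (ap D x))" by (subst ae_not) (intro vdi)
    then have "ae U (\<lambda>x. vset {x \<in> elts B. x \<notin> elts A} \<in> elts (ap D x))"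
      by (rule ae_mp[OF D]) (use A in \<open>unfold cc_ultrafilter_on_iff, blast\<close>)
    then show ?thesis using c by (auto simp: elts_lim)
  qed (use A in \<open>simp add: elts_lim\<close>)
next
  fix s assume s: "vfun s omega \<and> (\<forall>n\<in>elts omega. ap s n \<in> elts (lim B D))"
  have e: "elts (vset {x \<in> elts (ap s v0). \<forall>n\<in>elts omega. x \<in> elts (ap s n)}) =
      {x \<in> elts (ap s v0). \<forall>n\<in>elts omega. x \<in> elts (ap s n)}" by (intro elts_vset small_sep vdi)
  have v: "vd (\<lambda>e. ap s (e 0) \<in> elts (ap D (e 1)))" by (intro vdi)
  have "ae U (\<lambda>x. \<forall>n. natural n \<longrightarrow> ap s n \<in> elts (ap D x))"
    by (rule ae_nat[OF v]) (use s in \<open>simp add: elts_lim\<close>)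
  then have "ae U (\<lambda>x. vset {x \<in> elts (ap s v0). \<forall>n\<in>elts omega. x \<in> elts (ap s n)} \<in> elts (ap D x))"
  proof (rule ae_mp[OF D])
    fix x assume "cc_ultrafilter_on UNIV B (ap D x)" "\<forall>n. natural n \<longrightarrow> ap s n \<in> elts (ap D x)"
    then show "vset {x \<in> elts (ap s v0). \<forall>n\<in>elts omega. x \<in> elts (ap s n)} \<in> elts (ap D x)"
      using s unfolding cc_ultrafilter_on_iff elts_omega by blast
  qed
  moreover have "elts (ap s v0) \<subseteq> elts B" using s natural_v0 by (auto simp: elts_lim)
  ultimately show "vset {x \<in> elts (ap s v0). \<forall>n\<in>elts omega. x \<in> elts (ap s n)} \<in> elts (lim B D)"
    unfolding elts_lim e mem_Collect_eq by blast
qed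

end

section \<open>Images of ultrafilters, and facts transferred to ultrapowers of inner models\<close>

lemma principal_cc: assumes "b \<in> elts B" and Z: "elts Z = {A. elts A \<subseteq> elts B \<and> b \<in> elts A}"
  shows "cc_ultrafilter_on UNIV B Z"
  unfolding cc_ultrafilter_on_iff
proof (intro conjI ballI impI)
  fix A C assume "A \<in> elts Z" "C \<in> elts Z"
  moreover have "elts (vset {x \<in> elts A. x \<in> elts C}) = {x \<in> elts A. x \<in> elts C}" by (intro elts_vset small_sep vdi)
  ultimately show "vset {x \<in> elts A. x \<in> elts C} \<in> elts Z" by (auto simp: Z)
next
  fix A assume "elts A \<subseteq> elts B"
  moreover have "elts (vset {x \<in> elts B. x \<notin> elts A}) = {x \<in> elts B. x \<notin> elts A}" by (intro elts_vset small_sep vdi)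
  ultimately show "A \<in> elts Z \<or> vset {x \<in> elts B. x \<notin> elts A} \<in> elts Z" using assms(1) by (auto simp: Z)
next
  fix s assume s: "vfun s omega \<and> (\<forall>n\<in>elts omega. ap s n \<in> elts Z)"
  have e: "elts (vset {x \<in> elts (ap s v0). \<forall>n\<in>elts omega. x \<in> elts (ap s n)}) =
      {x \<in> elts (ap s v0). \<forall>n\<in>elts omega. x \<in> elts (ap s n)}" by (intro elts_vset small_sep vdi)
  have "elts (ap s v0) \<subseteq> elts B" using s natural_v0 by (auto simp: Z)
  moreover have "\<forall>n\<in>elts omega. b \<in> elts (ap s n)" using s by (simp add: Z)
  ultimately show "vset {x \<in> elts (ap s v0). \<forall>n\<in>elts omega. x \<in> elts (ap s n)} \<in> elts Z"
    unfolding Z e mem_Collect_eq using natural_v0 by auto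
qed (use assms in auto)

definition push_prop :: "'v::zfc set \<Rightarrow> 'v \<Rightarrow> 'v \<Rightarrow> 'v \<Rightarrow> 'v \<Rightarrow> bool" where
  "push_prop M Y W h B \<longleftrightarrow> (cc_ultrafilter_on M Y W \<and> vfun h Y \<and> (\<forall>y\<in>elts Y. ap h y \<in> elts B) \<longrightarrow>
     (\<exists>Z\<in>M. cc_ultrafilter_on M B Z \<and>
        (\<forall>A\<in>M. elts A \<subseteq> elts B \<longrightarrow> (A \<in> elts Z \<longleftrightarrow> ae W (\<lambda>y. ap h y \<in> elts A)))))"

text \<open>The image of \<open>W\<close> under \<open>h\<close> is the limit along \<open>W\<close>
  of the principal ultrafilters at the points \<open>ap h y\<close>; its completeness is then a case
  of \<open>lim_cc\<close>.\<close>

lemma push_prop_V: "push_prop UNIV Y W h B"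
  unfolding push_prop_def
proof (intro impI, elim conjE)
  assume W: "cc_ultrafilter_on UNIV Y W" and h: "vfun h Y" "\<forall>y\<in>elts Y. ap h y \<in> elts B"
  interpret uf W Y by unfold_locales (rule W)
  define F where "F y = vset {A. elts A \<subseteq> elts B \<and> ap h y \<in> elts A}" for y
  have dF: "dt (\<lambda>e. F (e 0))" unfolding F_def by (intro vdi)
  have F: "elts (F y) = {A. elts A \<subseteq> elts B \<and> ap h y \<in> elts A}" for y
    unfolding F_def by (intro elts_vset small_subset[of _ "vPow B"]) (intro vdi, auto)
  define D where "D = vlam Y F"
  have D: "vfun D Y" "\<And>y. y \<in> elts Y \<Longrightarrow> ap D y = F y" unfolding D_def by (simp_all add: vlam_vfun dF)
  have "ae W (\<lambda>y. cc_ultrafilter_on UNIV B (ap D y))"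
    by (rule ae_triv) (simp add: D(2) principal_cc[OF _ F] h(2))
  from lim_cc[OF this] have cc: "cc_ultrafilter_on UNIV B (lim B D)" .
  have "A \<in> elts (lim B D) \<longleftrightarrow> ae W (\<lambda>y. ap h y \<in> elts A)" if "elts A \<subseteq> elts B" for A
  proof -
    have "A \<in> elts (lim B D) \<longleftrightarrow> ae W (\<lambda>y. A \<in> elts (ap D y))" using that by (simp add: elts_lim)
    also have "\<dots> \<longleftrightarrow> ae W (\<lambda>y. ap h y \<in> elts A)" by (rule ae_cong) (use that in \<open>simp add: D(2) F\<close>)
    finally show ?thesis .
  qed
  then show "\<exists>Z\<in>UNIV. cc_ultrafilter_on UNIV B Z \<and>
        (\<forall>A\<in>UNIV. elts A \<subseteq> elts B \<longrightarrow> (A \<in> elts Z \<longleftrightarrow> ae W (\<lambda>y. ap h y \<in> elts A)))"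
    using cc by blast
qed

lemma push_prop_em: assumes "inner_model M" "Y \<in> M" "W \<in> M" "h \<in> M" "B \<in> M" shows "push_prop M Y W h B"
proof (rule transfer4[of push_prop, OF _ assms(1) push_prop_V assms(2-)])
  show "pd (\<lambda>M e. push_prop M (e 0) (e 1) (e 2) (e 3))" unfolding push_prop_def by (intro pdi)
qed

text \<open>Los is available for ultrapowers of the universe only. Its two consequences needed for
  ultrapowers of inner models are phrased through \<open>collapses_to\<close>, so that they
  transfer.\<close>

definition ord_props :: "'v::zfc set \<Rightarrow> 'v \<Rightarrow> 'v \<Rightarrow> bool" where
  "ord_props M X U \<longleftrightarrow> (cc_ultrafilter_on M X U \<longrightarrow>
     (\<forall>f\<in>M. \<forall>y\<in>M. \<forall>g\<in>M. \<forall>z\<in>M. collapses_to M X U f y \<longrightarrow> collapses_to M X U g z \<longrightarrow>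
       (fless y z \<longleftrightarrow> ae U (\<lambda>x. fless (ap f x) (ap g x)))) \<and>
     (\<forall>f\<in>M. \<forall>y\<in>M. collapses_to M X U f y \<longrightarrow> ae U (\<lambda>x. finord M (ap f x)) \<longrightarrow> finord M y))"

lemma ord_props_em: assumes "inner_model M" "X \<in> M" "U \<in> M" shows "ord_props M X U"
proof (rule transfer2[of ord_props, OF _ assms(1) _ assms(2,3)])
  show "pd (\<lambda>M e. ord_props M (e 0) (e 1))" unfolding ord_props_def by (intro pdi)
  fix X U :: 'a
  show "ord_props UNIV X U" unfolding ord_props_def
  proof
    assume "cc_ultrafilter_on UNIV X U"
    then interpret uf U X by unfold_locales
    have p1: "pd (\<lambda>M e. fless (e 0) (e 1))" by (intro pdi)
    have p2: "pd (\<lambda>M e. finord M (e 0))" by (intro pdi)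
    have 1: "\<forall>f\<in>UNIV. \<forall>y\<in>UNIV. \<forall>g\<in>UNIV. \<forall>z\<in>UNIV. collapses_to UNIV X U f y \<longrightarrow> collapses_to UNIV X U g z \<longrightarrow>
       (fless y z \<longleftrightarrow> ae U (\<lambda>x. fless (ap f x) (ap g x)))"
    proof (intro ballI impI)
      fix f g y z assume i: "collapses_to UNIV X U f y" "collapses_to UNIV X U g z"
      then show "fless y z \<longleftrightarrow> ae U (\<lambda>x. fless (ap f x) (ap g x))"
        using los2[of "\<lambda>M. fless", OF p1 collapses_to_fn[OF i(1)] collapses_to_fn[OF i(2)]] unfolding cls_eqI[OF i(1)] cls_eqI[OF i(2)] by simp
    qed
    have 2: "\<forall>f\<in>UNIV. \<forall>y\<in>UNIV. collapses_to UNIV X U f y \<longrightarrow> ae U (\<lambda>x. finord UNIV (ap f x)) \<longrightarrow> finord UNIV y"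
    proof (intro ballI impI)
      fix f y assume i: "collapses_to UNIV X U f y" and a: "ae U (\<lambda>x. finord UNIV (ap f x))"
      have "finord MU (cls f)" using los1[of finord, OF p2 collapses_to_fn[OF i]] a by simp
      then show "finord UNIV y" unfolding cls_eqI[OF i] by (rule finord_mono)
    qed
    show "(\<forall>f\<in>UNIV. \<forall>y\<in>UNIV. \<forall>g\<in>UNIV. \<forall>z\<in>UNIV. collapses_to UNIV X U f y \<longrightarrow> collapses_to UNIV X U g z \<longrightarrow>
       (fless y z \<longleftrightarrow> ae U (\<lambda>x. fless (ap f x) (ap g x)))) \<and>
     (\<forall>f\<in>UNIV. \<forall>y\<in>UNIV. collapses_to UNIV X U f y \<longrightarrow> ae U (\<lambda>x. finord UNIV (ap f x)) \<longrightarrow> finord UNIV y)"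
      by (intro conjI 1 2)
  qed
qed

context emuf
begin

lemma const_fun: assumes "c \<in> M"
  shows "vlam X (\<lambda>_. c) \<in> M" "vfun (vlam X (\<lambda>_. c)) X" "\<And>x. x \<in> elts X \<Longrightarrow> ap (vlam X (\<lambda>_. c)) x = c"
proof -
  have d: "dt (\<lambda>e. c)" by (intro vdi)
  show v: "vfun (vlam X (\<lambda>_. c)) X" by (rule vlam_vfun[OF d])
  show a: "\<And>x. x \<in> elts X \<Longrightarrow> ap (vlam X (\<lambda>_. c)) x = c" by (rule ap_vlam[OF d])
  have p: "pd (\<lambda>M e. \<exists>f\<in>M. vfun f (e 0) \<and> (\<forall>x\<in>elts (e 0). ap f x = e 1))" by (intro pdi)
  have "\<exists>f\<in>UNIV. vfun f X \<and> (\<forall>x\<in>elts X. ap f x = c)" for X c :: 'v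
  proof -
    have d: "dt (\<lambda>e. c)" by (intro vdi)
    show ?thesis by (rule bexI[of _ "vlam X (\<lambda>_. c)"]) (simp_all add: vlam_vfun[OF d] ap_vlam[OF d])
  qed
  from transfer2[of "\<lambda>M X c. \<exists>f\<in>M. vfun f X \<and> (\<forall>x\<in>elts X. ap f x = c)", OF p inner_model this X_M assms]
  obtain f where f: "f \<in> M" "vfun f X" "\<forall>x\<in>elts X. ap f x = c" by blast
  have "vlam X (\<lambda>_. c) = f" by (rule vfun_ext[OF v f(2)]) (simp add: a f(3))
  then show "vlam X (\<lambda>_. c) \<in> M" using f(1) by simp
qed

lemma emb_cls: "ult_emb M U c = ult_class M U (vlam X (\<lambda>_. c))" by (simp add: ult_emb_def carrier_M)

lemma cls_emb_mem: assumes "f \<in> M" "vfun f X" "c \<in> M"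
  shows "ult_class M U f \<in> elts (ult_emb M U c) \<longleftrightarrow> ae U (\<lambda>x. ap f x \<in> elts c)"
  unfolding emb_cls cls_mem[OF assms(1,2) const_fun(1,2)[OF assms(3)]]
  by (rule ae_cong_M) (simp add: const_fun(3)[OF assms(3)])

lemma cls_fless: assumes "f \<in> M" "vfun f X" "g \<in> M" "vfun g X"
  shows "fless (ult_class M U f) (ult_class M U g) \<longleftrightarrow> ae U (\<lambda>x. fless (ap f x) (ap g x))"
  using ord_props_em[OF inner_model X_M U_M] ccM cls_collapses_to[OF assms(1,2)] cls_collapses_to[OF assms(3,4)] assms cls_in
  unfolding ord_props_def by blast

lemma cls_emb_fless: assumes "f \<in> M" "vfun f X" "c \<in> M"
  shows "fless (ult_class M U f) (ult_emb M U c) \<longleftrightarrow> ae U (\<lambda>x. fless (ap f x) c)"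
  unfolding emb_cls cls_fless[OF assms(1,2) const_fun(1,2)[OF assms(3)]]
  by (rule ae_cong_M) (simp add: const_fun(3)[OF assms(3)])

lemma emb_finord: assumes "c \<in> M" "finord M c" shows "finord M (ult_emb M U c)"
proof -
  note cf = const_fun[OF assms(1)]
  have "ae U (\<lambda>x. finord M (ap (vlam X (\<lambda>_. c)) x))"
    unfolding ae_def by (rule bexI[OF _ X_U]) (simp add: cf(3) assms(2))
  then show ?thesis unfolding emb_cls
    using ord_props_em[OF inner_model X_M U_M] ccM cls_collapses_to[OF cf(1,2)] cls_in[OF cf(1,2)] cf(1)
    unfolding ord_props_def by blast
qed

lemma emb_emb_mem: assumes "a \<in> M" "c \<in> M" shows "ult_emb M U a \<in> elts (ult_emb M U c) \<longleftrightarrow> a \<in> elts c"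
proof -
  note cf = const_fun[OF assms(1)]
  have "ult_emb M U a \<in> elts (ult_emb M U c) \<longleftrightarrow> ae U (\<lambda>x. a \<in> elts c)"
    unfolding emb_cls[of a] cls_emb_mem[OF cf(1,2) assms(2)] by (rule ae_cong_M) (simp add: cf(3))
  also have "\<dots> \<longleftrightarrow> a \<in> elts c"
  proof
    assume "ae U (\<lambda>x. a \<in> elts c)"
    then obtain A where A: "A \<in> elts U" "\<forall>x\<in>elts A. a \<in> elts c" unfolding ae_def by blast
    have "A \<noteq> v0" using A(1) ccM unfolding cc_ultrafilter_on_iff by blast
    then show "a \<in> elts c" using A(2) empty_v0[of A] by blast
  next
    assume "a \<in> elts c" then show "ae U (\<lambda>x. a \<in> elts c)" unfolding ae_def using X_U by blast
  qed
  finally show ?thesis .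
qed

end

section \<open>The Ketonen order\<close>

text \<open>\<open>seed X0 U0 U1\<close> is the Ketonen order as it is seen by \<open>Ult(V,U\<^sub>1)\<close>, and \<open>ketonen U0 U1\<close> its
  combinatorial form, with \<open>Z = [D]\<close>.\<close>

definition seed :: "'v::zfc \<Rightarrow> 'v \<Rightarrow> 'v \<Rightarrow> bool" where
  "seed X0 U0 U1 \<longleftrightarrow> (\<exists>Z. cc_ultrafilter_on (Ult UNIV U1) (ult_emb UNIV U1 X0) Z \<and>
     (\<forall>A. elts A \<subseteq> elts X0 \<longrightarrow> (A \<in> elts U0 \<longleftrightarrow> ult_emb UNIV U1 A \<in> elts Z)) \<and>
     ae Z (\<lambda>b. fless b (ult_id UNIV U1)))"

lemma seed_of_push:
  assumes U1: "uf U1 X1" and W: "cc_ultrafilter_on (Ult UNIV U1) Y W"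
    and h: "h \<in> Ult UNIV U1" "vfun h Y"
    and ne: "elts X0 \<noteq> {}"
    and val: "ae W (\<lambda>y. ap h y \<in> elts (ult_emb UNIV U1 X0))"
    and less: "ae W (\<lambda>y. fless (ap h y) (ult_id UNIV U1))"
    and eq: "\<And>A. elts A \<subseteq> elts X0 \<Longrightarrow> A \<in> elts U0 \<longleftrightarrow> ae W (\<lambda>y. ap h y \<in> elts (ult_emb UNIV U1 A))"
  shows "seed X0 U0 U1"
proof -
  interpret uf U1 X1 by (rule U1)
  interpret N: emuf MU W Y by unfold_locales (rule inner_model_MU, rule W)
  \<comment> \<open>\<open>h\<close> maps into \<open>J X0\<close> only almost everywhere. Its
    correction \<open>k\<close> takes the value \<open>J b\<close> elsewhere, so the image of
    \<open>W\<close> under \<open>k\<close> is an ultrafilter on all of \<open>J X0\<close>; this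
    image is the \<open>Z\<close> of \<open>seed\<close>.\<close>
  obtain b where b: "b \<in> elts X0" using ne by blast
  have p: "pd (\<lambda>M e. \<exists>k\<in>M. vfun k (e 0) \<and> (\<forall>y\<in>elts (e 0). (ap (e 1) y \<in> elts (e 2) \<longrightarrow> ap k y = ap (e 1) y) \<and>
      (ap (e 1) y \<notin> elts (e 2) \<longrightarrow> ap k y = e 3)))" by (intro pdi)
  have V: "\<exists>k\<in>UNIV. vfun k Y \<and> (\<forall>y\<in>elts Y. (ap h y \<in> elts B \<longrightarrow> ap k y = ap h y) \<and> (ap h y \<notin> elts B \<longrightarrow> ap k y = b))"
    for Y h B b :: 'a
  proof -
    define F where "F y = (if ap h y \<in> elts B then ap h y else b)" for y
    have dF: "dt (\<lambda>e. F (e 0))" unfolding F_def by (intro vdi)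
    have "vfun (vlam Y F) Y" "\<And>y. y \<in> elts Y \<Longrightarrow> ap (vlam Y F) y = F y" by (simp_all add: vlam_vfun dF)
    then show ?thesis by (intro bexI[of _ "vlam Y F"]) (simp_all add: F_def)
  qed
  obtain k where k: "k \<in> MU" "vfun k Y" "\<And>y. y \<in> elts Y \<Longrightarrow> ap h y \<in> elts (J X0) \<Longrightarrow> ap k y = ap h y"
    "\<And>y. y \<in> elts Y \<Longrightarrow> ap h y \<notin> elts (J X0) \<Longrightarrow> ap k y = J b"
    using transfer4[of "\<lambda>M Y h B b. \<exists>k\<in>M. vfun k Y \<and> (\<forall>y\<in>elts Y. (ap h y \<in> elts B \<longrightarrow> ap k y = ap h y) \<and> (ap h y \<notin> elts B \<longrightarrow> ap k y = b))",
      OF p inner_model_MU V N.X_M h(1) J_in[of X0] J_in[of b]] by blast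
  have kB: "\<forall>y\<in>elts Y. ap k y \<in> elts (J X0)" using k(3,4) J_mem b by metis
  have akh: "ae W (\<lambda>y. ap k y = ap h y)"
    using val N.sub_X unfolding ae_def by (meson k(3) subsetD)
  obtain Z where Z: "Z \<in> MU" "cc_ultrafilter_on MU (J X0) Z"
    "\<And>A. A \<in> MU \<Longrightarrow> elts A \<subseteq> elts (J X0) \<Longrightarrow> A \<in> elts Z \<longleftrightarrow> ae W (\<lambda>y. ap k y \<in> elts A)"
    using push_prop_em[OF inner_model_MU N.X_M N.U_M k(1) J_in[of X0]] W k(2) kB unfolding push_prop_def by blast
  have W2: "ae W P \<Longrightarrow> ae W Q \<Longrightarrow> (\<And>y. y \<in> elts Y \<Longrightarrow> P y \<Longrightarrow> Q y \<Longrightarrow> R y) \<Longrightarrow> ae W R" for P Q R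
  proof -
    assume "ae W P" "ae W Q" and r: "\<And>y. y \<in> elts Y \<Longrightarrow> P y \<Longrightarrow> Q y \<Longrightarrow> R y"
    then obtain A C where AC: "A \<in> elts W" "C \<in> elts W" "\<forall>x\<in>elts A. P x" "\<forall>x\<in>elts C. Q x" unfolding ae_def by blast
    have "vset {x \<in> elts A. x \<in> elts C} \<in> elts W" using W AC(1,2) unfolding cc_ultrafilter_on_iff by blast
    moreover have "elts (vset {x \<in> elts A. x \<in> elts C}) = {x \<in> elts A. x \<in> elts C}" by (intro elts_vset small_sep vdi)
    ultimately show "ae W R" unfolding ae_def using AC r N.sub_X[OF AC(1)]
      by (intro bexI[of _ "vset {x \<in> elts A. x \<in> elts C}"]) auto
  qed
  have 1: "A \<in> elts U0 \<longleftrightarrow> J A \<in> elts Z" if A: "elts A \<subseteq> elts X0" for A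
  proof -
    have "elts (J A) \<subseteq> elts (J X0)" using elem2[of "\<lambda>M x y. elts x \<subseteq> elts y" A X0] A by (simp add: pd_subset pt_var)
    then have "J A \<in> elts Z \<longleftrightarrow> ae W (\<lambda>y. ap k y \<in> elts (J A))" using Z(3) J_in by blast
    also have "\<dots> \<longleftrightarrow> ae W (\<lambda>y. ap h y \<in> elts (J A))" using W2[OF akh] by (metis (no_types, lifting))
    finally show ?thesis using eq[OF A] by simp
  qed
  have 2: "ae Z (\<lambda>b. fless b idU)"
  proof -
    let ?L = "vset {b \<in> elts (J X0). fless b idU}"
    have L: "elts ?L = {b \<in> elts (J X0). fless b idU}" by (intro elts_vset small_sep vdi)
    have "pt (\<lambda>M e. vset {b \<in> elts (e 0). fless b (e 1)})" by (intro pdi)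
    from pt_in[OF this inner_model_MU, of "case_nat (J X0) (\<lambda>_. idU)"] have LM: "?L \<in> MU"
      using J_in id_in by (simp split: nat.split)
    have "ae W (\<lambda>y. ap k y \<in> elts ?L)" unfolding L
      by (rule W2[OF akh less]) (use kB in auto)
    then have "?L \<in> elts Z" using Z(3)[OF LM] L by blast
    then show ?thesis unfolding ae_def by (rule bexI[rotated]) (simp add: L)
  qed
  show ?thesis unfolding seed_def using Z(2) 1 2 by blast
qed

text \<open>The targets coincide, so the image of the seed of \<open>U0\<close> is represented over
  \<open>Ult(V,U1)\<close> by some \<open>h\<close>; the image of \<open>W1\<close> under
  \<open>h\<close> is the required ultrafilter.\<close>

lemma seed_of_comparison:
  assumes U0: "uf U0 X0" and U1: "uf U1 X1" and c: "comparison U0 U1 W0 W1"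
    and l: "fless (ult_emb (Ult UNIV U0) W0 (ult_id UNIV U0)) (ult_emb (Ult UNIV U1) W1 (ult_id UNIV U1))"
  shows "seed X0 U0 U1"
proof -
  interpret A: uf U0 X0 by (rule U0)
  interpret B: uf U1 X1 by (rule U1)
  obtain Y0 Y1 where Y: "cc_ultrafilter_on A.MU Y0 W0" "cc_ultrafilter_on B.MU Y1 W1"
    using c unfolding comparison_def cc_ultrafilter_def by blast
  interpret N0: emuf A.MU W0 Y0 by unfold_locales (rule A.inner_model_MU, rule Y(1))
  interpret N1: emuf B.MU W1 Y1 by unfold_locales (rule B.inner_model_MU, rule Y(2))
  have eqM: "Ult A.MU W0 = Ult B.MU W1" and com: "\<And>x. ult_emb A.MU W0 (A.J x) = ult_emb B.MU W1 (B.J x)"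
    using c unfolding comparison_def by blast+
  let ?a = "ult_emb A.MU W0 A.idU"
  have "?a \<in> Ult A.MU W0" unfolding N0.emb_cls using N0.const_fun[OF A.id_in] by (intro N0.Ult_I)
  then obtain h where h: "h \<in> B.MU" "vfun h Y1" "?a = ult_class B.MU W1 h" unfolding eqM by (rule N1.UltE)
  \<comment> \<open>\<open>A\<close> is large for \<open>U0\<close> iff the seed belongs to
    \<open>J A\<close>. Applying the embedding of \<open>W0\<close> and commutativity turns this
    into a statement about \<open>h\<close>, the embedding of \<open>W1\<close> and
    \<open>J A\<close> of the other side.\<close>
  have key: "ae U0 (\<lambda>x. x \<in> elts A) \<longleftrightarrow> ae W1 (\<lambda>y. ap h y \<in> elts (B.J A))" for A
    unfolding A.id_J[symmetric] N0.emb_emb_mem[OF A.id_in A.J_in, symmetric] com h(3)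
    by (rule N1.cls_emb_mem[OF h(1,2) B.J_in])
  show ?thesis
  proof (rule seed_of_push[OF U1 Y(2) h(1,2)])
    show "elts X0 \<noteq> {}" using A.ae_ex[OF A.ae_carrier] by blast
    show "ae W1 (\<lambda>y. ap h y \<in> elts (B.J X0))" using key A.ae_carrier by blast
    show "ae W1 (\<lambda>y. fless (ap h y) B.idU)"
      using l unfolding h(3) N1.cls_emb_fless[OF h(1,2) B.id_in] .
    show "(A \<in> elts U0) = ae W1 (\<lambda>y. ap h y \<in> elts (B.J A))" if "elts A \<subseteq> elts X0" for A
      using A.ae_set[OF that] key by simp
  qed
qed

text \<open>Both images of the seeds are finite sets of ordinals, hence comparable. When they are
  equal only agreement of the measures follows, as the spaces may differ; \<open>unif_eq\<close>
  turns this into equality of uniform ultrafilters.\<close>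

lemma trichotomy:
  assumes UA: "ultrapower_axiom TYPE('v::zfc)"
    and U0: "uf U0 X0" and U1: "uf (U1 :: 'v) X1"
    and f0: "\<And>x. x \<in> elts X0 \<Longrightarrow> finord UNIV x" and f1: "\<And>x. x \<in> elts X1 \<Longrightarrow> finord UNIV x"
  shows "seed X0 U0 U1 \<or> seed X1 U1 U0 \<or> (\<forall>B. ae U0 (\<lambda>x. x \<in> elts B) \<longleftrightarrow> ae U1 (\<lambda>x. x \<in> elts B))"
proof -
  interpret A: uf U0 X0 by (rule U0)
  interpret B: uf U1 X1 by (rule U1)
  have "cc_ultrafilter UNIV U0" "cc_ultrafilter UNIV U1" using A.uf B.uf unfolding cc_ultrafilter_def by blast+
  then obtain W0 W1 where c: "comparison U0 U1 W0 W1" using UA unfolding ultrapower_axiom_def by blast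
  then have c': "comparison U1 U0 W1 W0" unfolding comparison_def by simp
  obtain Y0 Y1 where Y: "cc_ultrafilter_on A.MU Y0 W0" "cc_ultrafilter_on B.MU Y1 W1"
    using c unfolding comparison_def cc_ultrafilter_def by blast
  interpret N0: emuf A.MU W0 Y0 by unfold_locales (rule A.inner_model_MU, rule Y(1))
  interpret N1: emuf B.MU W1 Y1 by unfold_locales (rule B.inner_model_MU, rule Y(2))
  have com: "\<And>x. ult_emb A.MU W0 (A.J x) = ult_emb B.MU W1 (B.J x)"
    using c unfolding comparison_def by blast
  let ?a = "ult_emb A.MU W0 A.idU" and ?b = "ult_emb B.MU W1 B.idU"
  have p: "pd (\<lambda>M e. finord M (e 0))" by (intro pdi)
  have "finord A.MU A.idU" unfolding A.id_cls A.los1[of finord, OF p A.I_fun] by (rule A.ae_triv) (simp add: f0)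
  then have a: "has_maxima ?a" using N0.emb_finord[OF A.id_in] finord_mono finord_hm by blast
  have "finord B.MU B.idU" unfolding B.id_cls B.los1[of finord, OF p B.I_fun] by (rule B.ae_triv) (simp add: f1)
  then have b: "has_maxima ?b" using N1.emb_finord[OF B.id_in] finord_mono finord_hm by blast
  consider "?a = ?b" | "fless ?a ?b" | "fless ?b ?a" using fless_linear[OF a b] by blast
  then show ?thesis
  proof cases
    case 1
    have "ae U0 (\<lambda>x. x \<in> elts A) \<longleftrightarrow> ae U1 (\<lambda>x. x \<in> elts A)" for A
      unfolding A.id_J[symmetric] B.id_J[symmetric] N0.emb_emb_mem[OF A.id_in A.J_in, symmetric]
        N1.emb_emb_mem[OF B.id_in B.J_in, symmetric] com 1 ..
    then show ?thesis by blast
  next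
    case 2 then show ?thesis using seed_of_comparison[OF U0 U1 c] by blast
  next
    case 3 then show ?thesis using seed_of_comparison[OF U1 U0 c'] by blast
  qed
qed

section \<open>Wellfoundedness of the Ketonen order\<close>

lemma dt_carrier [vdi]: "dt S \<Longrightarrow> dt (\<lambda>e. carrier (S e))"
  by (rule dt_fun[where F = carrier]) (unfold carrier_def, intro vdi)

definition ketonen_wit :: "'v::zfc \<Rightarrow> 'v \<Rightarrow> 'v \<Rightarrow> bool" where
  "ketonen_wit D U0 U1 \<longleftrightarrow> vfun D (carrier U1) \<and>
     ae U1 (\<lambda>v. cc_ultrafilter_on UNIV (carrier U0) (ap D v) \<and> ae (ap D v) (\<lambda>b. fless b v)) \<and>
     (\<forall>A. elts A \<subseteq> elts (carrier U0) \<longrightarrow> (A \<in> elts U0 \<longleftrightarrow> ae U1 (\<lambda>v. A \<in> elts (ap D v))))"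

definition ketonen :: "'v::zfc \<Rightarrow> 'v \<Rightarrow> bool" where "ketonen U0 U1 \<longleftrightarrow> (\<exists>D. ketonen_wit D U0 U1)"

lemma ketonen_wit_ae: "ketonen_wit D U0 U1 \<Longrightarrow>
    ae U1 (\<lambda>v. cc_ultrafilter_on UNIV (carrier U0) (ap D v) \<and> ae (ap D v) (\<lambda>b. fless b v))"
  unfolding ketonen_wit_def by (elim conjE)

lemma ketonen_wit_iff: "ketonen_wit D U0 U1 \<Longrightarrow>
    \<forall>A. elts A \<subseteq> elts (carrier U0) \<longrightarrow> (A \<in> elts U0 \<longleftrightarrow> ae U1 (\<lambda>v. A \<in> elts (ap D v)))"
  unfolding ketonen_wit_def by (elim conjE)

lemma vd_ketonen_wit0: "vd (\<lambda>e. ketonen_wit (e 0) (e 1) (e 2))" unfolding ketonen_wit_def by (intro vdi)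
lemma vd_ketonen_wit [vdi]: assumes "dt S" "dt T" "dt W" shows "vd (\<lambda>e. ketonen_wit (S e) (T e) (W e))"
proof -
  have "vd (\<lambda>e. \<exists>x y z. x = S e \<and> y = T e \<and> z = W e \<and> ketonen_wit x y z)"
    using vd_ren[OF vd_ketonen_wit0, of "\<lambda>i. if i = 0 then Suc (Suc 0) else if i = 1 then Suc 0 else 0"]
    by (intro vd_ex vd_conj vd_eq dt_var dt_ren[OF assms(1)] dt_ren[OF assms(2)] dt_ren[OF assms(3)]) simp
  then show ?thesis by simp
qed
lemma vd_ketonen [vdi]: "dt S \<Longrightarrow> dt T \<Longrightarrow> vd (\<lambda>e. ketonen (S e) (T e))"
  by (rule vd_pred2[where P = ketonen]) (unfold ketonen_def, intro vdi)

text \<open>Los for \<open>Z = [D]\<close>, with constant functions representing \<open>J X0\<close>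
  and \<open>J A\<close> and the identity representing the seed.\<close>

lemma seed_ketonen:
  assumes "uf U0 X0" "uf U1 X1" "seed X0 U0 U1" shows "ketonen U0 U1"
proof -
  interpret A: uf U0 X0 by fact
  interpret uf U1 X1 by fact
  obtain Z where Z: "cc_ultrafilter_on MU (J X0) Z" "\<And>A. elts A \<subseteq> elts X0 \<Longrightarrow> A \<in> elts U0 \<longleftrightarrow> J A \<in> elts Z"
    "ae Z (\<lambda>b. fless b idU)" using assms(3) unfolding seed_def by blast
  have "Z \<in> MU" using Z(1) unfolding cc_ultrafilter_on_def by blast
  then obtain D where D: "vfun D X1" "Z = cls D" using UltE by blast
  have p1: "pd (\<lambda>M e. cc_ultrafilter_on M (e 0) (e 1))" and p2: "pd (\<lambda>M e. ae (e 0) (\<lambda>b. fless b (e 1)))"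
    and p3: "pd (\<lambda>M e. e 0 \<in> elts (e 1))" by (intro pdi)+
  have 1: "ae U1 (\<lambda>v. cc_ultrafilter_on UNIV X0 (ap D v))"
    using Z(1) unfolding D(2) J_cls los2[of cc_ultrafilter_on, OF p1 K_fun D(1)] by (rule ae_mono) simp
  have 2: "ae U1 (\<lambda>v. ae (ap D v) (\<lambda>b. fless b v))"
    using Z(3) unfolding D(2) id_cls los2[of "\<lambda>M Z i. ae Z (\<lambda>b. fless b i)", OF p2 D(1) I_fun] by (rule ae_mono) simp
  have 3: "A \<in> elts U0 \<longleftrightarrow> ae U1 (\<lambda>v. A \<in> elts (ap D v))" if "elts A \<subseteq> elts X0" for A
    unfolding Z(2)[OF that] D(2) J_cls los2[of "\<lambda>M x y. x \<in> elts y", OF p3 K_fun D(1)] by (rule ae_cong) simp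
  show ?thesis unfolding ketonen_def ketonen_wit_def A.carrier_eq carrier_eq
    using D(1) ae_conj[OF 1 2] 3 by blast
qed

text \<open>A descending sequence starting at \<open>U\<close> is moved to the points of its space:
  for almost every \<open>y\<close> the ultrafilters \<open>Z n y\<close> descend in their turn.
  They form a set without a minimal element whose first member concentrates below
  \<open>y\<close>.\<close>

lemma ketonen_wf_step:
  fixes H :: "'v::zfc"
  defines "nomin \<equiv> \<lambda>B. \<forall>V\<in>elts B. cc_ultrafilter_on UNIV (carrier V) V \<and> elts (carrier V) \<subseteq> elts H \<and> (\<exists>V'\<in>elts B. ketonen V' V)"
  assumes B: "nomin B" and U: "U \<in> elts B"
  shows "ae U (\<lambda>x. \<exists>B. nomin B \<and> (\<exists>V\<in>elts B. ae V (\<lambda>b. fless b x)))"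
proof -
  have ufB: "uf V (carrier V)" if "V \<in> elts B" for V using B that unfolding nomin_def uf_def by blast
  interpret uf U "carrier U" by (rule ufB[OF U])
  have v: "vd (\<lambda>e. e 1 \<in> elts B \<and> ketonen (e 1) (e 0))" by (intro vdi)
  obtain c where c: "vfun c B" "\<And>V. V \<in> elts B \<Longrightarrow> ap c V \<in> elts B \<and> ketonen (ap c V) V"
    by (rule choose_fun[of "\<lambda>V V'. V' \<in> elts B \<and> ketonen V' V" B, OF v]) (use B in \<open>unfold nomin_def, blast+\<close>)
  have v: "vd (\<lambda>e. ketonen_wit (e 1) (ap c (e 0)) (e 0))" by (intro vdi)
  obtain d where d: "vfun d B" "\<And>V. V \<in> elts B \<Longrightarrow> ketonen_wit (ap d V) (ap c V) V"
    by (rule choose_fun[of "\<lambda>V D. ketonen_wit D (ap c V) V" B, OF v]) (use c(2) in \<open>unfold ketonen_def, blast+\<close>)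
  have dc: "dt (\<lambda>e. ap c (e 1))" by (intro vdi)
  obtain s where s: "ap s v0 = U" "\<And>n. natural n \<Longrightarrow> ap s (vsucc n) = ap c (ap s n)"
    using omega_rec[of "\<lambda>_ x. ap c x" U, OF dc] by blast
  have sB: "ap s n \<in> elts B" if "natural n" for n using that
  proof (induction n rule: natural_induct)
    case dfn show ?case by (intro vdi)
  qed (use s U c in auto)
  \<comment> \<open>The indices are shifted: \<open>U\<close> is the value of \<open>s\<close> at 0,
    so \<open>Z n y\<close> stands for the value at n+1, and \<open>E n\<close> witnesses that the
    value at n+2 is below the one at n+1.\<close>
  define Xn where "Xn n = carrier (ap s (vsucc n))" for n
  have dX [vdi]: "dt (\<lambda>e. Xn (S e))" if "dt S" for S by (rule dt_fun[OF _ that]) (unfold Xn_def, intro vdi)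
  define E where "E n = ap d (ap s (vsucc n))" for n
  have dE [vdi]: "dt (\<lambda>e. E (S e))" if "dt S" for S by (rule dt_fun[OF _ that]) (unfold E_def, intro vdi)
  \<comment> \<open>The next ultrafilter at \<open>y\<close> is the limit of the witness
    \<open>E n\<close> along the current one, written out as a set; that the current one is an
    ultrafilter is known only for almost all \<open>y\<close>.\<close>
  define F where "F n z = vlam (carrier U) (\<lambda>y. vset {A. elts A \<subseteq> elts (Xn (vsucc n)) \<and> ae (ap z y) (\<lambda>v. A \<in> elts (ap (E n) v))})" for n z
  have dF: "dt (\<lambda>e. F (e 0) (e 1))" unfolding F_def by (intro vdi)
  obtain zz where zz: "ap zz v0 = ap d U" "\<And>n. natural n \<Longrightarrow> ap zz (vsucc n) = F n (ap zz n)"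
    using omega_rec[of F "ap d U", OF dF] by blast
  define Z where "Z n y = ap (ap zz n) y" for n y
  have dZ [vdi]: "dt (\<lambda>e. Z (S e) (T e))" if "dt S" "dt T" for S T by (rule dt_fun2[OF _ that]) (unfold Z_def, intro vdi)
  have Zs: "Z (vsucc n) y = vset {A. elts A \<subseteq> elts (Xn (vsucc n)) \<and> ae (Z n y) (\<lambda>v. A \<in> elts (ap (E n) v))}"
    if "natural n" "y \<in> elts (carrier U)" for n y
    unfolding Z_def zz(2)[OF that(1)] F_def
    by (rule ap_vlam[OF _ that(2)]) (intro vdi)
  \<comment> \<open>The points at which the witness \<open>E n\<close> does its work. If this set is
    large for \<open>Z n y\<close>, the limit is an ultrafilter and \<open>E n\<close> witnesses the
    next descent as well.\<close>
  define g where "g n = vset {v \<in> elts (Xn n). cc_ultrafilter_on UNIV (Xn (vsucc n)) (ap (E n) v) \<and> ae (ap (E n) v) (\<lambda>b. fless b v)}" for n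
  have g: "elts (g n) = {v \<in> elts (Xn n). cc_ultrafilter_on UNIV (Xn (vsucc n)) (ap (E n) v) \<and> ae (ap (E n) v) (\<lambda>b. fless b v)}" for n
    unfolding g_def by (intro elts_vset small_sep vdi)
  have dg [vdi]: "dt (\<lambda>e. g (S e))" if "dt S" for S by (rule dt_fun[OF _ that]) (unfold g_def, intro vdi)
  have klwE: "ketonen_wit (E n) (ap s (vsucc (vsucc n))) (ap s (vsucc n))" if "natural n" for n
    using d(2)[OF sB[OF natural_vsucc[OF that]]] s(2)[OF natural_vsucc[OF that]] unfolding E_def by simp
  have gV: "g n \<in> elts (ap s (vsucc n))" if "natural n" for n
  proof -
    interpret V: uf "ap s (vsucc n)" "Xn n" unfolding Xn_def by (rule ufB[OF sB[OF natural_vsucc[OF that]]])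
    have v: "vd (\<lambda>e. cc_ultrafilter_on UNIV (Xn (vsucc n)) (ap (E n) (e 0)) \<and> ae (ap (E n) (e 0)) (\<lambda>b. fless b (e 0)))"
      by (intro vdi)
    show ?thesis unfolding g_def V.ae_iff_set[OF v, symmetric] unfolding Xn_def by (rule ketonen_wit_ae[OF klwE[OF that]])
  qed
  have next_y: "cc_ultrafilter_on UNIV (Xn (vsucc n)) (Z (vsucc n) y) \<and> ketonen (Z (vsucc n) y) (Z n y)"
    if n: "natural n" and y: "y \<in> elts (carrier U)" and cc: "cc_ultrafilter_on UNIV (Xn n) (Z n y)" and gz: "g n \<in> elts (Z n y)" for n y
  proof -
    interpret W: uf "Z n y" "Xn n" by unfold_locales (rule cc)
    have a: "ae (Z n y) (\<lambda>v. cc_ultrafilter_on UNIV (Xn (vsucc n)) (ap (E n) v) \<and> ae (ap (E n) v) (\<lambda>b. fless b v))"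
      unfolding ae_def[of "Z n y"] by (rule bexI[OF _ gz]) (simp add: g)
    have l: "Z (vsucc n) y = W.lim (Xn (vsucc n)) (E n)" unfolding Zs[OF n y] W.lim_def ..
    have cc': "cc_ultrafilter_on UNIV (Xn (vsucc n)) (Z (vsucc n) y)" unfolding l
      by (rule W.lim_cc, rule W.ae_mono[OF a]) blast
    interpret W': uf "Z (vsucc n) y" "Xn (vsucc n)" by unfold_locales (rule cc')
    have "vfun (E n) (Xn n)" using klwE[OF n] unfolding ketonen_wit_def Xn_def by blast
    then have "ketonen_wit (E n) (Z (vsucc n) y) (Z n y)" unfolding ketonen_wit_def W.carrier_eq W'.carrier_eq
      using a W.elts_lim unfolding l by blast
    then show ?thesis using cc' unfolding ketonen_def by blast
  qed
  \<comment> \<open>The second conjunct says that the \<open>Z n y\<close> integrate to the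
    corresponding member of the sequence. It carries the largeness of \<open>g n\<close> from that
    member to almost every \<open>Z n y\<close>, which keeps the induction going.\<close>
  have C: "ae U (\<lambda>y. cc_ultrafilter_on UNIV (Xn n) (Z n y)) \<and>
      (\<forall>A. elts A \<subseteq> elts (Xn n) \<longrightarrow> (A \<in> elts (ap s (vsucc n)) \<longleftrightarrow> ae U (\<lambda>y. A \<in> elts (Z n y))))" if "natural n" for n
    using that
  proof (induction n rule: natural_induct)
    case dfn show ?case by (intro vdi)
  next
    case zero
    have 1: "ketonen_wit (ap d U) (ap s (vsucc v0)) U" using d(2)[OF U] s(2)[OF natural_v0] s(1) by simp
    have 2: "ae U (\<lambda>v. cc_ultrafilter_on UNIV (Xn v0) (Z v0 v) \<and> ae (Z v0 v) (\<lambda>b. fless b v))"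
      unfolding Xn_def Z_def zz(1) by (rule ketonen_wit_ae[OF 1])
    have 3: "\<forall>A. elts A \<subseteq> elts (Xn v0) \<longrightarrow> (A \<in> elts (ap s (vsucc v0)) \<longleftrightarrow> ae U (\<lambda>y. A \<in> elts (Z v0 y)))"
      unfolding Xn_def Z_def zz(1) by (rule ketonen_wit_iff[OF 1])
    have "ae U (\<lambda>y. cc_ultrafilter_on UNIV (Xn v0) (Z v0 y))" by (rule ae_mono[OF 2]) (rule conjunct1)
    then show ?case using 3 by (rule conjI)
  next
    case (succ n)
    interpret V: uf "ap s (vsucc n)" "Xn n" unfolding Xn_def by (rule ufB[OF sB[OF natural_vsucc[OF succ(1)]]])
    have "elts (g n) \<subseteq> elts (Xn n)" by (auto simp: g)
    then have gz: "ae U (\<lambda>y. g n \<in> elts (Z n y))" using succ(2) gV[OF succ(1)] by blast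
    have cc: "ae U (\<lambda>y. cc_ultrafilter_on UNIV (Xn n) (Z n y))" using succ(2) by blast
    have 1: "ae U (\<lambda>y. cc_ultrafilter_on UNIV (Xn (vsucc n)) (Z (vsucc n) y))"
      by (rule ae_mp[OF cc gz]) (use next_y[OF succ(1)] in blast)
    have 2: "A \<in> elts (ap s (vsucc (vsucc n))) \<longleftrightarrow> ae U (\<lambda>y. A \<in> elts (Z (vsucc n) y))" if A: "elts A \<subseteq> elts (Xn (vsucc n))" for A
    proof -
      have v: "vd (\<lambda>e. A \<in> elts (ap (E n) (e 0)))" by (intro vdi)
      let ?A = "vset {v \<in> elts (Xn n). A \<in> elts (ap (E n) v)}"
      have eA: "elts ?A = {v \<in> elts (Xn n). A \<in> elts (ap (E n) v)}" by (intro elts_vset small_sep v)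
      have "A \<in> elts (ap s (vsucc (vsucc n))) \<longleftrightarrow> ae (ap s (vsucc n)) (\<lambda>v. A \<in> elts (ap (E n) v))"
        using ketonen_wit_iff[OF klwE[OF succ(1)]] A unfolding Xn_def by blast
      also have "\<dots> \<longleftrightarrow> ?A \<in> elts (ap s (vsucc n))" by (rule V.ae_iff_set[OF v])
      also have "\<dots> \<longleftrightarrow> ae U (\<lambda>y. ?A \<in> elts (Z n y))" using succ(2) eA by auto
      also have "\<dots> \<longleftrightarrow> ae U (\<lambda>y. A \<in> elts (Z (vsucc n) y))"
      proof -
        have e: "?A \<in> elts (Z n y) \<longleftrightarrow> A \<in> elts (Z (vsucc n) y)"
          if y: "y \<in> elts (carrier U)" and c: "cc_ultrafilter_on UNIV (Xn n) (Z n y)" for y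
        proof -
          interpret W: uf "Z n y" "Xn n" by unfold_locales (rule c)
          have "Z (vsucc n) y = W.lim (Xn (vsucc n)) (E n)" unfolding Zs[OF succ(1) y] W.lim_def ..
          then show ?thesis unfolding W.ae_iff_set[OF v, symmetric] using W.elts_lim A by simp
        qed
        show ?thesis
        proof
          assume "ae U (\<lambda>y. ?A \<in> elts (Z n y))"
          from cc this show "ae U (\<lambda>y. A \<in> elts (Z (vsucc n) y))" by (rule ae_mp) (simp add: e)
        next
          assume "ae U (\<lambda>y. A \<in> elts (Z (vsucc n) y))"
          from cc this show "ae U (\<lambda>y. ?A \<in> elts (Z n y))" by (rule ae_mp) (simp add: e)
        qed
      qed
      finally show ?thesis .
    qed
    show ?case using 1 2 by blast
  qed
  have v: "vd (\<lambda>e. cc_ultrafilter_on UNIV (Xn (e 0)) (Z (e 0) (e 1)) \<and> g (e 0) \<in> elts (Z (e 0) (e 1)))" by (intro vdi)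
  have "ae U (\<lambda>y. \<forall>n. natural n \<longrightarrow> cc_ultrafilter_on UNIV (Xn n) (Z n y) \<and> g n \<in> elts (Z n y))"
  proof (rule ae_nat[OF v])
    fix n :: 'v assume n: "natural n"
    have "elts (g n) \<subseteq> elts (Xn n)" by (auto simp: g)
    then show "ae U (\<lambda>y. cc_ultrafilter_on UNIV (Xn n) (Z n y) \<and> g n \<in> elts (Z n y))"
      using C[OF n] gV[OF n] by (intro ae_conj) blast+
  qed
  moreover have "ae U (\<lambda>v. cc_ultrafilter_on UNIV (carrier (ap c U)) (Z v0 v) \<and> ae (Z v0 v) (\<lambda>b. fless b v))"
    unfolding Z_def zz(1) by (rule ketonen_wit_ae[OF d(2)[OF U]])
  then have "ae U (\<lambda>y. ae (Z v0 y) (\<lambda>b. fless b y))" by (rule ae_mono) (rule conjunct2)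
  ultimately show ?thesis
  proof (rule ae_mp)
    fix y assume y: "y \<in> elts (carrier U)" and r: "\<forall>n. natural n \<longrightarrow> cc_ultrafilter_on UNIV (Xn n) (Z n y) \<and> g n \<in> elts (Z n y)"
      and l: "ae (Z v0 y) (\<lambda>b. fless b y)"
    define B' where "B' = vset ((\<lambda>n. Z n y) ` elts omega)"
    have B': "elts B' = (\<lambda>n. Z n y) ` elts omega" unfolding B'_def by (intro elts_vset small_image vdi)
    have "nomin B'" unfolding nomin_def
    proof
      fix V assume "V \<in> elts B'"
      then obtain n where n: "natural n" "V = Z n y" by (auto simp: B')
      interpret W: uf V "Xn n" unfolding n(2) by unfold_locales (use r n(1) in blast)
      have "elts (Xn n) \<subseteq> elts H" using B sB[OF natural_vsucc[OF n(1)]] unfolding nomin_def Xn_def by blast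
      moreover have "Z (vsucc n) y \<in> elts B'" using natural_vsucc[OF n(1)] by (auto simp: B')
      moreover have "ketonen (Z (vsucc n) y) V" using next_y[OF n(1) y] r n by blast
      ultimately show "cc_ultrafilter_on UNIV (carrier V) V \<and> elts (carrier V) \<subseteq> elts H \<and> (\<exists>V'\<in>elts B'. ketonen V' V)"
        unfolding W.carrier_eq using W.uf by blast
    qed
    moreover have "Z v0 y \<in> elts B'" using natural_v0 by (auto simp: B')
    ultimately show "\<exists>B. nomin B \<and> (\<exists>V\<in>elts B. ae V (\<lambda>b. fless b y))" using l by blast
  qed
qed

text \<open>\<open>Q x\<close> says that a set without a minimal element has a member concentrating
  below \<open>x\<close>. By \<open>ketonen_wf_step\<close> almost all points satisfy
  \<open>Q\<close>, for every member of every such set. At the \<open>fless\<close>-least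
  \<open>m\<close> with \<open>Q m\<close>, the member concentrating below \<open>m\<close> yields a
  smaller such point.\<close>

lemma ketonen_wf:
  fixes H :: "'v::zfc"
  assumes H: "\<And>x. x \<in> elts H \<Longrightarrow> has_maxima x"
    and B: "\<And>V. V \<in> elts B \<Longrightarrow> cc_ultrafilter_on UNIV (carrier V) V \<and> elts (carrier V) \<subseteq> elts H"
    and b0: "b0 \<in> elts B"
  shows "\<exists>m\<in>elts B. \<forall>V\<in>elts B. \<not> ketonen V m"
proof (rule ccontr)
  assume n: "\<not> ?thesis"
  define nomin where "nomin = (\<lambda>B. \<forall>V\<in>elts B. cc_ultrafilter_on UNIV (carrier V) V \<and> elts (carrier V) \<subseteq> elts H \<and> (\<exists>V'\<in>elts B. ketonen V' V))"
  have vn [vdi]: "vd (\<lambda>e. nomin (S e))" if "dt S" for S by (rule vd_pred[OF _ that]) (unfold nomin_def, intro vdi)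
  define Q where "Q x \<longleftrightarrow> (\<exists>B. nomin B \<and> (\<exists>V\<in>elts B. ae V (\<lambda>b. fless b x)))" for x
  have vQ: "vd (\<lambda>e. Q (e 0))" unfolding Q_def by (intro vdi)
  have step: "ae V Q" if "nomin B" "V \<in> elts B" for B V
    using ketonen_wf_step[of B H V] that unfolding nomin_def Q_def by blast
  have ufn: "uf V (carrier V)" if "nomin B" "V \<in> elts B" for B V
    using that unfolding nomin_def uf_def by blast
  have cH: "elts (carrier V) \<subseteq> elts H" if "nomin B" "V \<in> elts B" for B V using that unfolding nomin_def by blast
  have nB: "nomin B" unfolding nomin_def using n B by blast
  interpret U: uf b0 "carrier b0" by (rule ufn[OF nB b0])
  obtain x where x: "x \<in> elts H" "Q x" using U.ae_ex[OF step[OF nB b0]] cH[OF nB b0] by blast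
  obtain m where m: "m \<in> elts H" "Q m" "\<And>y. y \<in> elts H \<Longrightarrow> Q y \<Longrightarrow> \<not> fless y m"
    using wf_rel_min[OF fless_wf[OF H] vQ x] by blast
  obtain B' V where V: "nomin B'" "V \<in> elts B'" "ae V (\<lambda>b. fless b m)" using m(2) unfolding Q_def by blast
  interpret V: uf V "carrier V" by (rule ufn[OF V(1,2)])
  obtain y where "y \<in> elts (carrier V)" "Q y" "fless y m" using V.ae_ex[OF V.ae_conj[OF step[OF V(1,2)] V(3)]] by blast
  then show False using m(3) cH[OF V(1,2)] by blast
qed

section \<open>Uniform and Dodd solid ultrafilters\<close>

lemma vd_has_size [vdi]: "dt S \<Longrightarrow> dt T \<Longrightarrow> vd (\<lambda>e. has_size (S e) (T e))"
proof (rule vd_pred2[where P = has_size])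
  have p: "pd (\<lambda>M e. bij_fun (e 0) (e 1) (e 2))" by (intro pdi)
  show "vd (\<lambda>e. has_size (e 0 :: 'a) (e 1))" unfolding has_size_iff
    by (intro vdi vd_pd3[of "\<lambda>M. bij_fun", OF p])
qed

lemma vd_finord [vdi]: "dt S \<Longrightarrow> vd (\<lambda>e. finord UNIV (S e))"
  by (rule vd_pd1[of finord]) (intro pdi)

lemma elts_nsubsets: "elts (nsubsets X n) = {b. elts b \<subseteq> elts X \<and> has_size b n}"
  unfolding nsubsets_def by (intro elts_vset small_subset[of _ "vPow X"]) (intro vdi, auto)

lemma elts_finsubsets: "elts (finsubsets X) = {b. elts b \<subseteq> elts X \<and> (\<exists>n. natural n \<and> has_size b n)}"
  unfolding finsubsets_def vfinite_def by (intro elts_vset small_subset[of _ "vPow X"]) (intro vdi, auto)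

lemma finsubsets_finord: "Ord \<kappa> \<Longrightarrow> b \<in> elts (finsubsets \<kappa>) \<Longrightarrow> finord UNIV b"
  unfolding elts_finsubsets finord_def has_size_iff using Ord_in by auto

lemma carrier_on: "cc_ultrafilter_on UNIV X U \<Longrightarrow> carrier U = X"
  by (rule uf.carrier_eq) unfold_locales

text \<open>If \<open>\<kappa>\<close> were an element of \<open>\<kappa>'\<close>, the common
  carrier would consist of subsets of \<open>\<kappa>\<close> and thus equal
  \<open>nsubsets \<kappa> n'\<close>, against the minimality of \<open>\<kappa>'\<close>.\<close>

lemma uniform_on_unique: assumes "uniform_on \<kappa> n U" "uniform_on \<kappa>' n' U" shows "\<kappa> = \<kappa>'"
proof -
  have *: "\<kappa> \<notin> elts \<kappa>'" if u: "uniform_on \<kappa> n U" "uniform_on \<kappa>' n' U" for \<kappa> \<kappa>' n n'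
  proof
    assume k: "\<kappa> \<in> elts \<kappa>'"
    have cc: "cc_ultrafilter_on UNIV (nsubsets \<kappa> n) U" "cc_ultrafilter_on UNIV (nsubsets \<kappa>' n') U"
      using u unfolding uniform_on_def by blast+
    have "nsubsets \<kappa> n = nsubsets \<kappa>' n'" using carrier_on[OF cc(1)] carrier_on[OF cc(2)] by simp
    then have e: "elts (nsubsets \<kappa> n) = elts (nsubsets \<kappa>' n')" by simp
    have "elts \<kappa> \<subseteq> elts \<kappa>'" using k u(2) Ord_trans unfolding uniform_on_def by blast
    then have "elts (nsubsets \<kappa> n') = elts (nsubsets \<kappa>' n')" using e unfolding elts_nsubsets by blast
    then have "nsubsets \<kappa> n' = nsubsets \<kappa>' n'" by (rule extensionality)
    then show False using u(2) k cc(2) unfolding uniform_on_def cc_ultrafilter_on_iff by metis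
  qed
  show ?thesis using *[OF assms] *[OF assms(2,1)] assms Ord_linear unfolding uniform_on_def by blast
qed

lemma sp_eq: "uniform_on \<kappa> n U \<Longrightarrow> sp U = \<kappa>"
  unfolding sp_def using uniform_on_unique by (intro the_equality) blast+

locale unif = uf U X for U X :: "'v::zfc" +
  fixes \<kappa> n :: 'v
  assumes unif: "uniform_on \<kappa> n U" and X_eq: "X = nsubsets \<kappa> n"
begin

lemma Ord_\<kappa>: "Ord \<kappa>" and nat_n: "natural n" and unif_min: "\<alpha> \<in> elts \<kappa> \<Longrightarrow> nsubsets \<alpha> n \<notin> elts U"
  using unif unfolding uniform_on_def by blast+

lemma X_fin: "elts X \<subseteq> elts (finsubsets \<kappa>)"
  unfolding X_eq elts_nsubsets elts_finsubsets using nat_n by blast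

lemma X_finord: "x \<in> elts X \<Longrightarrow> finord UNIV x" using X_fin finsubsets_finord[OF Ord_\<kappa>] by blast
lemma X_hm: "x \<in> elts X \<Longrightarrow> has_maxima x" using X_finord finord_hm by blast
lemma X_sub: "x \<in> elts X \<Longrightarrow> elts x \<subseteq> elts \<kappa>" using X_fin unfolding elts_finsubsets by blast

lemma ae_not_sub: assumes "\<alpha> \<in> elts \<kappa>" shows "ae U (\<lambda>b. \<not> elts b \<subseteq> elts \<alpha>)"
proof -
  have "\<not> ae U (\<lambda>b. elts b \<subseteq> elts \<alpha>)"
  proof
    assume a: "ae U (\<lambda>b. elts b \<subseteq> elts \<alpha>)"
    have "elts (nsubsets \<alpha> n) \<subseteq> elts X" unfolding X_eq elts_nsubsets using Ord_trans[OF Ord_\<kappa> assms] by blast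
    moreover have "ae U (\<lambda>b. b \<in> elts (nsubsets \<alpha> n))" by (rule ae_mono[OF a]) (simp add: X_eq elts_nsubsets)
    ultimately show False using ae_set unif_min[OF assms] by blast
  qed
  then show ?thesis by (subst ae_not) (intro vdi)
qed

end

text \<open>\<open>J C\<close> and the points below the seed are both large for \<open>Z\<close>,
  hence meet; Los turns this into a statement about almost all \<open>x\<close>. The comparisons of
  spaces use the relation \<open>seed\<close> in this form.\<close>

lemma seed_meet:
  assumes "uf U0 X0" "uf U1 X1" "seed X0 U0 U1" "elts C \<subseteq> elts X0" "C \<in> elts U0"
  shows "ae U1 (\<lambda>x. \<exists>b\<in>elts C. fless b x)"
proof -
  interpret uf U1 X1 by fact
  obtain Z where Z: "cc_ultrafilter_on MU (J X0) Z" "\<And>A. elts A \<subseteq> elts X0 \<Longrightarrow> A \<in> elts U0 \<longleftrightarrow> J A \<in> elts Z"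
    "ae Z (\<lambda>b. fless b idU)" using assms(3) unfolding seed_def by blast
  obtain A where A: "A \<in> elts Z" "\<forall>b\<in>elts A. fless b idU" using Z(3) unfolding ae_def by blast
  have "J C \<in> elts Z" using Z(2) assms(4,5) by blast
  then have i: "vset {x \<in> elts A. x \<in> elts (J C)} \<in> elts Z" using Z(1) A(1) unfolding cc_ultrafilter_on_iff by blast
  have e: "elts (vset {x \<in> elts A. x \<in> elts (J C)}) = {x \<in> elts A. x \<in> elts (J C)}" by (intro elts_vset small_sep vdi)
  have "vset {x \<in> elts A. x \<in> elts (J C)} \<noteq> v0" using i Z(1) unfolding cc_ultrafilter_on_iff by metis
  then have "\<exists>b\<in>elts (J C). fless b idU" using empty_v0 e A(2) by blast
  moreover have p: "pd (\<lambda>M e. \<exists>b\<in>elts (e 0). fless b (e 1))" by (intro pdi)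
  ultimately have "ae U1 (\<lambda>x. \<exists>b\<in>elts (ap (K C) x). fless b (ap I x))"
    using los2[of "\<lambda>M x y. \<exists>b\<in>elts x. fless b y", OF p K_fun I_fun] unfolding J_cls id_cls by simp
  then show ?thesis by (rule ae_mono) simp
qed

lemma fless_sub: assumes "Ord \<kappa>" "elts y \<subseteq> elts \<kappa>" "fless b y" shows "elts b \<subseteq> elts \<kappa>"
proof
  fix \<xi> assume x: "\<xi> \<in> elts b"
  obtain \<delta> where \<delta>: "\<delta> \<in> elts y" "\<forall>\<xi>\<in>elts b. \<xi> \<notin> elts y \<longrightarrow> \<xi> = \<delta> \<or> \<xi> \<in> elts \<delta>"
    using assms(3) unfolding fless_def by blast
  then show "\<xi> \<in> elts \<kappa>" using x assms(2) Ord_trans[OF assms(1), of \<delta>] by blast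
qed

text \<open>If \<open>\<kappa>1\<close> were smaller, \<open>U0\<close> would concentrate on sets
  not contained in \<open>\<kappa>1\<close>; but whatever is \<open>fless\<close>-below a subset of
  an ordinal is a subset of that ordinal.\<close>

lemma seed_sp: assumes "unif U0 X0 \<kappa>0 n0" "unif U1 X1 \<kappa>1 n1" "seed X0 U0 U1" shows "elts \<kappa>0 \<subseteq> elts \<kappa>1"
proof -
  interpret A: unif U0 X0 \<kappa>0 n0 by fact
  interpret B: unif U1 X1 \<kappa>1 n1 by fact
  have "\<kappa>1 \<notin> elts \<kappa>0"
  proof
    assume k: "\<kappa>1 \<in> elts \<kappa>0"
    define C where "C = vset {b \<in> elts X0. \<not> elts b \<subseteq> elts \<kappa>1}"
    have v: "vd (\<lambda>e. \<not> elts (e 0) \<subseteq> elts \<kappa>1)" by (intro vdi)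
    have C: "elts C = {b \<in> elts X0. \<not> elts b \<subseteq> elts \<kappa>1}" unfolding C_def by (intro elts_vset small_sep v)
    have "C \<in> elts U0" unfolding C_def A.ae_iff_set[OF v, symmetric] by (rule A.ae_not_sub[OF k])
    then have "ae U1 (\<lambda>x. \<exists>b\<in>elts C. fless b x)"
      using seed_meet[OF A.uf_axioms B.uf_axioms assms(3)] C by blast
    from B.ae_ex[OF this] obtain x b where "x \<in> elts X1" "b \<in> elts C" "fless b x" by blast
    then show False using fless_sub[OF B.Ord_\<kappa> B.X_sub] C by blast
  qed
  then show ?thesis using Ord_linear[OF A.Ord_\<kappa> B.Ord_\<kappa>] Ord_trans[OF B.Ord_\<kappa>] by blast
qed

text \<open>A bounded space would contradict uniformity on the other side, so the ordinals agree; a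
  point common to both spaces shows that the sizes agree.\<close>

lemma unif_eq:
  assumes "unif U0 X0 \<kappa>0 n0" "unif U1 X1 \<kappa>1 n1" and eq: "\<And>B. ae U0 (\<lambda>x. x \<in> elts B) \<longleftrightarrow> ae U1 (\<lambda>x. x \<in> elts B)"
  shows "U0 = U1"
proof -
  have *: "\<kappa>0 \<notin> elts \<kappa>1" if "unif U0 X0 \<kappa>0 n0" "unif U1 X1 \<kappa>1 n1" and eq: "\<And>B. ae U0 (\<lambda>x. x \<in> elts B) \<longleftrightarrow> ae U1 (\<lambda>x. x \<in> elts B)"
    for U0 X0 \<kappa>0 n0 U1 X1 \<kappa>1 n1
  proof
    interpret A: unif U0 X0 \<kappa>0 n0 by fact
    interpret B: unif U1 X1 \<kappa>1 n1 by fact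
    assume k: "\<kappa>0 \<in> elts \<kappa>1"
    have "ae U1 (\<lambda>x. x \<in> elts X0)" using eq A.ae_carrier by blast
    from B.ae_ex[OF B.ae_conj[OF this B.ae_not_sub[OF k]]] A.X_sub show False by blast
  qed
  interpret A: unif U0 X0 \<kappa>0 n0 by fact
  interpret B: unif U1 X1 \<kappa>1 n1 by fact
  have k: "\<kappa>0 = \<kappa>1" using *[OF assms] *[OF assms(2,1)] eq Ord_linear[OF A.Ord_\<kappa> B.Ord_\<kappa>] by blast
  have "ae U1 (\<lambda>x. x \<in> elts X0)" using eq A.ae_carrier by blast
  then obtain b where "b \<in> elts X1" "b \<in> elts X0" using B.ae_ex by blast
  then have fg: "has_size b n0" "has_size b n1" unfolding A.X_eq B.X_eq elts_nsubsets by blast+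
  have sz: "has_size c n1" if c: "has_size c n" and b: "has_size b n" "has_size b n1" for c n n1
  proof -
    obtain f g h where f: "bij_betw (app f) (elts n) (elts b)" and g: "vfun g n1" "bij_betw (app g) (elts n1) (elts b)"
      and h: "vfun h n" "bij_betw (app h) (elts n) (elts c)" and ff: "vfun f n" using c b unfolding has_size_def by blast
    \<comment> \<open>The graph of the composition of \<open>h\<close>, the inverse of
      \<open>f\<close>, and \<open>g\<close>. As a definable relation it gives a function of the
      model, which the HOL composition would not.\<close>
    define P where "P x y \<longleftrightarrow> (\<exists>z\<in>elts n. ap f z = ap g x \<and> y = ap h z)" for x y
    have v: "vd (\<lambda>e. P (e 0) (e 1))" unfolding P_def by (intro vdi)
    have f': "bij_betw (ap f) (elts n) (elts b)" using f app_ap[OF ff] bij_betw_cong[of "elts n" "app f" "ap f"] by simp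
    have g': "bij_betw (ap g) (elts n1) (elts b)" using g(2) app_ap[OF g(1)] bij_betw_cong[of "elts n1" "app g" "ap g"] by simp
    have h': "bij_betw (ap h) (elts n) (elts c)" using h(2) app_ap[OF h(1)] bij_betw_cong[of "elts n" "app h" "ap h"] by simp
    let ?k = "\<lambda>x. ap h (inv_into (elts n) (ap f) (ap g x))"
    have bk: "bij_betw ?k (elts n1) (elts c)"
      using bij_betw_trans[OF g' bij_betw_trans[OF bij_betw_inv_into[OF f'] h']] by (simp add: comp_def)
    have Pk: "P x y \<longleftrightarrow> y = ?k x" if "x \<in> elts n1" for x y
    proof -
      have "ap g x \<in> elts b" using g' that unfolding bij_betw_def by blast
      then have 1: "ap f (inv_into (elts n) (ap f) (ap g x)) = ap g x" "inv_into (elts n) (ap f) (ap g x) \<in> elts n"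
        using f' unfolding bij_betw_def by (metis f_inv_into_f, metis inv_into_into)
      have "z = inv_into (elts n) (ap f) (ap g x)" if "z \<in> elts n" "ap f z = ap g x" for z
        using f' that unfolding bij_betw_def by (metis inv_into_f_f)
      then show ?thesis unfolding P_def using 1 by blast
    qed
    obtain k where k: "vfun k n1" "\<And>x. x \<in> elts n1 \<Longrightarrow> P x (ap k x)"
      by (rule choose_fun[of P n1, OF v]) (use Pk in blast)+
    have "bij_betw (app k) (elts n1) (elts c)"
      using bij_betw_cong[of "elts n1" "app k" ?k] Pk k app_ap[OF k(1)] bk by simp
    then show ?thesis unfolding has_size_def using k(1) by blast
  qed
  have "elts X0 = elts X1" unfolding A.X_eq B.X_eq elts_nsubsets k using sz[OF _ fg] sz[OF _ fg(2,1)] by blast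
  then have X: "X0 = X1" by (rule extensionality)
  show ?thesis
  proof (rule eltsI)
    fix z show "z \<in> elts U0 \<longleftrightarrow> z \<in> elts U1"
      using A.sub[of z] B.sub[of z] A.ae_set[of z] B.ae_set[of z] eq[of z] unfolding X by blast
  qed
qed

section \<open>Dodd solid ultrafilters and the use of their extenders\<close>

locale dodd = unif U X \<kappa> n for U X \<kappa> n :: "'v::zfc" +
  assumes dodd: "dodd_solid U"
begin

definition E :: 'v where "E = extender_below U idU"

lemma E_in: "E \<in> MU" using dodd unfolding dodd_solid_def E_def by blast

lemma nonprin: "ae U (\<lambda>y. y \<noteq> x)"
proof -
  have "\<not> ae U (\<lambda>y. y = x)"
  proof
    assume a: "ae U (\<lambda>y. y = x)"
    then have x: "x \<in> elts X" using ae_ex by blast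
    have "vset {x} \<in> elts U" by (subst ae_set) (use x a in auto)
    then show False using dodd x unfolding dodd_solid_def nonprincipal_def carrier_eq by blast
  qed
  then show ?thesis by (subst ae_not) (intro vdi)
qed

lemma E_eq: "E = vlam (vPow (finsubsets \<kappa>)) (\<lambda>A. vset {b. b \<in> elts (J A) \<and> finord UNIV b \<and> fless b idU})"
proof -
  have "elts (J A) \<inter> {b \<in> fin_ords. fin_less b idU} = {b. b \<in> elts (J A) \<and> finord UNIV b \<and> fless b idU}" for A
    unfolding fin_less_eq using fin_ords_iff by blast
  then show ?thesis unfolding E_def extender_below_def sp_eq[OF unif] by simp
qed

lemma E_fun: "vfun E (vPow (finsubsets \<kappa>))"
  unfolding E_eq by (rule vlam_vfun) (intro vdi dt_J)

lemma elts_E: assumes "elts A \<subseteq> elts (finsubsets \<kappa>)" shows "elts (ap E A) = {b \<in> elts (J A). fless b idU}"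
proof -
  have d: "dt (\<lambda>e. vset {b. b \<in> elts (J (e 0)) \<and> finord UNIV b \<and> fless b idU})" by (intro vdi dt_J)
  have "ap E A = vset {b. b \<in> elts (J A) \<and> finord UNIV b \<and> fless b idU}"
    unfolding E_eq by (rule ap_vlam[OF d]) (simp add: assms)
  moreover have "elts (vset {b \<in> elts (J A). finord UNIV b \<and> fless b idU}) = {b \<in> elts (J A). finord UNIV b \<and> fless b idU}"
    by (intro elts_vset small_sep vdi)
  moreover have "finord UNIV b" if "b \<in> elts (J A)" for b
  proof -
    have p: "pd (\<lambda>M e. \<forall>b\<in>elts (e 0). finord M b)" by (intro pdi)
    have "\<forall>b\<in>elts A. finord UNIV b" using assms finsubsets_finord[OF Ord_\<kappa>] by blast
    then have "\<forall>b\<in>elts (J A). finord MU b" using elem1[of "\<lambda>M a. \<forall>b\<in>elts a. finord M b", OF p] by blast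
    then show ?thesis using that finord_mono by blast
  qed
  ultimately show ?thesis by auto
qed

text \<open>\<open>A\<close> is an argument of the extender, hence a component of one of its pairs;
  the ultrapower is transitive and contains \<open>E\<close>.\<close>

lemma Pow_in: assumes "elts A \<subseteq> elts (finsubsets \<kappa>)" shows "A \<in> MU"
proof -
  have "vpair A (ap E A) \<in> elts E" by (rule vfun_pair[OF E_fun]) (simp add: assms)
  then show ?thesis using inner_model_vpairD[OF inner_model_MU E_in] by blast
qed

text \<open>Comparing seeds below \<open>[id]\<close> only takes the extender, which the ultrapower contains.\<close>

lemma seed_in:
  assumes D: "uf D XD" and sub: "elts XD \<subseteq> elts (finsubsets \<kappa>)" and s: "seed XD D U"
  shows "D \<in> MU"
proof -
  interpret D: uf D XD by (rule D)
  obtain Z where Z: "cc_ultrafilter_on MU (J XD) Z" "\<And>A. elts A \<subseteq> elts XD \<Longrightarrow> A \<in> elts D \<longleftrightarrow> J A \<in> elts Z"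
    "ae Z (\<lambda>b. fless b idU)" using s unfolding seed_def by blast
  interpret Z: emuf MU Z "J XD" by unfold_locales (rule inner_model_MU, rule Z(1))
  have p: "pd (\<lambda>M e. \<exists>u\<in>M. \<forall>A\<in>M. A \<in> elts u \<longleftrightarrow> elts A \<subseteq> elts (e 0) \<and> ae (e 2) (\<lambda>b. b \<in> elts (ap (e 1) A)))" by (intro pdi)
  have V: "\<exists>u\<in>UNIV. \<forall>A\<in>UNIV. A \<in> elts u \<longleftrightarrow> elts A \<subseteq> elts X \<and> ae Z (\<lambda>b. b \<in> elts (ap E A))" for X E Z :: 'v
  proof -
    have "small {A. elts A \<subseteq> elts X \<and> ae Z (\<lambda>b. b \<in> elts (ap E A))}"
      by (rule small_subset[of _ "vPow X"]) (intro vdi, auto)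
    then show ?thesis unfolding small_def by blast
  qed
  have XD: "XD \<in> MU" by (rule Pow_in[OF sub])
  obtain u where u: "u \<in> MU" "\<forall>A\<in>MU. A \<in> elts u \<longleftrightarrow> elts A \<subseteq> elts XD \<and> ae Z (\<lambda>b. b \<in> elts (ap E A))"
    using transfer3[of "\<lambda>M X E Z. \<exists>u\<in>M. \<forall>A\<in>M. A \<in> elts u \<longleftrightarrow> elts A \<subseteq> elts X \<and> ae Z (\<lambda>b. b \<in> elts (ap E A))", OF p inner_model_MU V XD E_in Z.U_M]
    by blast
  \<comment> \<open>\<open>ap E A\<close> is the part of \<open>J A\<close> below the seed, where
    \<open>Z\<close> concentrates, so \<open>Z\<close> treats both alike. \<open>E\<close> is an
    element of the ultrapower, so the right side can be evaluated there.\<close>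
  have key: "A \<in> elts D \<longleftrightarrow> ae Z (\<lambda>b. b \<in> elts (ap E A))" if A: "elts A \<subseteq> elts XD" for A
  proof -
    have e: "elts (ap E A) = {b \<in> elts (J A). fless b idU}" by (rule elts_E) (use A sub in blast)
    show ?thesis unfolding Z(2)[OF A]
    proof
      assume JA: "J A \<in> elts Z"
      obtain B where B: "B \<in> elts Z" "\<forall>b\<in>elts B. fless b idU" using Z(3) unfolding ae_def by blast
      have "vset {x \<in> elts (J A). x \<in> elts B} \<in> elts Z" using Z(1) JA B(1) unfolding cc_ultrafilter_on_iff by blast
      moreover have "elts (vset {x \<in> elts (J A). x \<in> elts B}) = {x \<in> elts (J A). x \<in> elts B}" by (intro elts_vset small_sep vdi)
      ultimately show "ae Z (\<lambda>b. b \<in> elts (ap E A))" unfolding ae_def e using B(2)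
        by (intro bexI[of _ "vset {x \<in> elts (J A). x \<in> elts B}"]) auto
    next
      assume "ae Z (\<lambda>b. b \<in> elts (ap E A))"
      then obtain B where B: "B \<in> elts Z" "\<forall>b\<in>elts B. b \<in> elts (ap E A)" unfolding ae_def by blast
      have "elts (J A) \<subseteq> elts (J XD)" using elem2[of "\<lambda>M x y. elts x \<subseteq> elts y" A XD] A by (simp add: pd_subset pt_var)
      then show "J A \<in> elts Z" using Z.up_M[OF B(1) J_in] B(2) e by blast
    qed
  qed
  have "D = u"
  proof (rule eltsI)
    fix A show "A \<in> elts D \<longleftrightarrow> A \<in> elts u"
      using key[of A] u(2) D.sub[of A] Pow_in[of A] sub inner_model_trans[OF inner_model_MU u(1), of A] by blast
  qed
  then show ?thesis using u(1) by simp
qed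

lemma fless_J_id: "fless (J b) idU \<longleftrightarrow> ae U (\<lambda>x. fless b x)"
proof -
  have p: "pd (\<lambda>M e. fless (e 0) (e 1))" by (intro pdi)
  show ?thesis unfolding J_cls id_cls los2[of "\<lambda>M. fless", OF p K_fun I_fun] by (rule ae_cong) simp
qed

lemma J_sing: "elts (J (vset {b})) = {J b}"
proof -
  have p: "pd (\<lambda>M e. e 0 = vset {e 1})" by (intro pdi)
  have "J (vset {b}) = vset {J b}" using elem2[of "\<lambda>M x y. x = vset {y}", OF p] by blast
  then show ?thesis by simp
qed

text \<open>\<open>J b\<close> is read off the value of the extender at \<open>{b}\<close>.\<close>

lemma J_restr:
  assumes sub: "elts L \<subseteq> elts (finsubsets \<kappa>)"
  obtains k where "k \<in> MU" "vfun k L" "\<And>b. b \<in> elts L \<Longrightarrow> ae U (\<lambda>x. fless b x) \<Longrightarrow> ap k b = J b"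
proof -
  have p: "pd (\<lambda>M e. \<exists>k\<in>M. vfun k (e 0) \<and> (\<forall>b\<in>elts (e 0). (\<exists>z\<in>elts (ap (e 1) (vset {b})). z = z) \<longrightarrow> ap k b \<in> elts (ap (e 1) (vset {b}))))"
    by (intro pdi)
  have V: "\<exists>k\<in>UNIV. vfun k L \<and> (\<forall>b\<in>elts L. (\<exists>z\<in>elts (ap E (vset {b})). z = z) \<longrightarrow> ap k b \<in> elts (ap E (vset {b})))" for L E :: 'v
  proof -
    have v: "vd (\<lambda>e. (\<exists>z\<in>elts (ap E (vset {e 0})). z = z) \<longrightarrow> e 1 \<in> elts (ap E (vset {e 0})))" by (intro vdi)
    show ?thesis
      by (rule choose_fun[of "\<lambda>b y. (\<exists>z\<in>elts (ap E (vset {b})). z = z) \<longrightarrow> y \<in> elts (ap E (vset {b}))" L, OF v]) blast+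
  qed
  obtain k where k: "k \<in> MU" "vfun k L" "\<forall>b\<in>elts L. (\<exists>z\<in>elts (ap E (vset {b})). z = z) \<longrightarrow> ap k b \<in> elts (ap E (vset {b}))"
    using transfer2[of "\<lambda>M L E. \<exists>k\<in>M. vfun k L \<and> (\<forall>b\<in>elts L. (\<exists>z\<in>elts (ap E (vset {b})). z = z) \<longrightarrow> ap k b \<in> elts (ap E (vset {b})))",
      OF p inner_model_MU V Pow_in[OF sub] E_in] by blast
  show ?thesis
  proof (rule that[OF k(1,2)])
    fix b assume b: "b \<in> elts L" "ae U (\<lambda>x. fless b x)"
    have "elts (ap E (vset {b})) = {z \<in> elts (J (vset {b})). fless z idU}" by (rule elts_E) (use sub b(1) in auto)
    then have "elts (ap E (vset {b})) = {J b}" unfolding J_sing using b(2) fless_J_id by auto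
    then show "ap k b = J b" using k(3) b(1) by auto
  qed
qed

text \<open>\<open>Z\<close> is to be the image of \<open>U\<close> under \<open>J\<close>. Since
  \<open>U\<close> is assumed to lie in the ultrapower and \<open>J_restr\<close> supplies
  \<open>J\<close> at almost all points, the image can be formed there.\<close>

lemma seed_self: assumes "U \<in> MU" shows "seed X U U"
proof -
  \<comment> \<open>Almost every \<open>b\<close> is sent below the seed. Otherwise almost all
    points are exceptions, and for the \<open>fless\<close>-least exception \<open>b\<close> almost
    every \<open>x\<close> is below \<open>b\<close>, as nonprincipality excludes equality; some
    exception would be below the least one.\<close>
  have S: "ae U (\<lambda>b. ae U (\<lambda>x. fless b x))"
  proof (rule ccontr)
    assume "\<not> ?thesis"
    then have T: "ae U (\<lambda>b. \<not> ae U (\<lambda>x. fless b x))" by (subst ae_not) (intro vdi)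
    then obtain b0 where b0: "b0 \<in> elts X" "\<not> ae U (\<lambda>x. fless b0 x)" using ae_ex by blast
    have v: "vd (\<lambda>e. \<not> ae U (\<lambda>x. fless (e 0) x))" by (intro vdi)
    obtain b where b: "b \<in> elts X" "\<not> ae U (\<lambda>x. fless b x)" "\<And>y. y \<in> elts X \<Longrightarrow> \<not> ae U (\<lambda>x. fless y x) \<Longrightarrow> \<not> fless y b"
      using wf_rel_min[OF fless_wf[OF X_hm] v b0] by blast
    have nb: "ae U (\<lambda>x. \<not> fless b x)" using b(2) by (subst ae_not) (intro vdi)
    have "ae U (\<lambda>x. fless x b)"
      by (rule ae_mp[OF nb nonprin[of b]]) (use fless_linear[OF X_hm[OF b(1)] X_hm] in blast)
    from ae_ex[OF ae_conj[OF T this]] b(3) show False by blast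
  qed
  obtain k where k: "k \<in> MU" "vfun k X" "\<And>b. b \<in> elts X \<Longrightarrow> ae U (\<lambda>x. fless b x) \<Longrightarrow> ap k b = J b"
    using J_restr[OF X_fin] by blast
  show ?thesis
  proof (rule seed_of_push[OF uf_axioms cc_restrict[OF uf assms] k(1,2)])
    show "elts X \<noteq> {}" using ae_ex[OF ae_carrier] by blast
    show "ae U (\<lambda>y. ap k y \<in> elts (J X))" by (rule ae_mono[OF S]) (simp add: k(3) J_mem)
    show "ae U (\<lambda>y. fless (ap k y) idU)" by (rule ae_mono[OF S]) (simp add: k(3) fless_J_id)
    show "(A \<in> elts U) = ae U (\<lambda>y. ap k y \<in> elts (J A))" if "elts A \<subseteq> elts X" for A
    proof -
      have "ae U (\<lambda>y. y \<in> elts A) = ae U (\<lambda>y. ap k y \<in> elts (J A))"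
      proof
        assume "ae U (\<lambda>y. y \<in> elts A)"
        from S this show "ae U (\<lambda>y. ap k y \<in> elts (J A))" by (rule ae_mp) (simp add: k(3) J_mem)
      next
        assume "ae U (\<lambda>y. ap k y \<in> elts (J A))"
        from S this show "ae U (\<lambda>y. y \<in> elts A)" by (rule ae_mp) (simp add: k(3) J_mem)
      qed
      then show ?thesis using ae_set[OF that] by simp
    qed
  qed
qed

text \<open>The one-element set of \<open>U\<close> must have a Ketonen-minimal member, so
  \<open>ketonen U U\<close> is impossible.\<close>

lemma not_self: "U \<notin> MU"
proof
  assume "U \<in> MU"
  then have "ketonen U U" using seed_ketonen[OF uf_axioms uf_axioms seed_self] by blast
  moreover have "\<exists>m\<in>elts (vset {U}). \<forall>V\<in>elts (vset {U}). \<not> ketonen V m"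
    by (rule ketonen_wf[of X _ U]) (use X_hm uf carrier_eq in auto)
  ultimately show False by simp
qed

end

lemma doddE: assumes "dodd_solid U" obtains X \<kappa> n where "dodd U X \<kappa> n"
proof -
  obtain \<kappa> n where u: "uniform_on \<kappa> n U" using assms unfolding dodd_solid_def uniform_ultrafilter_def by blast
  then have "cc_ultrafilter_on UNIV (nsubsets \<kappa> n) U" unfolding uniform_on_def by blast
  then have "dodd U (nsubsets \<kappa> n) \<kappa> n" using u assms by unfold_locales simp_all
  then show ?thesis by (rule that)
qed

section \<open>Closure properties of ultrapowers\<close>

context uf
begin

lemma J_Ord: "Ord (J \<alpha>) = Ord \<alpha>"
proof -
  have p: "pd (\<lambda>M e. Ord (e 0))" by (intro pdi)
  show ?thesis by (rule elem1[of "\<lambda>M. Ord", OF p])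
qed

lemma J_subset: "elts (J A) \<subseteq> elts (J B) \<longleftrightarrow> elts A \<subseteq> elts B"
proof -
  have p: "pd (\<lambda>M e. elts (e 0) \<subseteq> elts (e 1))" by (intro pdi)
  show ?thesis by (rule elem2[of "\<lambda>M x y. elts x \<subseteq> elts y", OF p])
qed

lemma J_fless: "fless (J a) (J b) \<longleftrightarrow> fless a b"
proof -
  have p: "pd (\<lambda>M e. fless (e 0) (e 1))" by (intro pdi)
  show ?thesis by (rule elem2[of "\<lambda>M. fless", OF p])
qed

lemma J_ge: assumes "Ord \<alpha>" shows "\<alpha> = J \<alpha> \<or> \<alpha> \<in> elts (J \<alpha>)"
proof -
  have "J \<alpha> \<notin> elts \<alpha>"
  proof
    assume a: "J \<alpha> \<in> elts \<alpha>"
    have v: "vd (\<lambda>e. J (e 0) \<in> elts (e 0))" by (intro vdi dt_J)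
    obtain m where m: "J m \<in> elts m" "\<And>y. y \<in> elts m \<Longrightarrow> \<not> J y \<in> elts y"
      using mem_min[of "\<lambda>\<alpha>. J \<alpha> \<in> elts \<alpha>", OF v a] by blast
    have "J (J m) \<in> elts (J m)" unfolding J_mem by (rule m(1))
    then show False using m by blast
  qed
  then show ?thesis using Ord_linear[OF assms, of "J \<alpha>"] assms J_Ord by blast
qed

lemma J_v0: "J v0 = v0"
proof -
  have p: "pd (\<lambda>M e. e 0 = v0)" by (intro pdi)
  show ?thesis using elem1[of "\<lambda>M x. x = v0", OF p] by blast
qed

lemma J_omega: "J omega = omega"
proof -
  have p: "pd (\<lambda>M e. e 0 = omega)" by (intro pdi)
  show ?thesis using elem1[of "\<lambda>M x. x = omega", OF p] by blast
qed

lemma J_vsucc: "J (vsucc n) = vsucc (J n)"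
proof -
  have p: "pd (\<lambda>M e. e 0 = vsucc (e 1))" by (intro pdi)
  show ?thesis using elem2[of "\<lambda>M x y. x = vsucc y", OF p] by blast
qed

lemma J_natural: "natural n \<Longrightarrow> J n = n"
proof (induction n rule: natural_induct)
  case dfn show ?case by (intro vdi dt_J)
qed (simp_all add: J_v0 J_vsucc)

text \<open>If the class of \<open>f\<close> belonged to \<open>J c\<close> without being one of the
  \<open>J (ap s n)\<close>, then \<open>ae_nat\<close> would provide a single \<open>x\<close> with
  \<open>ap f x\<close> in \<open>c\<close> but different from every \<open>ap s n\<close>.\<close>

lemma J_countable:
  assumes c: "elts c = ap s ` elts omega" shows "elts (J c) = J ` elts c"
proof (intro set_eqI iffI)
  fix y assume y: "y \<in> elts (J c)"
  then have "y \<in> MU" using Ult_trans[OF J_in] by blast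
  then obtain f where f: "vfun f X" "y = cls f" using UltE by blast
  have fc: "ae U (\<lambda>x. ap f x \<in> elts c)"
    using y unfolding f(2) J_cls cls_mem[OF UNIV_I f(1) UNIV_I K_fun] by (rule ae_mono) simp
  have "\<exists>n. natural n \<and> ae U (\<lambda>x. ap f x = ap s n)"
  proof (rule ccontr)
    assume n: "\<not> ?thesis"
    have v: "vd (\<lambda>e. ap f (e 1) \<noteq> ap s (e 0))" by (intro vdi)
    have "ae U (\<lambda>x. \<forall>n. natural n \<longrightarrow> ap f x \<noteq> ap s n)"
    proof (rule ae_nat[OF v])
      fix m :: 'v assume "natural m"
      then have "\<not> ae U (\<lambda>x. ap f x = ap s m)" using n by blast
      then show "ae U (\<lambda>x. ap f x \<noteq> ap s m)" by (subst ae_not) (intro vdi)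
    qed
    from ae_ex[OF ae_conj[OF this fc]] show False unfolding c by auto
  qed
  then obtain n where n: "natural n" "ae U (\<lambda>x. ap f x = ap s n)" by blast
  have "ae U (\<lambda>x. ap f x = ap (K (ap s n)) x)" by (rule ae_mono[OF n(2)]) simp
  then have "y = J (ap s n)" unfolding f(2) J_cls cls_eq[OF UNIV_I f(1) UNIV_I K_fun] .
  then show "y \<in> J ` elts c" using n(1) c by auto
qed (auto simp: J_mem)

lemma J_finite:
  assumes n: "natural n" and c: "elts c = ap s ` elts n" shows "elts (J c) = J ` elts c"
proof (cases "c = v0")
  case True then show ?thesis by (simp add: J_v0)
next
  case False
  then obtain x where x: "x \<in> elts c" using empty_v0[of c] by blast
  \<comment> \<open>The finite enumeration is padded with an element of \<open>c\<close> to an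
    enumeration by all naturals; hence the separate case of the empty set.\<close>
  define F where "F m = (if m \<in> elts n then ap s m else x)" for m
  have dF: "dt (\<lambda>e. F (e 0))" unfolding F_def by (intro vdi)
  have "ap (vlam omega F) m = F m" if "natural m" for m using that by (simp add: dF)
  then have "ap (vlam omega F) ` elts omega = F ` elts omega" by (intro image_cong) auto
  also have "\<dots> = elts c" using c x natural_in[OF n] unfolding F_def by (auto simp: image_iff)
  finally show ?thesis by (rule J_countable[OF sym])
qed

text \<open>A sequence \<open>s\<close> of elements \<open>[f\<^sub>a]\<close> of the ultrapower equals \<open>a \<mapsto> J(f)(J(a))(id)\<close>.\<close>

lemma closure:
  assumes L: "L \<in> MU" and k: "k \<in> MU" and s: "\<And>a. a \<in> elts L \<Longrightarrow> ap s a \<in> MU"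
  obtains s' where "s' \<in> MU" "vfun s' L" "\<And>a. a \<in> elts L \<Longrightarrow> ap k a = J a \<Longrightarrow> ap s' a = ap s a"
proof -
  have v: "vd (\<lambda>e. collapses_to UNIV X U (e 1) (ap s (e 0)))" by (intro vdi)
  have ex: "\<exists>f. collapses_to UNIV X U f (ap s a)" if "a \<in> elts L" for a
    using UltE[OF s[OF that]] cls_collapses_to by metis
  obtain G where G: "vfun G L" "\<And>a. a \<in> elts L \<Longrightarrow> collapses_to UNIV X U (ap G a) (ap s a)"
    by (rule choose_fun[of "\<lambda>a f. collapses_to UNIV X U f (ap s a)" L, OF v ex]) blast+
  have p: "pd (\<lambda>M e. \<exists>s\<in>M. vfun s (e 0) \<and> (\<forall>a\<in>elts (e 0). ap s a = ap (ap (e 1) (ap (e 2) a)) (e 3)))" by (intro pdi)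
  have V: "\<exists>s\<in>UNIV. vfun s L \<and> (\<forall>a\<in>elts L. ap s a = ap (ap G (ap k a)) i)" for L G k i :: 'v
  proof -
    have d: "dt (\<lambda>e. ap (ap G (ap k (e 0))) i)" by (intro vdi)
    show ?thesis by (rule bexI[of _ "vlam L (\<lambda>a. ap (ap G (ap k a)) i)"]) (simp_all add: vlam_vfun[OF d] ap_vlam[OF d])
  qed
  obtain s' where s': "s' \<in> MU" "vfun s' L" "\<forall>a\<in>elts L. ap s' a = ap (ap (J G) (ap k a)) idU"
    using transfer4[of "\<lambda>M L G k i. \<exists>s\<in>M. vfun s L \<and> (\<forall>a\<in>elts L. ap s a = ap (ap G (ap k a)) i)", OF p inner_model_MU V L J_in k id_in]
    by blast
  show ?thesis
  proof (rule that[OF s'(1,2)])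
    fix a assume a: "a \<in> elts L" "ap k a = J a"
    have "ap s' a = ap (J (ap G a)) idU" using s'(3) a J_ap[OF G(1) a(1)] by simp
    also have "\<dots> = ap s a" using cls_rep[OF collapses_to_fn[OF G(2)[OF a(1)]]] cls_eqI[OF G(2)[OF a(1)]] by simp
    finally show "ap s' a = ap s a" .
  qed
qed

lemma closure_all:
  assumes "L \<in> MU" "k \<in> MU" "\<And>a. a \<in> elts L \<Longrightarrow> ap k a = J a" "vfun s L" "\<And>a. a \<in> elts L \<Longrightarrow> ap s a \<in> MU"
  shows "s \<in> MU"
proof -
  obtain s' where s': "s' \<in> MU" "vfun s' L" "\<And>a. a \<in> elts L \<Longrightarrow> ap k a = J a \<Longrightarrow> ap s' a = ap s a"
    using closure[of L k s] assms(1,2,5) by blast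
  have "s = s'" by (rule vfun_ext[OF assms(4) s'(2)]) (simp add: s'(3) assms(3))
  then show ?thesis using s'(1) by simp
qed

lemma closure_fixed:
  assumes "L \<in> MU" "\<And>a. a \<in> elts L \<Longrightarrow> J a = a" "vfun s L" "\<And>a. a \<in> elts L \<Longrightarrow> ap s a \<in> MU"
  shows "s \<in> MU"
proof -
  have p: "pd (\<lambda>M e. \<exists>k\<in>M. \<forall>a\<in>elts (e 0). ap k a = a)" by (intro pdi)
  have V: "\<exists>k\<in>UNIV. \<forall>a\<in>elts L. ap k a = a" for L :: 'v
  proof -
    have d: "dt (\<lambda>e. e 0)" by (intro vdi)
    show ?thesis by (rule bexI[of _ "vlam L (\<lambda>a. a)"]) (simp_all add: ap_vlam[OF d])
  qed
  obtain k where k: "k \<in> MU" "\<forall>a\<in>elts L. ap k a = a"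
    using transfer1[of "\<lambda>M L. \<exists>k\<in>M. \<forall>a\<in>elts L. ap k a = a", OF p inner_model_MU V assms(1)] by blast
  show ?thesis by (rule closure_all[OF assms(1) k(1) _ assms(3,4)]) (simp add: k(2) assms(2))
qed

text \<open>\<open>J\<close> fixes the natural \<open>n\<close> and all its elements, so
  \<open>closure_fixed\<close> places the enumeration of \<open>b\<close> in the ultrapower.\<close>

lemma finord_MU: assumes "b \<in> MU" "finord UNIV b" shows "finord MU b"
proof -
  obtain n f where n: "natural n" "bij_fun f n b" using assms(2) unfolding finord_def by auto
  have "J n = n" by (rule J_natural[OF n(1)])
  then have "n \<in> MU" using J_in[of n] by simp
  moreover have "J a = a" if "a \<in> elts n" for a using J_natural natural_in[OF n(1) that] by blast
  moreover have "ap f a \<in> MU" if "a \<in> elts n" for a using n(2) that Ult_trans[OF assms(1)] unfolding bij_fun_def by blast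
  moreover have "vfun f n" using n(2) unfolding bij_fun_def by blast
  ultimately have "f \<in> MU" by (intro closure_fixed[of n f])
  then show ?thesis using assms(2) n unfolding finord_def by auto
qed

text \<open>The collapse along the wellorder \<open>fless\<close> recovers \<open>J\<close> on \<open>L\<close> from its range.\<close>

lemma J_restr_range:
  assumes L: "L \<in> MU" "\<And>b. b \<in> elts L \<Longrightarrow> finord UNIV b" and R: "R \<in> MU" "elts R = J ` elts L"
  obtains k where "k \<in> MU" "\<And>b. b \<in> elts L \<Longrightarrow> ap k b = J b"
proof -
  let ?C = "\<lambda>M R p. vfun p R \<and> (\<forall>b\<in>elts R. (\<forall>y\<in>elts (ap p b). \<exists>d\<in>elts R. fless d b \<and> y = ap p d) \<and>
      (\<forall>d\<in>elts R. fless d b \<longrightarrow> ap p d \<in> elts (ap p b)))"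
  have p: "pd (\<lambda>M e. (\<forall>b\<in>elts (e 0). finord M b) \<longrightarrow> (\<exists>p\<in>M. ?C M (e 0) p))" by (intro pdi)
  have V: "(\<forall>b\<in>elts R. finord UNIV b) \<longrightarrow> (\<exists>p\<in>UNIV. ?C UNIV R p)" for R :: 'v
  proof
    assume f: "\<forall>b\<in>elts R. finord UNIV b"
    have wf: "wf_rel R fless" using f finord_hm by (intro fless_wf) blast
    define G where "G g r = vset (ap r ` elts (vset {h \<in> elts R. fless h g}))" for g r
    have dG: "dt (\<lambda>e. G (e 0) (e 1))" unfolding G_def by (intro vdi)
    have vl: "vd (\<lambda>e. fless (e 0) (e 1))" by (intro vdi)
    obtain p where p: "vfun p R" "\<And>g. g \<in> elts R \<Longrightarrow> ap p g = G g (vlam (vset {h \<in> elts R. fless h g}) (ap p))"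
      using wf_rec[OF wf vl dG] by blast
    have pe: "elts (ap p g) = ap p ` {h \<in> elts R. fless h g}" if "g \<in> elts R" for g
    proof -
      have 1: "elts (vset {h \<in> elts R. fless h g}) = {h \<in> elts R. fless h g}" by (intro elts_vset small_sep vdi)
      have d: "dt (\<lambda>e. ap p (e 0))" by (intro vdi)
      have "ap (vlam (vset {h \<in> elts R. fless h g}) (ap p)) ` {h \<in> elts R. fless h g} = ap p ` {h \<in> elts R. fless h g}"
        using ap_vlam[of "ap p" _ "vset {h \<in> elts R. fless h g}", OF d] unfolding 1 by (rule image_cong[OF refl])
      moreover have "small (ap p ` {h \<in> elts R. fless h g})" using small_image[OF d, of "vset {h \<in> elts R. fless h g}"] unfolding 1 .
      ultimately show ?thesis unfolding p(2)[OF that] G_def 1 by simp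
    qed
    have "?C UNIV R p" using p(1) pe by auto
    then show "\<exists>p\<in>UNIV. ?C UNIV R p" by blast
  qed
  have fL: "\<forall>b\<in>elts L. finord MU b" using L(2) finord_MU Ult_trans[OF L(1)] by blast
  have fR: "\<forall>b\<in>elts R. finord MU b"
  proof
    fix b assume b: "b \<in> elts R"
    then obtain c where c: "c \<in> elts L" "b = J c" unfolding R(2) by blast
    have p: "pd (\<lambda>M e. finord M (e 0))" by (intro pdi)
    show "finord MU b" unfolding c(2) elem1[of finord, OF p] by (rule L(2)[OF c(1)])
  qed
  obtain q where q: "q \<in> MU" "?C MU R q"
    using transfer1[of "\<lambda>M R. (\<forall>b\<in>elts R. finord M b) \<longrightarrow> (\<exists>p\<in>M. ?C M R p)", OF p inner_model_MU V R(1)] fR by blast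
  obtain q0 where q0: "q0 \<in> MU" "?C MU L q0"
    using transfer1[of "\<lambda>M R. (\<forall>b\<in>elts R. finord M b) \<longrightarrow> (\<exists>p\<in>M. ?C M R p)", OF p inner_model_MU V L(1)] fL by blast
  have hmL: "\<And>b. b \<in> elts L \<Longrightarrow> has_maxima b" using L(2) finord_hm by blast
  have wfL: "wf_rel L fless" by (rule fless_wf[OF hmL])
  \<comment> \<open>\<open>J\<close> is an isomorphism of \<open>L\<close> and \<open>R\<close> for
    \<open>fless\<close>, so the collapse \<open>q\<close> of \<open>R\<close> composed with
    \<open>J\<close> is the collapse \<open>q0\<close> of \<open>L\<close>. Both collapses lie in
    the ultrapower, and inverting \<open>q\<close> there recovers \<open>J\<close>.\<close>
  have eq: "ap q (J b) = ap q0 b" if "b \<in> elts L" for b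
  proof (rule wf_rel_induct[OF wfL _ that])
    show "vd (\<lambda>e. ap q (J (e 0)) = ap q0 (e 0))" by (intro vdi dt_J)
    fix g assume g: "g \<in> elts L" and IH: "\<And>h. h \<in> elts L \<Longrightarrow> fless h g \<Longrightarrow> ap q (J h) = ap q0 h"
    have Jg: "J g \<in> elts R" using g R(2) by blast
    show "ap q (J g) = ap q0 g"
    proof (rule eltsI, rule iffI)
      fix y assume "y \<in> elts (ap q (J g))"
      then obtain d where d: "d \<in> elts R" "fless d (J g)" "y = ap q d" using q(2) Jg by blast
      from d(1) obtain c where c0: "c \<in> elts L" "d = J c" unfolding R(2) by blast
      have c: "c \<in> elts L" "fless (J c) (J g)" "y = ap q (J c)" using c0 d(2,3) by simp_all
      have "y = ap q0 c" using IH[OF c(1)] c(2,3) J_fless by simp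
      then show "y \<in> elts (ap q0 g)" using q0(2) g c(1,2) J_fless by blast
    next
      fix y assume "y \<in> elts (ap q0 g)"
      then obtain c where c: "c \<in> elts L" "fless c g" "y = ap q0 c" using q0(2) g by blast
      have "y = ap q (J c)" using IH[OF c(1,2)] c(3) by simp
      moreover have "J c \<in> elts R" "fless (J c) (J g)" using c(1,2) R(2) J_fless by blast+
      ultimately show "y \<in> elts (ap q (J g))" using q(2) Jg by blast
    qed
  qed
  have inj: "b = c" if "b \<in> elts L" "c \<in> elts L" "ap q0 b = ap q0 c" for b c
  proof (rule ccontr)
    assume "b \<noteq> c"
    then have "fless b c \<or> fless c b" using fless_linear[OF hmL[OF that(1)] hmL[OF that(2)]] by blast
    then have "ap q0 b \<in> elts (ap q0 c) \<or> ap q0 c \<in> elts (ap q0 b)" using q0(2) that(1,2) by blast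
    then show False using that(3) by simp
  qed
  have p: "pd (\<lambda>M e. (\<forall>b\<in>elts (e 0). \<exists>c\<in>elts (e 1). ap (e 2) c = ap (e 3) b) \<longrightarrow>
      (\<exists>k\<in>M. \<forall>b\<in>elts (e 0). ap k b \<in> elts (e 1) \<and> ap (e 2) (ap k b) = ap (e 3) b))" by (intro pdi)
  have V: "(\<forall>b\<in>elts L. \<exists>c\<in>elts R. ap q c = ap q0 b) \<longrightarrow>
      (\<exists>k\<in>UNIV. \<forall>b\<in>elts L. ap k b \<in> elts R \<and> ap q (ap k b) = ap q0 b)" for L R q q0 :: 'v
  proof
    assume e: "\<forall>b\<in>elts L. \<exists>c\<in>elts R. ap q c = ap q0 b"
    have v: "vd (\<lambda>e. e 1 \<in> elts R \<and> ap q (e 1) = ap q0 (e 0))" by (intro vdi)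
    show "\<exists>k\<in>UNIV. \<forall>b\<in>elts L. ap k b \<in> elts R \<and> ap q (ap k b) = ap q0 b"
      by (rule choose_fun[of "\<lambda>b c. c \<in> elts R \<and> ap q c = ap q0 b" L, OF v]) (use e in blast)+
  qed
  have "\<exists>c\<in>elts R. ap q c = ap q0 b" if "b \<in> elts L" for b
    by (rule bexI[of _ "J b"], rule eq[OF that]) (use that R(2) in blast)
  then obtain k where k: "k \<in> MU" "\<forall>b\<in>elts L. ap k b \<in> elts R \<and> ap q (ap k b) = ap q0 b"
    using transfer4[of "\<lambda>M L R q q0. (\<forall>b\<in>elts L. \<exists>c\<in>elts R. ap q c = ap q0 b) \<longrightarrow>
      (\<exists>k\<in>M. \<forall>b\<in>elts L. ap k b \<in> elts R \<and> ap q (ap k b) = ap q0 b)", OF p inner_model_MU V L(1) R(1) q(1) q0(1)] by blast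
  show ?thesis
  proof (rule that[OF k(1)])
    fix b assume b: "b \<in> elts L"
    then have "ap k b \<in> elts R" using k(2) by blast
    then obtain c where c: "c \<in> elts L" "ap k b = J c" unfolding R(2) by blast
    have "ap q (ap k b) = ap q0 b" using k(2) b by blast
    then have "ap q0 c = ap q0 b" unfolding c(2) eq[OF c(1)] .
    then show "ap k b = J b" using inj[OF c(1) b] c(2) by simp
  qed
qed

end

section \<open>Kunen's inconsistency for ultrapowers\<close>

definition tail_eq :: "'v::zfc \<Rightarrow> 'v \<Rightarrow> bool" where
  "tail_eq t t' \<longleftrightarrow> (\<exists>m\<in>elts omega. \<forall>n\<in>elts omega. m \<in> elts n \<longrightarrow> ap t n = ap t' n)"

lemma vd_tail_eq [vdi]: "dt S \<Longrightarrow> dt T \<Longrightarrow> vd (\<lambda>e. tail_eq (S e) (T e))"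
  by (rule vd_pred2[where P = tail_eq]) (unfold tail_eq_def, intro vdi)

lemma tail_eq_refl: "tail_eq t t" unfolding tail_eq_def using natural_v0 by auto
lemma tail_eq_sym: "tail_eq t t' \<Longrightarrow> tail_eq t' t" unfolding tail_eq_def by fastforce
lemma tail_eq_trans: assumes "tail_eq t t'" "tail_eq t' t''" shows "tail_eq t t''"
proof -
  obtain m m' where m: "natural m" "natural m'" "\<And>n. natural n \<Longrightarrow> m \<in> elts n \<Longrightarrow> ap t n = ap t' n"
    "\<And>n. natural n \<Longrightarrow> m' \<in> elts n \<Longrightarrow> ap t' n = ap t'' n"
    using assms unfolding tail_eq_def by auto
  have o: "Ord m" "Ord m'" using m(1,2) natural_iff by blast+
  define k where "k = (if m \<in> elts m' then m' else m)"
  have k: "natural k" "m = k \<or> m \<in> elts k" "m' = k \<or> m' \<in> elts k"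
    using m(1,2) Ord_linear[OF o] by (auto simp: k_def)
  have "m \<in> elts n" "m' \<in> elts n" if "natural n" "k \<in> elts n" for n
    using k(2,3) that Ord_trans[of n k] natural_iff by blast+
  then have "ap t n = ap t'' n" if "natural n" "k \<in> elts n" for n using m(3,4) that by auto
  then show ?thesis unfolding tail_eq_def using k(1) by auto
qed

text \<open>A choice function \<open>g\<close> on the quotient modulo equality of tails provides the
  representatives.\<close>

lemma tail_selector:
  obtains r where "vfun r (vfuns omega L)"
    "\<And>t. t \<in> elts (vfuns omega L) \<Longrightarrow> ap r t \<in> elts (vfuns omega L) \<and> tail_eq (ap r t) t"
    "\<And>t t'. t \<in> elts (vfuns omega L) \<Longrightarrow> t' \<in> elts (vfuns omega L) \<Longrightarrow> tail_eq t t' \<Longrightarrow> ap r t = ap r t'"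
proof -
  let ?T = "vfuns omega L"
  define cl where "cl t = vset {u \<in> elts ?T. tail_eq u t}" for t
  have cl: "elts (cl t) = {u \<in> elts ?T. tail_eq u t}" for t unfolding cl_def by (intro elts_vset small_sep vdi)
  have dcl: "dt (\<lambda>e. cl (S e))" if "dt S" for S by (rule dt_fun[OF _ that]) (unfold cl_def, intro vdi)
  define Q where "Q = vset (cl ` elts ?T)"
  have Q: "elts Q = cl ` elts ?T" unfolding Q_def by (intro elts_vset small_image dcl vdi)
  have d: "dt (\<lambda>e. e 0)" by (intro vdi)
  obtain g where g: "vfun g Q" "\<And>c. c \<in> elts Q \<Longrightarrow> ap g c \<in> elts c"
  proof -
    have "elts c \<noteq> {}" if "c \<in> elts Q" for c using that tail_eq_refl unfolding Q using cl by blast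
    from set_choice[OF d this] show ?thesis using that by blast
  qed
  have dr: "dt (\<lambda>e. ap g (cl (e 0)))" by (intro vdi dcl)
  define r where "r = vlam ?T (\<lambda>t. ap g (cl t))"
  have r: "vfun r ?T" "\<And>t. t \<in> elts ?T \<Longrightarrow> ap r t = ap g (cl t)"
    unfolding r_def by (rule vlam_vfun[OF dr], rule ap_vlam[OF dr])
  show ?thesis
  proof (rule that[OF r(1)])
    fix t assume t: "t \<in> elts ?T"
    then have "ap g (cl t) \<in> elts (cl t)" using g(2) Q by blast
    then show "ap r t \<in> elts ?T \<and> tail_eq (ap r t) t" unfolding r(2)[OF t] cl by blast
  next
    fix t t' assume t: "t \<in> elts ?T" "t' \<in> elts ?T" "tail_eq t t'"
    have "elts (cl t) = elts (cl t')" unfolding cl using tail_eq_trans tail_eq_sym t(3) by blast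
    then have "cl t = cl t'" by (rule extensionality)
    then show "ap r t = ap r t'" using r(2) t(1,2) by simp
  qed
qed

text \<open>The model \<open>M\<close> believes that \<open>B\<close> has at least the cardinality
  of \<open>L\<close>; stated through an injection, so that no cardinals are needed.\<close>

definition big :: "'v::zfc set \<Rightarrow> 'v \<Rightarrow> 'v \<Rightarrow> bool" where
  "big M L B \<longleftrightarrow> (\<exists>g\<in>M. vfun g L \<and> (\<forall>x\<in>elts L. ap g x \<in> elts B) \<and> (\<forall>x\<in>elts L. \<forall>y\<in>elts L. ap g x = ap g y \<longrightarrow> x = y))"

definition jonsson :: "'v::zfc set \<Rightarrow> 'v \<Rightarrow> 'v \<Rightarrow> 'v \<Rightarrow> bool" where
  "jonsson M L r A \<longleftrightarrow> (\<forall>B\<in>M. elts B \<subseteq> elts A \<and> big M L B \<longrightarrow> (\<forall>a\<in>elts A. \<exists>t\<in>M. vfun t omega \<and>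
      (\<forall>n\<in>elts omega. ap t n \<in> elts B) \<and> (\<exists>n\<in>elts omega. ap (ap r t) n = a)))"

lemma pd_big [pdi]: "pt S \<Longrightarrow> pt T \<Longrightarrow> pd (\<lambda>M e. big M (S M e) (T M e))"
  by (rule pd_pred2[of big]) (unfold big_def, intro pdi)
lemma pd_jonsson: "pd (\<lambda>M e. jonsson M (e 0) (e 1) (e 2))"
  unfolding jonsson_def by (intro pdi)
lemma vd_big [vdi]: "dt S \<Longrightarrow> dt T \<Longrightarrow> vd (\<lambda>e. big UNIV (S e) (T e))"
  by (rule vd_pd2[of big]) (intro pdi)

text \<open>The function \<open>n \<mapsto> r(t)(n)\<close> plays the role of an \<open>\<omega>\<close>-Jonsson function (Galvin and Prikry):
  otherwise there are \<open>A\<^sub>0 \<supseteq> A\<^sub>1 \<supseteq> \<dots>\<close> and \<open>\<alpha>\<^sub>n \<in> A\<^sub>n\<close> omitted by \<open>r(t)\<close> for all sequences \<open>t\<close> in \<open>A\<^sub>n\<^sub>+\<^sub>1\<close>; but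
  \<open>r(\<alpha>)\<close> is eventually equal to \<open>\<alpha>\<close>, and to a sequence in \<open>A\<^sub>n\<^sub>+\<^sub>1\<close>.\<close>

lemma jonsson_ex:
  assumes r: "\<And>t. t \<in> elts (vfuns omega L) \<Longrightarrow> ap r t \<in> elts (vfuns omega L) \<and> tail_eq (ap r t) t"
    "\<And>t t'. t \<in> elts (vfuns omega L) \<Longrightarrow> t' \<in> elts (vfuns omega L) \<Longrightarrow> tail_eq t t' \<Longrightarrow> ap r t = ap r t'"
  shows "\<exists>A. elts A \<subseteq> elts L \<and> big UNIV L A \<and> jonsson UNIV L r A"
proof (rule ccontr)
  assume n: "\<not> ?thesis"
  define omits where "omits a B \<longleftrightarrow> (\<forall>t. vfun t omega \<and> (\<forall>n\<in>elts omega. ap t n \<in> elts B) \<longrightarrow> (\<forall>n\<in>elts omega. ap (ap r t) n \<noteq> a))" for a B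
  have vom [vdi]: "vd (\<lambda>e. omits (S e) (T e))" if "dt S" "dt T" for S T
    by (rule vd_pred2[OF _ that]) (unfold omits_def, intro vdi)
  define SA where "SA = vset {A. elts A \<subseteq> elts L \<and> big UNIV L A}"
  have SA: "elts SA = {A. elts A \<subseteq> elts L \<and> big UNIV L A}" unfolding SA_def
    by (intro elts_vset small_subset[of _ "vPow L"]) (intro vdi, auto)
  have v: "vd (\<lambda>e. e 1 \<in> elts SA \<and> elts (e 1) \<subseteq> elts (e 0) \<and> (\<exists>a\<in>elts (e 0). omits a (e 1)))" by (intro vdi)
  have ex: "\<exists>B. B \<in> elts SA \<and> elts B \<subseteq> elts A \<and> (\<exists>a\<in>elts A. omits a B)" if A: "A \<in> elts SA" for A
  proof -
    have "\<not> jonsson UNIV L r A" using n A unfolding SA by blast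
    then obtain B a where B: "elts B \<subseteq> elts A" "big UNIV L B" "a \<in> elts A" "omits a B"
      unfolding jonsson_def omits_def by blast
    moreover have "elts B \<subseteq> elts L" using A B(1) unfolding SA by blast
    ultimately show ?thesis unfolding SA by blast
  qed
  obtain c where c: "vfun c SA" "\<And>A. A \<in> elts SA \<Longrightarrow> ap c A \<in> elts SA \<and> elts (ap c A) \<subseteq> elts A \<and> (\<exists>a\<in>elts A. omits a (ap c A))"
    by (rule choose_fun[of "\<lambda>A B. B \<in> elts SA \<and> elts B \<subseteq> elts A \<and> (\<exists>a\<in>elts A. omits a B)" SA, OF v ex]) blast+
  have dc: "dt (\<lambda>e. ap c (e 1))" by (intro vdi)
  obtain s where s: "ap s v0 = L" "\<And>n. natural n \<Longrightarrow> ap s (vsucc n) = ap c (ap s n)"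
    using omega_rec[of "\<lambda>_ x. ap c x" L, OF dc] by blast
  have "big UNIV L L" unfolding big_def
  proof -
    have d: "dt (\<lambda>e. e 0)" by (intro vdi)
    show "\<exists>g\<in>UNIV. vfun g L \<and> (\<forall>x\<in>elts L. ap g x \<in> elts L) \<and> (\<forall>x\<in>elts L. \<forall>y\<in>elts L. ap g x = ap g y \<longrightarrow> x = y)"
      by (rule bexI[of _ "vlam L (\<lambda>x. x)"]) (simp_all add: vlam_vfun[OF d] ap_vlam[OF d])
  qed
  then have LS: "L \<in> elts SA" by (simp add: SA)
  have sA: "ap s n \<in> elts SA" if "natural n" for n using that
  proof (induction n rule: natural_induct)
    case dfn show ?case by (intro vdi)
  qed (use s LS c in auto)
  have dec: "\<forall>m\<in>elts n. elts (ap s n) \<subseteq> elts (ap s m)" if "natural n" for n using that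
  proof (induction n rule: natural_induct)
    case dfn show ?case by (intro vdi)
  next
    case (succ n)
    have "elts (ap s (vsucc n)) \<subseteq> elts (ap s n)" using s(2)[OF succ(1)] c(2)[OF sA[OF succ(1)]] by simp
    then show ?case using succ(2) by auto
  qed simp
  have v: "vd (\<lambda>e. e 1 \<in> elts (ap s (e 0)) \<and> omits (e 1) (ap s (vsucc (e 0))))" by (intro vdi)
  have ex: "\<exists>a. a \<in> elts (ap s n) \<and> omits a (ap s (vsucc n))" if "n \<in> elts omega" for n
  proof -
    have nn: "natural n" using that by simp
    show ?thesis unfolding s(2)[OF nn] using c(2)[OF sA[OF nn]] by blast
  qed
  obtain \<alpha> where \<alpha>: "vfun \<alpha> omega" "\<And>n. n \<in> elts omega \<Longrightarrow> ap \<alpha> n \<in> elts (ap s n) \<and> omits (ap \<alpha> n) (ap s (vsucc n))"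
    by (rule choose_fun[of "\<lambda>n a. a \<in> elts (ap s n) \<and> omits a (ap s (vsucc n))" omega, OF v ex]) blast+
  have sL: "elts (ap s n) \<subseteq> elts L" if "natural n" for n using sA[OF that] unfolding SA by blast
  have \<alpha>T: "\<alpha> \<in> elts (vfuns omega L)" using \<alpha> sL by auto
  obtain m where m: "natural m" "\<And>n. natural n \<Longrightarrow> m \<in> elts n \<Longrightarrow> ap (ap r \<alpha>) n = ap \<alpha> n"
    using r(1)[OF \<alpha>T] unfolding tail_eq_def by auto
  \<comment> \<open>One more than \<open>m\<close>, so that at index \<open>k\<close> the
    representative of \<open>\<alpha>\<close> already agrees with \<open>\<alpha>\<close>.\<close>
  define k where "k = vsucc m"
  have k: "natural k" "m \<in> elts k" using m(1) natural_vsucc by (auto simp: k_def)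
  have sk: "natural (vsucc k)" by (rule natural_vsucc[OF k(1)])
  \<comment> \<open>\<open>t\<close> copies \<open>\<alpha>\<close> strictly beyond \<open>k\<close>
    and up to \<open>k\<close> repeats the value of \<open>\<alpha>\<close> at \<open>k+1\<close>.
    All its values thus lie in the set with index \<open>k+1\<close>, although its representative
    takes at \<open>k\<close> the value that this set omits.\<close>
  define F where "F n = (if k \<in> elts n then ap \<alpha> n else ap \<alpha> (vsucc k))" for n
  have dF: "dt (\<lambda>e. F (e 0))" unfolding F_def by (intro vdi)
  define t where "t = vlam omega F"
  have t: "vfun t omega" "\<And>n. natural n \<Longrightarrow> ap t n = F n" unfolding t_def by (simp_all add: vlam_vfun dF)
  have tB: "\<forall>n\<in>elts omega. ap t n \<in> elts (ap s (vsucc k))"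
  proof
    fix n :: 'a assume "n \<in> elts omega"
    then have nn: "natural n" by simp
    show "ap t n \<in> elts (ap s (vsucc k))"
    proof (cases "k \<in> elts n")
      case True
      have "Ord n" "Ord (vsucc k)" using nn sk natural_iff by blast+
      then have "vsucc k = n \<or> vsucc k \<in> elts n" using Ord_linear[of n "vsucc k"] True mem_asym by auto
      then have "elts (ap s n) \<subseteq> elts (ap s (vsucc k))" using dec[OF nn] by blast
      then show ?thesis using \<alpha>(2)[of n] nn True by (auto simp: t(2) F_def)
    next
      case False
      then show ?thesis using \<alpha>(2)[of "vsucc k"] nn sk by (simp add: t(2) F_def)
    qed
  qed
  have tT: "t \<in> elts (vfuns omega L)" using t(1) tB sL[OF sk] by auto
  have "tail_eq t \<alpha>" unfolding tail_eq_def by (rule bexI[of _ k]) (auto simp: t(2) F_def k(1))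
  then have "ap r t = ap r \<alpha>" by (rule r(2)[OF tT \<alpha>T])
  then have "ap (ap r t) k = ap \<alpha> k" using m(2)[OF k] by simp
  moreover have "omits (ap \<alpha> k) (ap s (vsucc k))" using \<alpha>(2) k(1) by simp
  ultimately show False unfolding omits_def using t(1) tB k(1) by auto
qed

context uf
begin

text \<open>Instead of an element that is moved, surjectivity of \<open>J\<close> on
  \<open>L\<close> is concluded. The image \<open>B\<close> of the Jonsson set \<open>A\<close> is a
  full-size subset of \<open>J A\<close>, so by elementarity every element of \<open>J A\<close> is
  produced by \<open>J r\<close> from a sequence in \<open>B\<close>. Such a sequence is the image
  of a sequence in \<open>A\<close>, so its products are values of \<open>J\<close>.\<close>

lemma kunen:
  assumes JL: "J L = L" and Pow: "\<And>A. elts A \<subseteq> elts L \<Longrightarrow> A \<in> MU" and fin: "\<And>b. b \<in> elts L \<Longrightarrow> finord UNIV b"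
    and y: "y \<in> elts L"
  shows "\<exists>z\<in>elts L. y = J z"
proof -
  have LM: "L \<in> MU" using Pow by blast
  have JinL: "J b \<in> elts L" if "b \<in> elts L" for b using J_mem[of b L] JL that by simp
  have im: "elts (vset (J ` elts A)) = J ` elts A" for A by (intro elts_vset small_image dt_J vdi)
  \<comment> \<open>The range of \<open>J\<close> on \<open>L\<close> is a subset of
    \<open>L\<close>, hence available in the ultrapower; \<open>J_restr_range\<close> recovers
    \<open>J\<close> on \<open>L\<close> from it.\<close>
  have "vset (J ` elts L) \<in> MU" by (rule Pow) (use im JinL in auto)
  then obtain k where k: "k \<in> MU" "\<And>b. b \<in> elts L \<Longrightarrow> ap k b = J b"
    using J_restr_range[OF LM fin _ im] by blast
  obtain r where r: "vfun r (vfuns omega L)"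
    "\<And>t. t \<in> elts (vfuns omega L) \<Longrightarrow> ap r t \<in> elts (vfuns omega L) \<and> tail_eq (ap r t) t"
    "\<And>t t'. t \<in> elts (vfuns omega L) \<Longrightarrow> t' \<in> elts (vfuns omega L) \<Longrightarrow> tail_eq t t' \<Longrightarrow> ap r t = ap r t'"
    using tail_selector[of L] by blast
  obtain A where A: "elts A \<subseteq> elts L" "big UNIV L A" "jonsson UNIV L r A" using jonsson_ex[of L r, OF r(2,3)] by blast
  obtain g where g: "vfun g L" "\<forall>x\<in>elts L. ap g x \<in> elts A" "\<forall>x\<in>elts L. \<forall>y\<in>elts L. ap g x = ap g y \<longrightarrow> x = y"
    using A(2) unfolding big_def by blast
  define B where "B = vset (J ` elts A)"
  have B: "elts B = J ` elts A" unfolding B_def by (rule im)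
  have jJ: "jonsson MU L (J r) (J A)"
    using elem3[of jonsson L r A, OF pd_jonsson] A(3) JL by simp
  have BA: "elts B \<subseteq> elts (J A)" unfolding B by (auto simp: J_mem)
  have BM: "B \<in> MU" by (rule Pow) (use B A(1) JinL in auto)
  have "big MU L B"
  proof -
    have d: "dt (\<lambda>e. J (ap g (e 0)))" by (intro vdi dt_J)
    define h where "h = vlam L (\<lambda>x. J (ap g x))"
    have h: "vfun h L" "\<And>x. x \<in> elts L \<Longrightarrow> ap h x = J (ap g x)"
      unfolding h_def by (rule vlam_vfun[OF d], rule ap_vlam[OF d])
    have "h \<in> MU" by (rule closure_all[OF LM k h(1)]) (simp_all add: h(2) J_in)
    then show ?thesis unfolding big_def using h g(2,3) J_inj by (intro bexI[of _ h]) (auto simp: B)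
  qed
  then have all: "\<exists>t\<in>MU. vfun t omega \<and> (\<forall>n\<in>elts omega. ap t n \<in> elts B) \<and> (\<exists>n\<in>elts omega. ap (ap (J r) t) n = a)"
    if "a \<in> elts (J A)" for a using jJ BM BA that unfolding jonsson_def by blast
  have ran: "\<exists>c. a = J c" if aA: "a \<in> elts (J A)" for a
  proof -
    obtain t n where t: "vfun t omega" "\<And>n. natural n \<Longrightarrow> ap t n \<in> elts B" "natural n" "ap (ap (J r) t) n = a"
      using all[OF aA] by auto
    have v: "vd (\<lambda>e. e 1 \<in> elts A \<and> ap t (e 0) = J (e 1))" by (intro vdi dt_J)
    have ex: "\<exists>x. x \<in> elts A \<and> ap t n = J x" if "n \<in> elts omega" for n using t(2)[of n] that B by auto
    obtain t' where t': "vfun t' omega" "\<And>n. n \<in> elts omega \<Longrightarrow> ap t' n \<in> elts A \<and> ap t n = J (ap t' n)"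
      by (rule choose_fun[of "\<lambda>n x. x \<in> elts A \<and> ap t n = J x" omega, OF v ex]) blast+
    have Jt: "ap (J u) n = J (ap u n)" if "vfun u omega" "natural n" for u n
      using J_ap[OF that(1), of n] J_natural[OF that(2)] that(2) by simp
    have "J t' = t"
    proof (rule vfun_ext[OF _ t(1)])
      show "vfun (J t') omega" using J_vfun[OF t'(1)] J_omega by simp
      show "ap (J t') n = ap t n" if "n \<in> elts omega" for n using Jt[OF t'(1), of n] t'(2)[of n] that by simp
    qed
    moreover have tT: "t' \<in> elts (vfuns omega L)" using t' A(1) by auto
    ultimately have "ap (J r) t = J (ap r t')" using J_ap[OF r(1) tT] by simp
    moreover have "vfun (ap r t') omega" using r(2)[OF tT] by simp
    ultimately have "a = J (ap (ap r t') n)" using t(4) Jt[OF _ t(3)] by simp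
    then show ?thesis by blast
  qed
  \<comment> \<open>By elementarity \<open>J g\<close> injects \<open>L\<close> into
    \<open>J A\<close>; so surjectivity of \<open>J\<close> onto \<open>J A\<close> pulls back to
    surjectivity onto \<open>L\<close>.\<close>
  have Jg: "vfun (J g) L" using J_vfun[OF g(1)] JL by simp
  have p1: "pd (\<lambda>M e. \<forall>x\<in>elts (e 1). ap (e 0) x \<in> elts (e 2))" by (intro pdi)
  have "\<forall>x\<in>elts L. ap (J g) x \<in> elts (J A)"
    using elem3[of "\<lambda>M g L A. \<forall>x\<in>elts L. ap g x \<in> elts A" g L A, OF p1] g(2) JL by simp
  then obtain c where c: "ap (J g) y = J c" using ran y by blast
  have p2: "pd (\<lambda>M e. \<exists>z\<in>elts (e 1). ap (e 0) z = e 2)" by (intro pdi)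
  have "\<exists>z\<in>elts (J L). ap (J g) z = J c" unfolding JL using c y by blast
  then obtain z where z: "z \<in> elts L" "ap g z = c"
    using elem3[of "\<lambda>M g L c. \<exists>z\<in>elts L. ap g z = c" g L c, OF p2] by blast
  have p3: "pd (\<lambda>M e. \<forall>x\<in>elts (e 1). \<forall>y\<in>elts (e 1). ap (e 0) x = ap (e 0) y \<longrightarrow> x = y)" by (intro pdi)
  have inj: "\<forall>x\<in>elts L. \<forall>y\<in>elts L. ap (J g) x = ap (J g) y \<longrightarrow> x = y"
    using elem2[of "\<lambda>M g L. \<forall>x\<in>elts L. \<forall>y\<in>elts L. ap g x = ap g y \<longrightarrow> x = y" g L, OF p3] g(3) JL by simp
  have "ap (J g) (J z) = ap (J g) y" using J_ap[OF g(1) z(1)] z(2) c by simp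
  then have "y = J z" using inj y JinL[OF z(1)] by blast
  then show ?thesis using z(1) by blast
qed

end

section \<open>The Mitchell order on Dodd solid ultrafilters\<close>

lemma inner_model_ap: assumes "inner_model M" "f \<in> M" "x \<in> M" shows "ap f x \<in> M"
proof -
  have "case_nat f (\<lambda>_. x) i \<in> M" for i using assms(2,3) by (simp split: nat.split)
  from pt_in[OF pt_ap0 assms(1), of "case_nat f (\<lambda>_. x)", OF this] show ?thesis by simp
qed

lemma has_size_swap:
  assumes "has_size b n" "\<xi> \<in> elts b" "\<beta> \<notin> elts b" "elts c = insert \<beta> (elts b - {\<xi>})"
  shows "has_size c n"
proof -
  obtain f where f: "bij_fun f n b" using assms(1) has_size_iff by blast
  define F where "F x = (if ap f x = \<xi> then \<beta> else ap f x)" for x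
  have dF: "dt (\<lambda>e. F (e 0))" unfolding F_def by (intro vdi)
  have g: "vfun (vlam n F) n" "\<And>x. x \<in> elts n \<Longrightarrow> ap (vlam n F) x = F x" by (simp_all add: vlam_vfun dF)
  have fb: "bij_betw (ap f) (elts n) (elts b)" using f bij_fun_iff by blast
  have "bij_betw F (elts n) (elts c)" unfolding bij_betw_def
  proof
    show "inj_on F (elts n)"
    proof (rule inj_onI)
      fix x y assume xy: "x \<in> elts n" "y \<in> elts n" "F x = F y"
      then have "ap f x \<in> elts b" "ap f y \<in> elts b" using fb unfolding bij_betw_def by blast+
      then have "ap f x = ap f y" using xy(3) assms(3) unfolding F_def by (auto split: if_splits)
      then show "x = y" using fb xy(1,2) unfolding bij_betw_def inj_on_def by blast
    qed
    have im: "ap f ` elts n = elts b" using fb unfolding bij_betw_def by blast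
    have "F ` elts n = (\<lambda>z. if z = \<xi> then \<beta> else z) ` ap f ` elts n" unfolding F_def image_image ..
    also have "\<dots> = elts c" unfolding im assms(4) using assms(2) by auto
    finally show "F ` elts n = elts c" .
  qed
  then have "bij_betw (ap (vlam n F)) (elts n) (elts c)" using bij_betw_cong[of "elts n" "ap (vlam n F)" F] g(2) by simp
  then show ?thesis unfolding has_size_iff bij_fun_iff using g(1) by blast
qed

context uf
begin

lemma J_nsubsets:
  assumes n: "natural n" and \<kappa>: "J \<kappa> = \<kappa>" and M: "nsubsets \<kappa> n \<in> MU"
  shows "J (nsubsets \<kappa> n) = nsubsets \<kappa> n"
proof (rule eltsI, rule iffI)
  let ?S = "nsubsets \<kappa> n"
  have Jn: "J n = n" by (rule J_natural[OF n])
  fix b assume b: "b \<in> elts (J ?S)"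
  have p: "pd (\<lambda>M e. \<forall>b\<in>elts (e 0). elts b \<subseteq> elts (e 1) \<and> (\<exists>f\<in>M. bij_fun f (e 2) b))" by (intro pdi)
  have "\<forall>b\<in>elts ?S. elts b \<subseteq> elts \<kappa> \<and> (\<exists>f\<in>UNIV. bij_fun f n b)" by (simp add: elts_nsubsets has_size_iff)
  then have "\<forall>b\<in>elts (J ?S). elts b \<subseteq> elts (J \<kappa>) \<and> (\<exists>f\<in>MU. bij_fun f (J n) b)"
    using elem3[of "\<lambda>M s k n. \<forall>b\<in>elts s. elts b \<subseteq> elts k \<and> (\<exists>f\<in>M. bij_fun f n b)" ?S \<kappa> n, OF p] by blast
  then have "elts b \<subseteq> elts \<kappa>" "\<exists>f. bij_fun f n b" using b unfolding Jn \<kappa> by blast+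
  then show "b \<in> elts ?S" unfolding elts_nsubsets has_size_iff by blast
next
  let ?S = "nsubsets \<kappa> n"
  have Jn: "J n = n" by (rule J_natural[OF n])
  fix b assume b: "b \<in> elts ?S"
  then have bM: "b \<in> MU" using Ult_trans[OF M] by blast
  obtain f where f: "bij_fun f n b" and bk: "elts b \<subseteq> elts \<kappa>" using b unfolding elts_nsubsets has_size_iff by blast
  have "f \<in> MU"
  proof (rule closure_fixed[of n])
    show "n \<in> MU" using J_in[of n] Jn by simp
    show "J a = a" if "a \<in> elts n" for a using J_natural natural_in[OF n that] by blast
    show "vfun f n" using f unfolding bij_fun_def by blast
    show "ap f a \<in> MU" if "a \<in> elts n" for a using f that Ult_trans[OF bM] unfolding bij_fun_def by blast
  qed
  have p: "pd (\<lambda>M e. \<forall>b\<in>M. \<forall>f\<in>M. elts b \<subseteq> elts (e 1) \<and> bij_fun f (e 2) b \<longrightarrow> b \<in> elts (e 0))" by (intro pdi)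
  have "\<forall>b\<in>UNIV. \<forall>f\<in>UNIV. elts b \<subseteq> elts \<kappa> \<and> bij_fun f n b \<longrightarrow> b \<in> elts ?S" unfolding elts_nsubsets has_size_iff by blast
  then have "\<forall>b\<in>MU. \<forall>f\<in>MU. elts b \<subseteq> elts (J \<kappa>) \<and> bij_fun f (J n) b \<longrightarrow> b \<in> elts (J ?S)"
    using elem3[of "\<lambda>M s k n. \<forall>b\<in>M. \<forall>f\<in>M. elts b \<subseteq> elts k \<and> bij_fun f n b \<longrightarrow> b \<in> elts s" ?S \<kappa> n, OF p] by blast
  then show "b \<in> elts (J ?S)" unfolding Jn \<kappa> using bM \<open>f \<in> MU\<close> bk f by blast
qed

end

context dodd
begin

text \<open>If \<open>J\<close> fixed \<open>\<kappa>0\<close>, Kunen's inconsistency would make \<open>J\<close> surjective on \<open>\<kappa>0\<close>; then the finite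
  set \<open>[id]\<close> would be in the range of \<open>J\<close> and \<open>U\<close> would be principal.\<close>

lemma space_moved:
  assumes "dodd U0 X0 \<kappa>0 n0" and U0: "U0 \<in> MU" and le: "elts \<kappa> \<subseteq> elts \<kappa>0"
  shows "\<kappa>0 \<in> elts (J \<kappa>0)"
proof (rule ccontr)
  interpret A: dodd U0 X0 \<kappa>0 n0 by fact
  assume "\<kappa>0 \<notin> elts (J \<kappa>0)"
  then have fix0: "J \<kappa>0 = \<kappa>0" using J_ge[OF A.Ord_\<kappa>] by simp
  have U0e: "A \<in> MU" if "A \<in> elts U0" for A using Ult_trans[OF U0 that] .
  have X0M: "X0 \<in> MU" by (rule U0e[OF A.X_in])
  have JX: "J X0 = X0" using J_nsubsets[OF A.nat_n fix0] X0M unfolding A.X_eq by blast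
  \<comment> \<open>Either the subset or its complement in \<open>X0\<close> belongs to
    \<open>U0\<close>, and so enters the ultrapower together with \<open>U0\<close>.\<close>
  have Pow0: "A \<in> MU" if A: "elts A \<subseteq> elts X0" for A
  proof (cases "A \<in> elts U0")
    case False
    define C where "C = vset {x \<in> elts X0. x \<notin> elts A}"
    have C: "elts C = {x \<in> elts X0. x \<notin> elts A}" unfolding C_def by (intro elts_vset small_sep vdi)
    have "C \<in> elts U0" unfolding C_def using A.uf A False unfolding cc_ultrafilter_on_iff by blast
    then have CM: "C \<in> MU" by (rule U0e)
    have "pt (\<lambda>M e. vset {x \<in> elts (e 0). x \<notin> elts (e 1)})" by (intro pdi)
    from pt_in[OF this inner_model_MU, of "case_nat X0 (\<lambda>_. C)"] have "vset {x \<in> elts X0. x \<notin> elts C} \<in> MU"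
      using X0M CM by (simp split: nat.split)
    moreover have "{x \<in> elts X0. x \<notin> elts C} = elts A" using A C by blast
    ultimately show ?thesis by simp
  qed (rule U0e)
  note kunen0 = kunen[OF JX Pow0 A.X_finord]
  have fin: "elts (J c) = J ` elts c" if "finord UNIV c" for c
  proof -
    obtain n f where n: "natural n" "bij_fun f n c" using \<open>finord UNIV c\<close> unfolding finord_def by auto
    have "elts c = ap f ` elts n" using n(2) unfolding bij_fun_iff bij_betw_def by blast
    then show ?thesis by (rule J_finite[OF n(1)])
  qed
  \<comment> \<open>Exchanging an element of a nonempty point of \<open>X0\<close> for
    \<open>\<beta>\<close> gives a point that contains \<open>\<beta>\<close>. By Kunen this point
    is \<open>J d\<close> with \<open>d\<close> finite, so its elements are values of
    \<open>J\<close>.\<close>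
  have ran: "\<exists>\<gamma>. \<beta> = J \<gamma>" if \<beta>: "\<beta> \<in> elts \<kappa>0" for \<beta>
  proof -
    have "ae U0 (\<lambda>b. b \<noteq> v0)" by (rule A.nonprin)
    then obtain b where b: "b \<in> elts X0" "b \<noteq> v0" using A.ae_ex by blast
    then obtain \<xi> where \<xi>: "\<xi> \<in> elts b" using empty_v0[of b] by blast
    have "\<exists>b\<in>elts X0. \<beta> \<in> elts b"
    proof (cases "\<beta> \<in> elts b")
      case True then show ?thesis using b(1) by blast
    next
      case False
      define c where "c = vset (insert \<beta> (elts (vset {x \<in> elts b. x \<noteq> \<xi>})))"
      have e: "elts (vset {x \<in> elts b. x \<noteq> \<xi>}) = {x \<in> elts b. x \<noteq> \<xi>}" by (intro elts_vset small_sep vdi)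
      have "elts c = insert \<beta> (elts (vset {x \<in> elts b. x \<noteq> \<xi>}))" unfolding c_def by (rule elts_vset[OF small_insert])
      then have c: "elts c = insert \<beta> (elts b - {\<xi>})" unfolding e by blast
      have "has_size c n0" using has_size_swap[OF _ \<xi> False c] b(1) unfolding A.X_eq elts_nsubsets by blast
      then have "c \<in> elts X0" using b(1) \<beta> c unfolding A.X_eq elts_nsubsets by auto
      then show ?thesis using c by blast
    qed
    then obtain b where b: "b \<in> elts X0" "\<beta> \<in> elts b" by blast
    then obtain d where d: "d \<in> elts X0" "b = J d" using kunen0 by blast
    then show ?thesis using b(2) fin[OF A.X_finord[OF d(1)]] by blast
  qed
  have p: "pd (\<lambda>M e. elts (e 0) \<subseteq> elts (e 1))" by (intro pdi)
  have "elts idU \<subseteq> elts (J \<kappa>)"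
    unfolding id_cls J_cls los2[of "\<lambda>M x y. elts x \<subseteq> elts y", OF p I_fun K_fun] by (rule ae_triv) (simp add: X_sub)
  also have "\<dots> \<subseteq> elts \<kappa>0" using le J_subset[of \<kappa> \<kappa>0] fix0 by simp
  finally have idk: "elts idU \<subseteq> elts \<kappa>0" .
  have p: "pd (\<lambda>M e. finord M (e 0))" by (intro pdi)
  have "finord MU idU" unfolding id_cls los1[of finord, OF p I_fun] by (rule ae_triv) (simp add: X_finord)
  then obtain m f where m: "natural m" "bij_fun f m idU" unfolding finord_def by auto
  have f: "elts idU = ap f ` elts m" using m(2) unfolding bij_fun_iff bij_betw_def by blast
  have v: "vd (\<lambda>e. ap f (e 0) = J (e 1))" by (intro vdi dt_J)
  have ex: "\<exists>\<gamma>. ap f i = J \<gamma>" if "i \<in> elts m" for i using ran idk f that by blast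
  obtain s where s: "vfun s m" "\<And>i. i \<in> elts m \<Longrightarrow> ap f i = J (ap s i)"
    by (rule choose_fun[of "\<lambda>i \<gamma>. ap f i = J \<gamma>" m, OF v ex]) blast+
  \<comment> \<open>The preimages of the finitely many elements of \<open>[id]\<close>; being
    finite, \<open>d\<close> is mapped pointwise, so \<open>J d\<close> is the seed and
    \<open>U\<close> concentrates on \<open>d\<close>.\<close>
  define d where "d = vset (ap s ` elts m)"
  have d: "elts d = ap s ` elts m" unfolding d_def by (intro elts_vset small_image vdi)
  have "elts (J d) = elts idU" unfolding J_finite[OF m(1) d] unfolding d f image_image by (rule image_cong) (simp_all add: s(2))
  then have "J d = idU" by (rule extensionality)
  then have "ae U (\<lambda>x. ap (K d) x = ap I x)" unfolding J_cls id_cls cls_eq[OF UNIV_I K_fun UNIV_I I_fun] .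
  then have "ae U (\<lambda>x. x = d)" by (rule ae_mono) simp
  from ae_ex[OF ae_conj[OF this nonprin[of d]]] show False by blast
qed

end

text \<open>If \<open>U1\<close> is below \<open>U0 = [f]\<^bsub>U1\<^esub>\<close> in the Ketonen order, the spaces of the \<open>f x\<close> are smaller than that
  of \<open>U0\<close>, so \<open>f x \<in> Ult(V,U0)\<close>; by closure \<open>f \<in> Ult(V,U0)\<close>, and \<open>U0 \<in> Ult(V,U0)\<close>.\<close>

lemma no_cycle:
  assumes UA: "ultrapower_axiom TYPE('v::zfc)"
    and d0: "dodd U0 X0 \<kappa>0 n0" and d1: "dodd (U1 :: 'v) X1 \<kappa>1 n1"
    and s: "seed X1 U1 U0" and mem: "U0 \<in> Ult UNIV U1"
  shows False
proof -
  interpret A: dodd U0 X0 \<kappa>0 n0 by (rule d0)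
  interpret B: dodd U1 X1 \<kappa>1 n1 by (rule d1)
  have le: "elts \<kappa>1 \<subseteq> elts \<kappa>0" by (rule seed_sp[OF B.unif_axioms A.unif_axioms s])
  have moved: "\<kappa>0 \<in> elts (B.J \<kappa>0)" by (rule B.space_moved[OF d0 mem le])
  have X1fin: "elts X1 \<subseteq> elts (finsubsets \<kappa>0)" using B.X_fin le unfolding elts_finsubsets by blast
  have U1M: "U1 \<in> A.MU" by (rule A.seed_in[OF B.uf_axioms X1fin s])
  interpret N: emuf A.MU U1 X1 by unfold_locales (rule A.inner_model_MU, rule cc_restrict[OF B.uf U1M])
  obtain f where f: "vfun f X1" "U0 = B.cls f" using mem by (rule B.UltE) blast
  have X0M: "X0 \<in> B.MU" by (rule B.Ult_trans[OF mem A.X_in])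
  obtain F where F: "vfun F X1" "X0 = B.cls F" using X0M by (rule B.UltE) blast
  \<comment> \<open>In \<open>Ult(V,U1)\<close> the points of \<open>X0\<close> are subsets of
    \<open>\<kappa>0\<close>, which is below its own image. By Los almost every
    \<open>ap f x\<close> is an ultrafilter on finite sets bounded by some \<open>\<alpha>\<close>
    below \<open>\<kappa>0\<close>.\<close>
  have p: "pd (\<lambda>M e. cc_ultrafilter_on M (e 0) (e 1) \<and>
      (\<exists>\<alpha>\<in>elts (e 2). \<forall>b\<in>elts (e 0). finord M b \<and> elts b \<subseteq> elts \<alpha>))" by (intro pdi)
  have "\<forall>b\<in>elts X0. finord B.MU b \<and> elts b \<subseteq> elts \<kappa>0"
    using B.finord_MU[OF B.Ult_trans[OF X0M] A.X_finord] A.X_sub by blast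
  then have "cc_ultrafilter_on B.MU X0 U0 \<and> (\<exists>\<alpha>\<in>elts (B.J \<kappa>0). \<forall>b\<in>elts X0. finord B.MU b \<and> elts b \<subseteq> elts \<alpha>)"
    using cc_restrict[OF A.uf mem] moved by blast
  then have "ae U1 (\<lambda>x. cc_ultrafilter_on UNIV (ap F x) (ap f x) \<and>
      (\<exists>\<alpha>\<in>elts (ap (B.K \<kappa>0) x). \<forall>b\<in>elts (ap F x). finord UNIV b \<and> elts b \<subseteq> elts \<alpha>))"
    unfolding B.J_cls F(2) f(2) B.los3[of "\<lambda>M X U k. cc_ultrafilter_on M X U \<and>
      (\<exists>\<alpha>\<in>elts k. \<forall>b\<in>elts X. finord M b \<and> elts b \<subseteq> elts \<alpha>)", OF p F(1) f(1) B.K_fun] .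
  then have fM: "ae U1 (\<lambda>x. ap f x \<in> A.MU)"
  proof (rule B.ae_mono)
    fix x assume x: "x \<in> elts X1" and a: "cc_ultrafilter_on UNIV (ap F x) (ap f x) \<and>
      (\<exists>\<alpha>\<in>elts (ap (B.K \<kappa>0) x). \<forall>b\<in>elts (ap F x). finord UNIV b \<and> elts b \<subseteq> elts \<alpha>)"
    interpret D: uf "ap f x" "ap F x" by unfold_locales (use a in blast)
    obtain \<alpha> where \<alpha>: "\<alpha> \<in> elts \<kappa>0" "\<And>b. b \<in> elts (ap F x) \<Longrightarrow> finord UNIV b \<and> elts b \<subseteq> elts \<alpha>"
      using a x by auto
    have \<alpha>o: "Ord \<alpha>" by (rule Ord_in[OF A.Ord_\<kappa> \<alpha>(1)])
    have sub: "elts (ap F x) \<subseteq> elts (finsubsets \<kappa>0)"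
    proof
      fix b assume "b \<in> elts (ap F x)"
      then have b: "finord UNIV b" "elts b \<subseteq> elts \<alpha>" using \<alpha>(2) by blast+
      have "\<exists>n. natural n \<and> has_size b n" using b(1) unfolding finord_def has_size_iff by auto
      moreover have "elts b \<subseteq> elts \<kappa>0" using b(2) Ord_trans[OF A.Ord_\<kappa> \<alpha>(1)] by blast
      ultimately show "b \<in> elts (finsubsets \<kappa>0)" unfolding elts_finsubsets by blast
    qed
    \<comment> \<open>\<open>U0\<close> concentrates on sets not contained in
      \<open>\<alpha>\<close>, which cannot be below a subset of \<open>\<alpha>\<close>. Trichotomy
      then leaves \<open>ap f x\<close> below \<open>U0\<close>, and Dodd solidity of
      \<open>U0\<close> places it in the ultrapower.\<close>
    have "\<not> seed X0 U0 (ap f x)"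
    proof
      assume s: "seed X0 U0 (ap f x)"
      define C where "C = vset {b \<in> elts X0. \<not> elts b \<subseteq> elts \<alpha>}"
      have v: "vd (\<lambda>e. \<not> elts (e 0) \<subseteq> elts \<alpha>)" by (intro vdi)
      have C: "elts C = {b \<in> elts X0. \<not> elts b \<subseteq> elts \<alpha>}" unfolding C_def by (intro elts_vset small_sep v)
      have "C \<in> elts U0" unfolding C_def A.ae_iff_set[OF v, symmetric] by (rule A.ae_not_sub[OF \<alpha>(1)])
      then have "ae (ap f x) (\<lambda>x. \<exists>b\<in>elts C. fless b x)"
        using seed_meet[OF A.uf_axioms D.uf_axioms s] C by blast
      from D.ae_ex[OF this] obtain y b where "y \<in> elts (ap F x)" "b \<in> elts C" "fless b y" by blast
      then show False using fless_sub[OF \<alpha>o] \<alpha>(2) C by blast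
    qed
    moreover have "\<not> (\<forall>B. ae (ap f x) (\<lambda>x. x \<in> elts B) \<longleftrightarrow> ae U0 (\<lambda>x. x \<in> elts B))"
    proof
      assume "\<forall>B. ae (ap f x) (\<lambda>x. x \<in> elts B) \<longleftrightarrow> ae U0 (\<lambda>x. x \<in> elts B)"
      then have "ae U0 (\<lambda>y. y \<in> elts (ap F x))" using D.ae_carrier by blast
      from A.ae_ex[OF A.ae_conj[OF this A.ae_not_sub[OF \<alpha>(1)]]] \<alpha>(2) show False by blast
    qed
    ultimately have "seed (ap F x) (ap f x) U0"
      using trichotomy[OF UA D.uf_axioms A.uf_axioms] \<alpha>(2) A.X_finord by blast
    then show "ap f x \<in> A.MU" by (rule A.seed_in[OF D.uf_axioms sub])
  qed
  \<comment> \<open>If the set \<open>T\<close> of exceptions were large for \<open>U1\<close>, then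
    by \<open>seed_meet\<close> almost every \<open>x\<close> of the space of \<open>U0\<close>
    would have an exception below it, and so would be above the least exception \<open>b\<close>;
    but then \<open>b\<close> is no exception.\<close>
  have S0: "ae U1 (\<lambda>b. ae U0 (\<lambda>x. fless b x))"
  proof (rule ccontr)
    assume "\<not> ?thesis"
    then have n: "ae U1 (\<lambda>b. \<not> ae U0 (\<lambda>x. fless b x))" by (subst B.ae_not) (intro vdi)
    have v: "vd (\<lambda>e. \<not> ae U0 (\<lambda>x. fless (e 0) x))" by (intro vdi)
    define T where "T = vset {b \<in> elts X1. \<not> ae U0 (\<lambda>x. fless b x)}"
    have T: "elts T = {b \<in> elts X1. \<not> ae U0 (\<lambda>x. fless b x)}" unfolding T_def by (intro elts_vset small_sep v)
    have TU: "T \<in> elts U1" unfolding T_def B.ae_iff_set[OF v, symmetric] by (rule n)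
    obtain b0 where b0: "b0 \<in> elts X1" "\<not> ae U0 (\<lambda>x. fless b0 x)" using B.ae_ex[OF n] by blast
    obtain b where b: "b \<in> elts X1" "\<not> ae U0 (\<lambda>x. fless b x)" "\<And>y. y \<in> elts X1 \<Longrightarrow> \<not> ae U0 (\<lambda>x. fless y x) \<Longrightarrow> \<not> fless y b"
      using wf_rel_min[OF fless_wf[OF B.X_hm] v b0] by blast
    have "ae U0 (\<lambda>x. \<exists>c\<in>elts T. fless c x)"
      using seed_meet[OF B.uf_axioms A.uf_axioms s _ TU] T by blast
    then have "ae U0 (\<lambda>x. fless b x)"
    proof (rule A.ae_mono)
      fix x assume x: "x \<in> elts X0" "\<exists>c\<in>elts T. fless c x"
      then obtain c where c: "c \<in> elts X1" "\<not> ae U0 (\<lambda>x. fless c x)" "fless c x" using T by blast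
      have "b = c \<or> fless b c" using fless_linear[OF B.X_hm[OF b(1)] B.X_hm[OF c(1)]] b(3)[OF c(1,2)] by blast
      then show "fless b x"
        using c(3) fless_trans[OF B.X_hm[OF b(1)] B.X_hm[OF c(1)] A.X_hm[OF x(1)]] by blast
    qed
    then show False using b(2) by blast
  qed
  obtain k where k: "k \<in> A.MU" "vfun k X1" "\<And>b. b \<in> elts X1 \<Longrightarrow> ae U0 (\<lambda>x. fless b x) \<Longrightarrow> ap k b = A.J b"
    using A.J_restr[OF X1fin] by blast
  have v0M: "v0 \<in> A.MU" using A.J_in[of v0] A.J_v0 by simp
  \<comment> \<open>\<open>k\<close> equals \<open>A.J\<close> only at almost all arguments, so
    \<open>A.closure\<close> reproduces a sequence only modulo \<open>U1\<close>. Outside the large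
    set \<open>C\<close> the values are replaced by \<open>v0\<close>, to stay inside the
    ultrapower.\<close>
  have into: "\<exists>g'\<in>A.MU. vfun g' X1 \<and> ueq U1 g' g" if g: "ae U1 (\<lambda>x. ap g x \<in> A.MU)" for g
  proof -
    obtain C where C: "C \<in> elts U1" "\<And>x. x \<in> elts C \<Longrightarrow> ap g x \<in> A.MU" using g unfolding ae_def by blast
    define G where "G x = (if x \<in> elts C then ap g x else v0)" for x
    have dG: "dt (\<lambda>e. G (e 0))" unfolding G_def by (intro vdi)
    have aG: "\<And>x. x \<in> elts X1 \<Longrightarrow> ap (vlam X1 G) x = G x" by (simp add: dG)
    have val: "ap (vlam X1 G) x \<in> A.MU" if "x \<in> elts X1" for x unfolding aG[OF that] G_def using C(2) v0M by simp
    obtain g' where g': "g' \<in> A.MU" "vfun g' X1" "\<And>a. a \<in> elts X1 \<Longrightarrow> ap k a = A.J a \<Longrightarrow> ap g' a = ap (vlam X1 G) a"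
      using A.closure[OF N.X_M k(1) val] by blast
    have CC: "ae U1 (\<lambda>x. x \<in> elts C)" unfolding ae_def using C(1) by blast
    have "ueq U1 g' g" unfolding ueq_def
      by (rule B.ae_mp[OF S0 CC]) (simp add: g'(3) k(3) aG G_def)
    then show ?thesis using g'(1,2) by blast
  qed
  obtain s' where s': "s' \<in> A.MU" "vfun s' X1" "ueq U1 s' f" using into[OF fM] by blast
  have "collapses_to A.MU X1 U1 s' (ult_class A.MU U1 s')" by (rule N.cls_collapses_to[OF s'(1,2)])
  then obtain t q where t: "t \<in> A.MU" "q \<in> A.MU" "collapse_on A.MU X1 U1 t q" "s' \<in> elts t" unfolding collapses_to_def by blast
  \<comment> \<open>The approximation found in \<open>Ult(V,U0)\<close> is one for the universe as
    well: by \<open>into\<close> every function below a member of \<open>t\<close> is represented in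
    that ultrapower. So both compute the same class of \<open>s'\<close>, namely
    \<open>U0\<close>.\<close>
  have "collapse_on UNIV X1 U1 t q" unfolding collapse_on_def
  proof (intro conjI)
    show "\<forall>f\<in>elts t. vfun f X1" "vfun q t"
      "\<forall>g\<in>elts t. (\<forall>y\<in>elts (ap q g). \<exists>f\<in>elts t. umem U1 f g \<and> y = ap q f) \<and>
        (\<forall>f\<in>elts t. umem U1 f g \<longrightarrow> ap q f \<in> elts (ap q g))"
      using t(3) unfolding collapse_on_def by blast+
    show "\<forall>g\<in>elts t. \<forall>f\<in>UNIV. vfun f X1 \<longrightarrow> umem U1 f g \<longrightarrow> (\<exists>f'\<in>elts t. ueq U1 f' f)"
    proof (intro ballI impI)
      fix g h assume g: "g \<in> elts t" and h: "vfun h X1" "umem U1 h g"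
      have gM: "g \<in> A.MU" by (rule A.Ult_trans[OF t(1) g])
      have "ap g x \<in> A.MU" if "x \<in> elts X1" for x
        by (rule inner_model_ap[OF A.inner_model_MU gM A.Ult_trans[OF N.X_M that]])
      then have "ae U1 (\<lambda>x. ap h x \<in> A.MU)"
        using A.Ult_trans by (intro B.ae_mono[OF h(2)[unfolded umem_def]]) blast
      then obtain h' where h': "h' \<in> A.MU" "vfun h' X1" "ueq U1 h' h" using into by blast
      have "umem U1 h' g" by (rule B.umem_ueq[OF h(2) B.ueq_sym[OF h'(3)]])
      then obtain f' where "f' \<in> elts t" "ueq U1 f' h'" using t(3) g h'(1,2) unfolding collapse_on_def by blast
      then show "\<exists>f'\<in>elts t. ueq U1 f' h" using B.ueq_trans h'(3) by blast
    qed
  qed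
  then have "collapses_to UNIV X1 U1 s' (ap q s')" unfolding collapses_to_def using t(4) by blast
  then have "B.cls s' = ap q s'" by (rule B.cls_eqI)
  moreover have "B.cls s' = U0" unfolding f(2) B.cls_eq[OF UNIV_I s'(2) UNIV_I f(1)] using s'(3) unfolding ueq_def .
  moreover have "ap q s' \<in> A.MU" by (rule inner_model_ap[OF A.inner_model_MU t(2) s'(1)])
  ultimately show False using A.not_self by simp
qed

lemma mitchell_seed:
  assumes UA: "ultrapower_axiom TYPE('v::zfc)"
    and d0: "dodd U0 X0 \<kappa>0 n0" and d1: "dodd (U1 :: 'v) X1 \<kappa>1 n1" and m: "mitchell_less U0 U1"
  shows "seed X0 U0 U1"
proof -
  interpret A: dodd U0 X0 \<kappa>0 n0 by (rule d0)
  interpret B: dodd U1 X1 \<kappa>1 n1 by (rule d1)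
  have mem: "U0 \<in> B.MU" using m unfolding mitchell_less_def .
  consider "seed X0 U0 U1" | "seed X1 U1 U0" | "\<forall>B. ae U0 (\<lambda>x. x \<in> elts B) \<longleftrightarrow> ae U1 (\<lambda>x. x \<in> elts B)"
    using trichotomy[OF UA A.uf_axioms B.uf_axioms A.X_finord B.X_finord] by blast
  then show ?thesis
  proof cases
    case 2 then show ?thesis using no_cycle[OF UA d0 d1 _ mem] by blast
  next
    case 3
    then have "U0 = U1" by (intro unif_eq[OF A.unif_axioms B.unif_axioms]) blast
    then show ?thesis using mem B.not_self by simp
  qed
qed

lemma seed_mitchell:
  assumes d0: "dodd U0 X0 \<kappa>0 n0" and d1: "dodd U1 X1 \<kappa>1 n1" and s: "seed X0 U0 U1"
  shows "mitchell_less U0 U1"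
proof -
  interpret A: dodd U0 X0 \<kappa>0 n0 by (rule d0)
  interpret B: dodd U1 X1 \<kappa>1 n1 by (rule d1)
  have "elts \<kappa>0 \<subseteq> elts \<kappa>1" by (rule seed_sp[OF A.unif_axioms B.unif_axioms s])
  then have "elts X0 \<subseteq> elts (finsubsets \<kappa>1)" using A.X_fin unfolding elts_finsubsets by blast
  then show ?thesis unfolding mitchell_less_def by (rule B.seed_in[OF A.uf_axioms _ s])
qed

lemma mitchell_linear:
  assumes UA: "ultrapower_axiom TYPE('v::zfc)" and d: "dodd_solid U0" "dodd_solid (U1 :: 'v)"
  shows "U0 = U1 \<or> mitchell_less U0 U1 \<or> mitchell_less U1 U0"
proof -
  obtain X0 \<kappa>0 n0 where d0: "dodd U0 X0 \<kappa>0 n0" using d(1) by (rule doddE)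
  obtain X1 \<kappa>1 n1 where d1: "dodd U1 X1 \<kappa>1 n1" using d(2) by (rule doddE)
  interpret A: dodd U0 X0 \<kappa>0 n0 by (rule d0)
  interpret B: dodd U1 X1 \<kappa>1 n1 by (rule d1)
  consider "seed X0 U0 U1" | "seed X1 U1 U0" | "\<forall>B. ae U0 (\<lambda>x. x \<in> elts B) \<longleftrightarrow> ae U1 (\<lambda>x. x \<in> elts B)"
    using trichotomy[OF UA A.uf_axioms B.uf_axioms A.X_finord B.X_finord] by blast
  then show ?thesis
  proof cases
    case 1 then show ?thesis using seed_mitchell[OF d0 d1] by blast
  next
    case 2 then show ?thesis using seed_mitchell[OF d1 d0] by blast
  next
    case 3
    then have "U0 = U1" by (intro unif_eq[OF A.unif_axioms B.unif_axioms]) blast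
    then show ?thesis ..
  qed
qed

lemma mitchell_ketonen:
  assumes UA: "ultrapower_axiom TYPE('v::zfc)" and d: "dodd_solid U0" "dodd_solid (U1 :: 'v)"
    and m: "mitchell_less U0 U1"
  shows "ketonen U0 U1"
proof -
  obtain X0 \<kappa>0 n0 where d0: "dodd U0 X0 \<kappa>0 n0" using d(1) by (rule doddE)
  obtain X1 \<kappa>1 n1 where d1: "dodd U1 X1 \<kappa>1 n1" using d(2) by (rule doddE)
  show ?thesis by (rule seed_ketonen[OF _ _ mitchell_seed[OF UA d0 d1 m]]) (use d0 d1 in \<open>unfold dodd_def unif_def, blast+\<close>)
qed

lemma mitchell_trans:
  assumes UA: "ultrapower_axiom TYPE('v::zfc)"
    and d: "dodd_solid U0" "dodd_solid U1" "dodd_solid (U2 :: 'v)"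
    and m: "mitchell_less U0 U1" "mitchell_less U1 U2"
  shows "mitchell_less U0 U2"
proof (rule ccontr)
  assume n: "\<not> ?thesis"
  obtain X0 \<kappa>0 n0 where d0: "dodd U0 X0 \<kappa>0 n0" using d(1) by (rule doddE)
  obtain X1 \<kappa>1 n1 where d1: "dodd U1 X1 \<kappa>1 n1" using d(2) by (rule doddE)
  obtain X2 \<kappa>2 n2 where d2: "dodd U2 X2 \<kappa>2 n2" using d(3) by (rule doddE)
  interpret A: dodd U0 X0 \<kappa>0 n0 by (rule d0)
  interpret B: dodd U1 X1 \<kappa>1 n1 by (rule d1)
  interpret C: dodd U2 X2 \<kappa>2 n2 by (rule d2)
  have k: "ketonen U0 U1" "ketonen U1 U2" using mitchell_ketonen[OF UA] d m by blast+
  \<comment> \<open>If transitivity fails, linearity closes a Ketonen cycle of length two or three,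
    and the set of the three ultrafilters would have no minimal member.\<close>
  have "U2 = U0 \<or> ketonen U2 U0" using mitchell_linear[OF UA d(3) d(1)] n mitchell_ketonen[OF UA d(3) d(1)] by blast
  then have k2: "ketonen U1 U0 \<or> ketonen U2 U0" using k(2) by blast
  define Y where "Y = vset (elts X1 \<union> elts X2)"
  define H where "H = vset (elts X0 \<union> elts Y)"
  have Y: "elts Y = elts X1 \<union> elts X2" by (simp add: Y_def)
  have "elts H = elts X0 \<union> elts Y" by (simp add: H_def)
  then have H: "elts H = elts X0 \<union> elts X1 \<union> elts X2" unfolding Y by blast
  define P where "P = vset {U1, U2}"
  define S where "S = vset (insert U0 (elts P))"
  have P: "elts P = {U1, U2}" by (simp add: P_def)
  have "elts S = insert U0 (elts P)" by (simp add: S_def)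
  then have S: "elts S = {U0, U1, U2}" unfolding P .
  have "\<exists>m\<in>elts S. \<forall>V\<in>elts S. \<not> ketonen V m"
  proof (rule ketonen_wf[of H])
    show "has_maxima x" if "x \<in> elts H" for x using that A.X_hm B.X_hm C.X_hm unfolding H by blast
    show "cc_ultrafilter_on UNIV (carrier V) V \<and> elts (carrier V) \<subseteq> elts H" if "V \<in> elts S" for V
      using that A.uf B.uf C.uf A.carrier_eq B.carrier_eq C.carrier_eq unfolding S H by auto
    show "U0 \<in> elts S" by (simp add: S)
  qed
  then show False using k k2 unfolding S by auto
qed

lemma mitchell_least:
  assumes UA: "ultrapower_axiom TYPE('v::zfc)"
    and B: "definable_class B" "B \<subseteq> {U :: 'v. dodd_solid U}" "B \<noteq> {}"
  shows "\<exists>m\<in>B. \<forall>x\<in>B. x \<noteq> m \<longrightarrow> mitchell_less m x"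
proof -
  obtain p e where pe: "B = {x. sat p (case_nat x e)}" using B(1) unfolding definable_class_def by blast
  have vB: "vd (\<lambda>e'. e' 0 \<in> B)"
  proof -
    have v: "vd (\<lambda>e'. sat p (\<lambda>i. (case_nat (\<lambda>e'. e' 0) (\<lambda>i _. e i) i) e'))"
      by (rule vd_sat) (simp add: dt_var dt_const split: nat.split)
    have eq: "(\<lambda>e'. sat p (\<lambda>i. (case_nat (\<lambda>e'. e' 0) (\<lambda>i _. e i) i) e')) = (\<lambda>e'. e' 0 \<in> B)"
      unfolding pe mem_Collect_eq
      by (rule ext, rule arg_cong[where f = "sat p"], rule ext) (simp split: nat.split)
    show ?thesis using v unfolding eq .
  qed
  obtain U where U: "U \<in> B" using B(3) by blast
  obtain X \<kappa> n where d: "dodd U X \<kappa> n" using B(2) U doddE by blast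
  interpret A: dodd U X \<kappa> n by (rule d)
  define H where "H = finsubsets \<kappa>"
  \<comment> \<open>\<open>B\<close> may be a proper class, but its members that live on finite
    subsets of \<open>\<kappa>\<close>, the space of one chosen \<open>U\<close>, form a set. By
    \<open>seed_sp\<close> every Mitchell predecessor in \<open>B\<close> of a member of
    \<open>S\<close> is again in \<open>S\<close>, so a Ketonen-minimal member of \<open>S\<close>
    is least in all of \<open>B\<close>.\<close>
  define S where "S = vset {V \<in> elts (vPow (vPow H)). V \<in> B}"
  have S: "elts S = {V \<in> elts (vPow (vPow H)). V \<in> B}" unfolding S_def by (intro elts_vset small_sep vB)
  have SI: "V \<in> elts S" if V: "dodd V Y \<rho> l" "V \<in> B" "elts \<rho> \<subseteq> elts \<kappa>" for V Y \<rho> l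
  proof -
    interpret V: dodd V Y \<rho> l by (rule V(1))
    have "elts Y \<subseteq> elts H" using V.X_fin V(3) unfolding H_def elts_finsubsets by blast
    then show ?thesis unfolding S using V.sub V(2) by auto
  qed
  have "\<exists>m\<in>elts S. \<forall>V\<in>elts S. \<not> ketonen V m"
  proof (rule ketonen_wf[of H])
    show "has_maxima x" if "x \<in> elts H" for x using that finsubsets_finord[OF A.Ord_\<kappa>] finord_hm unfolding H_def by blast
    show "U \<in> elts S" by (rule SI[OF d U]) simp
    fix V assume V: "V \<in> elts S"
    then obtain Y \<rho> l where "dodd V Y \<rho> l" using B(2) doddE unfolding S by blast
    then interpret V: dodd V Y \<rho> l .
    have "elts Y \<subseteq> elts H" using V V.X_in unfolding S by auto
    then show "cc_ultrafilter_on UNIV (carrier V) V \<and> elts (carrier V) \<subseteq> elts H"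
      using V.uf unfolding V.carrier_eq by blast
  qed
  then obtain m where m: "m \<in> elts S" "\<And>V. V \<in> elts S \<Longrightarrow> \<not> ketonen V m" by blast
  have mB: "m \<in> B" using m(1) unfolding S by blast
  obtain Y \<rho> l where dm: "dodd m Y \<rho> l" using B(2) mB doddE by blast
  interpret V: dodd m Y \<rho> l by (rule dm)
  have YH: "elts Y \<subseteq> elts H" using m(1) V.X_in unfolding S by auto
  have le: "elts \<rho> \<subseteq> elts \<kappa>"
  proof -
    have "\<kappa> \<notin> elts \<rho>"
    proof
      assume "\<kappa> \<in> elts \<rho>"
      from V.ae_ex[OF V.ae_not_sub[OF this]] obtain b where "b \<in> elts Y" "\<not> elts b \<subseteq> elts \<kappa>" by blast
      then show False using YH unfolding H_def elts_finsubsets by blast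
    qed
    then show ?thesis using Ord_linear[OF V.Ord_\<kappa> A.Ord_\<kappa>] Ord_trans[OF A.Ord_\<kappa>] by blast
  qed
  have "mitchell_less m x" if x: "x \<in> B" "x \<noteq> m" for x
  proof (rule ccontr)
    assume "\<not> mitchell_less m x"
    then have l: "mitchell_less x m" using mitchell_linear[OF UA, of m x] x B(2) mB by blast
    obtain Z \<mu> j where dx: "dodd x Z \<mu> j" using B(2) x(1) doddE by blast
    interpret W: dodd x Z \<mu> j by (rule dx)
    have s: "seed Z x m" by (rule mitchell_seed[OF UA dx dm l])
    have "elts \<mu> \<subseteq> elts \<kappa>" using seed_sp[OF W.unif_axioms V.unif_axioms s] le by blast
    then have "x \<in> elts S" by (rule SI[OF dx x(1)])
    then show False using m(2) seed_ketonen[OF W.uf_axioms V.uf_axioms s] by blast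
  qed
  then show ?thesis using mB by blast
qed

theorem theorem5p9:
  assumes "ultrapower_axiom TYPE('v::zfc)"
  shows "wellorders_class mitchell_less {U :: 'v. dodd_solid U}"
  unfolding wellorders_class_def
proof (intro conjI allI impI)
  show "irreflp_on {U :: 'v. dodd_solid U} mitchell_less"
  proof (rule irreflp_onI)
    fix U :: 'v assume "U \<in> {U. dodd_solid U}"
    then obtain X \<kappa> n where "dodd U X \<kappa> n" using doddE by blast
    then show "\<not> mitchell_less U U" unfolding mitchell_less_def by (rule dodd.not_self)
  qed
  show "transp_on {U :: 'v. dodd_solid U} mitchell_less"
    by (rule transp_onI) (use mitchell_trans[OF assms] in blast)
  show "totalp_on {U :: 'v. dodd_solid U} mitchell_less"
    by (rule totalp_onI) (use mitchell_linear[OF assms] in blast)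
  fix B :: "'v set"
  assume "definable_class B \<and> B \<subseteq> {U. dodd_solid U} \<and> B \<noteq> {}"
  then show "\<exists>m\<in>B. \<forall>x\<in>B. x \<noteq> m \<longrightarrow> mitchell_less m x" using mitchell_least[OF assms] by blast
qed

end
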